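(* For a generic Gough-Stewart platform, the reciprocal twist mapping $\mathrm{Rec}:\Sigma\to Q$ can be extended to a regular mapping $\mathrm{Rec}^h:\Sigma^h\to Q$. The image by $\mathrm{Rec}^h$ of a point at infinity of $\Sigma^h$ in the direction $P$ is the point of $\mathbb{P}^5$ with homogeneous coordinates $\begin{pmatrix} \Omega_\infty \\ V_\infty \end{pmatrix}$ given by the homogeneous second degree formulas $$V_\infty=\frac{-1}{4}\sum_{\sigma\in\mathfrak{S}_6}\varepsilon(\sigma)\,[A_{\sigma(1)},A_{\sigma(2)},P]\,[A_{\sigma(3)},C_{\sigma(3)},P]\;C_{\sigma(4)}\times C_{\sigma(5)},$$ $$\Omega_\infty=\frac{1}{12}\left(\sum_{\sigma\in\mathfrak{S}_6}\varepsilon(\sigma)\,[C_{\sigma(1)},C_{\sigma(2)},C_{\sigma(3)}]\,[A_{\sigma(4)},A_{\sigma(5)},P]\right)P,$$ provided that $V_\infty$ and $\Omega_\infty$ do not both vanish at $P$.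
   Context: A Gough-Stewart platform (its architecture) is given by vectors $A_1,\dots,A_6\in\mathbb{R}^3$ and $b_1,\dots,b_6\in\mathbb{R}^3$; frames are chosen so that $A_1=b_1=0$. "Generic" means: for all architectures in some nonempty Zariski open subset of the real parameter space of architectures. Let $K=\mathbb{R}(\mathrm{SO}(3))$ be the field of rational functions on $\mathrm{SO}(3)$ and let $R$ be the generic rotation matrix (its entries are the coordinate functions in $K$). Dot product, cross product and mixed product $[U,V,W]=\det(U,V,W)$ are defined over $K$ by the usual formulas. $\mathfrak{S}_6$ is the symmetric group on $\{1,\dots,6\}$ and $\varepsilon(\sigma)$ the signature of $\sigma$. Put $B_i=Rb_i$, $C_i=B_i-A_i$, $P=(x,y,z)^{\mathsf T}$, and let $\mathrm{Jac}$ be the $6\times6$ matrix whose $i$-th row is $\big((C_i+P)^{\mathsf T},(A_i\times(C_i+P))^{\mathsf T}\big)$ (Plücker coordinates of the $i$-th limb). $\Sigma$ is the surface $\det(\mathrm{Jac})=0$ in affine 3-space over $K$ with coordinates $x,y,z$; $\Sigma^h\subset\mathbb{P}^3$ (homogeneous coordinates $(w:x:y:z)$, plane at infinity $w=0$) is its projective closure, a nonsingular projective cubic surface for a generic platform. The point at infinity in the direction $P=(x,y,z)^{\mathsf T}\ne0$ is $(0:x:y:z)$. A twist $\begin{pmatrix} \Omega \\ V \end{pmatrix}$ ($\Omega,V$ 3-dimensional) is reciprocal to the limbs at $P$ if $(C_i+P)\cdot V+(A_i\times(C_i+P))\cdot\Omega=0$ for $i=1,\dots,6$. For a generic platform $\mathrm{Jac}$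 has rank 5 at each point of $\Sigma$, and $\mathrm{Rec}:\Sigma\to\mathbb{P}^5(K)$ sends $P$ to the line of twists reciprocal to the limbs at $P$. Its image lies in the quadric surface $Q$ defined as follows: indices are ordered so that $A_5=\sum_{i=2}^4\alpha_iA_i$ and $A_6=\sum_{i=2}^4\beta_iA_i$ with $\alpha_i,\beta_i\in\mathbb{R}$, and $Q\subset\mathbb{P}^5(K)$ is given, in homogeneous coordinates $(\Omega,V)$, by $$V\cdot\Big(C_5-\sum_{i=2}^4\alpha_iC_i\Big)+[\Omega,A_5,C_5]-\sum_{i=2}^4\alpha_i[\Omega,A_i,C_i]=0,$$ $$V\cdot\Big(C_6-\sum_{i=2}^4\beta_iC_i\Big)+[\Omega,A_6,C_6]-\sum_{i=2}^4\beta_i[\Omega,A_i,C_i]=0,$$ $$[\Omega,A_3,A_4](V\cdot C_2+[\Omega,A_2,C_2])+[\Omega,A_4,A_2](V\cdot C_3+[\Omega,A_3,C_3])+[\Omega,A_2,A_3](V\cdot C_4+[\Omega,A_4,C_4])=0.$$ *)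

theory Defs
  imports
    "HOL-Analysis.Analysis"
    "HOL-Computational_Algebra.Polynomial"
    "HOL-Computational_Algebra.Fraction_Field"
    "HOL-Algebra.Algebraic_Closure_Type"
    "HOL-Library.Poly_Mapping"
begin

no_notation fps_nth (infixl \<open>$\<close> 75)

section \<open>SO(3) is irreducible\<close>

text \<open>Every rotation matrix is the matrix of a quaternion, so two rotations are joined by a
  rational curve in SO(3); hence polynomial functions on SO(3) form an integral domain.\<close>

definition quat_norm :: "real \<Rightarrow> real \<Rightarrow> real \<Rightarrow> real \<Rightarrow> real" where
  "quat_norm a b c d = a*a + b*b + c*c + d*d"

definition quat_mat :: "'a::comm_ring_1 \<Rightarrow> 'a \<Rightarrow> 'a \<Rightarrow> 'a \<Rightarrow> 'a^3^3" where
  "quat_mat a b c d = vector [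
     vector [a*a + b*b - c*c - d*d, 2*(b*c - a*d), 2*(b*d + a*c)],
     vector [2*(b*c + a*d), a*a - b*b + c*c - d*d, 2*(c*d - a*b)],
     vector [2*(b*d - a*c), 2*(c*d + a*b), a*a - b*b - c*c + d*d]]"

lemma rotation_matrix_quat:
  assumes "quat_norm a b c d \<noteq> 0"
  shows "rotation_matrix (\<chi> i j. quat_mat a b c d $ i $ j / quat_norm a b c d)"
proof -
  define n where "n = quat_norm a b c d"
  have n: "n \<noteq> 0" and nd: "n = a*a + b*b + c*c + d*d"
    using assms by (auto simp: n_def quat_norm_def)
  define e11 e12 e13 where e1: "e11 = a*a + b*b - c*c - d*d" "e12 = 2*(b*c - a*d)"
    "e13 = 2*(b*d + a*c)"
  define e21 e22 e23 where e2: "e21 = 2*(b*c + a*d)" "e22 = a*a - b*b + c*c - d*d"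
    "e23 = 2*(c*d - a*b)"
  define e31 e32 e33 where e3: "e31 = 2*(b*d - a*c)" "e32 = 2*(c*d + a*b)"
    "e33 = a*a - b*b - c*c + d*d"
  have mat: "quat_mat a b c d = vector [vector [e11, e12, e13], vector [e21, e22, e23],
      vector [e31, e32, e33]]"
    unfolding quat_mat_def e1 e2 e3 ..
  have col: "e11*e11 + e21*e21 + e31*e31 = n*n" "e12*e12 + e22*e22 + e32*e32 = n*n"
    "e13*e13 + e23*e23 + e33*e33 = n*n" "e11*e12 + e21*e22 + e31*e32 = 0"
    "e11*e13 + e21*e23 + e31*e33 = 0" "e12*e13 + e22*e23 + e32*e33 = 0"
    unfolding e1 e2 e3 nd by (simp_all add: algebra_simps)
  have cof: "e22*e33 - e23*e32 = n*e11" "e13*e32 - e12*e33 = n*e21" "e12*e23 - e13*e22 = n*e31"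
    unfolding e1 e2 e3 nd by (simp_all add: algebra_simps)
  have "e11*e22*e33 + e12*e23*e31 + e13*e21*e32 - e11*e23*e32 - e12*e21*e33 - e13*e22*e31
      = e11*(e22*e33 - e23*e32) + e21*(e13*e32 - e12*e33) + e31*(e12*e23 - e13*e22)"
    by (simp add: algebra_simps)
  also have "\<dots> = n * (e11*e11 + e21*e21 + e31*e31)"
    unfolding cof by (simp add: algebra_simps)
  finally have det: "e11*e22*e33 + e12*e23*e31 + e13*e21*e32 - e11*e23*e32 - e12*e21*e33
      - e13*e22*e31 = n*n*n"
    unfolding col by simp
  have "det (\<chi> i j. quat_mat a b c d $ i $ j / n) = (e11*e22*e33 + e12*e23*e31 + e13*e21*e32
      - e11*e23*e32 - e12*e21*e33 - e13*e22*e31) / (n*n*n)"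
    by (simp add: det_3 mat add_divide_distrib diff_divide_distrib)
  then have "det (\<chi> i j. quat_mat a b c d $ i $ j / n) = 1"
    unfolding det using n by simp
  moreover have "orthogonal_matrix (\<chi> i j. quat_mat a b c d $ i $ j / n)"
    unfolding orthogonal_matrix
    using n col
    by (simp add: vec_eq_iff forall_3 sum_3 matrix_matrix_mult_def transpose_def mat_def mat
        mult.commute flip: add_divide_distrib)
  ultimately show ?thesis
    unfolding rotation_matrix_def n_def by simp
qed

lemma orthonormal_cross:
  fixes a1 a2 a3 b1 b2 b3 c1 c2 c3 :: real
  assumes n: "a1*a1 + a2*a2 + a3*a3 = 1" "b1*b1 + b2*b2 + b3*b3 = 1" "c1*c1 + c2*c2 + c3*c3 = 1"
    and o: "b1*c1 + b2*c2 + b3*c3 = 0"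
    and d: "a1*(b2*c3 - b3*c2) + a2*(b3*c1 - b1*c3) + a3*(b1*c2 - b2*c1) = 1"
  shows "a1 = b2*c3 - b3*c2 \<and> a2 = b3*c1 - b1*c3 \<and> a3 = b1*c2 - b2*c1"
proof -
  define w1 w2 w3 where w: "w1 = b2*c3 - b3*c2" "w2 = b3*c1 - b1*c3" "w3 = b1*c2 - b2*c1"
  have "w1*w1 + w2*w2 + w3*w3 =
      (b1*b1 + b2*b2 + b3*b3) * (c1*c1 + c2*c2 + c3*c3) - (b1*c1 + b2*c2 + b3*c3)\<^sup>2"
    unfolding w by (simp add: algebra_simps power2_eq_square)
  also have "\<dots> = 1" using n o by simp
  finally have ww: "w1*w1 + w2*w2 + w3*w3 = 1" .
  have "a1*w1 + a2*w2 + a3*w3 = 1" using d unfolding w .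
  then have "(a1 - w1)\<^sup>2 + (a2 - w2)\<^sup>2 + (a3 - w3)\<^sup>2 = 0"
    using n(1) ww by (simp add: algebra_simps power2_eq_square)
  then have "a1 = w1 \<and> a2 = w2 \<and> a3 = w3"
    by (smt (verit) zero_le_power2 power_eq_0_iff)
  then show ?thesis unfolding w .
qed

lemma rotation_matrix_quat_ex:
  assumes "rotation_matrix (M :: real^3^3)"
  obtains a b c d where "quat_norm a b c d \<noteq> 0"
    "M = (\<chi> i j. quat_mat a b c d $ i $ j / quat_norm a b c d)"
proof -
  define m11 m12 m13 where m1: "m11 = M$1$1" "m12 = M$1$2" "m13 = M$1$3"
  define m21 m22 m23 where m2: "m21 = M$2$1" "m22 = M$2$2" "m23 = M$2$3"
  define m31 m32 m33 where m3: "m31 = M$3$1" "m32 = M$3$2" "m33 = M$3$3"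
  note m = m1[symmetric] m2[symmetric] m3[symmetric]
  have o1: "transpose M ** M = mat 1" and o2: "M ** transpose M = mat 1" and dt: "det M = 1"
    using assms by (auto simp: rotation_matrix_def orthogonal_matrix_def)
  have c: "m11*m11 + m21*m21 + m31*m31 = 1" "m12*m12 + m22*m22 + m32*m32 = 1"
    "m13*m13 + m23*m23 + m33*m33 = 1" "m11*m12 + m21*m22 + m31*m32 = 0"
    "m11*m13 + m21*m23 + m31*m33 = 0" "m12*m13 + m22*m23 + m32*m33 = 0"
    using o1
    by (simp_all add: vec_eq_iff forall_3 sum_3 matrix_matrix_mult_def transpose_def mat_def m)
  have r: "m11*m11 + m12*m12 + m13*m13 = 1" "m21*m21 + m22*m22 + m23*m23 = 1"
    "m31*m31 + m32*m32 + m33*m33 = 1" "m11*m21 + m12*m22 + m13*m23 = 0"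
    "m11*m31 + m12*m32 + m13*m33 = 0" "m21*m31 + m22*m32 + m23*m33 = 0"
    using o2
    by (simp_all add: vec_eq_iff forall_3 sum_3 matrix_matrix_mult_def transpose_def mat_def m)
  have d: "m11*m22*m33 + m12*m23*m31 + m13*m21*m32
           - m11*m23*m32 - m12*m21*m33 - m13*m22*m31 = 1"
    using dt by (simp add: det_3 m)
  have k1: "m11 = m22*m33 - m23*m32" "m12 = m23*m31 - m21*m33" "m13 = m21*m32 - m22*m31"
    using orthonormal_cross[OF r(1) r(2) r(3) r(6)] d by (simp_all add: algebra_simps)
  have k2: "m21 = m32*m13 - m33*m12" "m22 = m33*m11 - m31*m13" "m23 = m31*m12 - m32*m11"
    using orthonormal_cross[OF r(2) r(3) r(1)] r(5) d by (simp_all add: algebra_simps)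
  have k3: "m31 = m12*m23 - m13*m22" "m32 = m13*m21 - m11*m23" "m33 = m11*m22 - m12*m21"
    using orthonormal_cross[OF r(3) r(1) r(2) r(4)] d by (simp_all add: algebra_simps)
  have cz: "m11*m11 + m21*m21 + m31*m31 - 1 = 0"
    "m12*m12 + m22*m22 + m32*m32 - 1 = 0"
    "m13*m13 + m23*m23 + m33*m33 - 1 = 0"
    "m11*m12 + m21*m22 + m31*m32 = 0"
    "m11*m13 + m21*m23 + m31*m33 = 0"
    "m12*m13 + m22*m23 + m32*m33 = 0"
    using c by simp_all
  have rz: "m11*m11 + m12*m12 + m13*m13 - 1 = 0"
    "m21*m21 + m22*m22 + m23*m23 - 1 = 0"
    "m31*m31 + m32*m32 + m33*m33 - 1 = 0"
    "m11*m21 + m12*m22 + m13*m23 = 0"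
    "m11*m31 + m12*m32 + m13*m33 = 0"
    "m21*m31 + m22*m32 + m23*m33 = 0"
    using r by simp_all
  have k1z: "m11 - m22*m33 + m23*m32 = 0"
    "m12 - m23*m31 + m21*m33 = 0"
    "m13 - m21*m32 + m22*m31 = 0"
    using k1 by simp_all
  have k2z: "m21 - m13*m32 + m12*m33 = 0"
    "m22 - m11*m33 + m13*m31 = 0"
    "m23 - m12*m31 + m11*m32 = 0"
    using k2 by simp_all
  have k3z: "m31 - m12*m23 + m13*m22 = 0"
    "m32 - m13*m21 + m11*m23 = 0"
    "m33 - m11*m22 + m12*m21 = 0"
    using k3 by simp_all
  note thesisI = that
  have main: thesis
    if s: "s \<noteq> 0" and
      sq: "a*a = s*(1 + m11 + m22 + m33)" "b*b = s*(1 + m11 - m22 - m33)"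
        "c*c = s*(1 - m11 + m22 - m33)" "d*d = s*(1 - m11 - m22 + m33)" and
      pr: "a*b = s*(m32 - m23)" "a*c = s*(m13 - m31)" "a*d = s*(m21 - m12)"
        "b*c = s*(m12 + m21)" "b*d = s*(m13 + m31)" "c*d = s*(m23 + m32)" for s a b c d
  proof (rule thesisI[of a b c d])
    have n: "quat_norm a b c d = 4 * s"
      unfolding quat_norm_def sq by (simp add: algebra_simps)
    show "quat_norm a b c d \<noteq> 0" using n s by simp
    show "M = (\<chi> i j. quat_mat a b c d $ i $ j / quat_norm a b c d)"
      unfolding n vec_eq_iff forall_3 quat_mat_def
      using s by (simp add: sq pr m field_simps)
  qed
  consider "1 + m11 + m22 + m33 \<noteq> 0" | "1 + m11 - m22 - m33 \<noteq> 0" | "1 - m11 + m22 - m33 \<noteq> 0"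
    | "1 - m11 - m22 + m33 \<noteq> 0" by linarith
  then show thesis
  proof cases
    case 1
    show thesis
    proof (rule main[OF 1, of "1 + m11 + m22 + m33" "m32 - m23" "m13 - m31" "m21 - m12"])
      show "(1 + m11 + m22 + m33) * (1 + m11 + m22 + m33) = (1 + m11 + m22 + m33) * (1 + m11 + m22 + m33)"
        by (simp add: algebra_simps)
      have "(m32 - m23) * (m32 - m23) = (1 + m11 + m22 + m33) * (1 + m11 - m22 - m33)
            + (-1) * (m11*m11 + m12*m12 + m13*m13 - 1)
            + (1) * (m12*m12 + m22*m22 + m32*m32 - 1)
            + (1) * (m13*m13 + m23*m23 + m33*m33 - 1)
            + (-2) * (m11 - m22*m33 + m23*m32)"
        by (simp add: algebra_simps)
      then show "(m32 - m23) * (m32 - m23) = (1 + m11 + m22 + m33) * (1 + m11 - m22 - m33)"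
        unfolding cz rz k1z k2z k3z by simp
      have "(m13 - m31) * (m13 - m31) = (1 + m11 + m22 + m33) * (1 - m11 + m22 - m33)
            + (1) * (m11*m11 + m21*m21 + m31*m31 - 1)
            + (-1) * (m21*m21 + m22*m22 + m23*m23 - 1)
            + (1) * (m13*m13 + m23*m23 + m33*m33 - 1)
            + (-2) * (m22 - m11*m33 + m13*m31)"
        by (simp add: algebra_simps)
      then show "(m13 - m31) * (m13 - m31) = (1 + m11 + m22 + m33) * (1 - m11 + m22 - m33)"
        unfolding cz rz k1z k2z k3z by simp
      have "(m21 - m12) * (m21 - m12) = (1 + m11 + m22 + m33) * (1 - m11 - m22 + m33)
            + (1) * (m11*m11 + m12*m12 + m13*m13 - 1)
            + (1) * (m21*m21 + m22*m22 + m23*m23 - 1)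
            + (-1) * (m13*m13 + m23*m23 + m33*m33 - 1)
            + (-2) * (m33 - m11*m22 + m12*m21)"
        by (simp add: algebra_simps)
      then show "(m21 - m12) * (m21 - m12) = (1 + m11 + m22 + m33) * (1 - m11 - m22 + m33)"
        unfolding cz rz k1z k2z k3z by simp
      show "(1 + m11 + m22 + m33) * (m32 - m23) = (1 + m11 + m22 + m33) * (m32 - m23)"
        by (simp add: algebra_simps)
      show "(1 + m11 + m22 + m33) * (m13 - m31) = (1 + m11 + m22 + m33) * (m13 - m31)"
        by (simp add: algebra_simps)
      show "(1 + m11 + m22 + m33) * (m21 - m12) = (1 + m11 + m22 + m33) * (m21 - m12)"
        by (simp add: algebra_simps)
      have "(m32 - m23) * (m13 - m31) = (1 + m11 + m22 + m33) * (m12 + m21)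
            + (-1) * (m11*m12 + m21*m22 + m31*m32)
            + (-1) * (m11*m21 + m12*m22 + m13*m23)
            + (-1) * (m12 - m23*m31 + m21*m33)
            + (-1) * (m21 - m13*m32 + m12*m33)"
        by (simp add: algebra_simps)
      then show "(m32 - m23) * (m13 - m31) = (1 + m11 + m22 + m33) * (m12 + m21)"
        unfolding cz rz k1z k2z k3z by simp
      have "(m32 - m23) * (m21 - m12) = (1 + m11 + m22 + m33) * (m13 + m31)
            + (-1) * (m11*m13 + m21*m23 + m31*m33)
            + (-1) * (m11*m31 + m12*m32 + m13*m33)
            + (-1) * (m13 - m21*m32 + m22*m31)
            + (-1) * (m31 - m12*m23 + m13*m22)"
        by (simp add: algebra_simps)
      then show "(m32 - m23) * (m21 - m12) = (1 + m11 + m22 + m33) * (m13 + m31)"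
        unfolding cz rz k1z k2z k3z by simp
      have "(m13 - m31) * (m21 - m12) = (1 + m11 + m22 + m33) * (m23 + m32)
            + (-1) * (m12*m13 + m22*m23 + m32*m33)
            + (-1) * (m21*m31 + m22*m32 + m23*m33)
            + (-1) * (m23 - m12*m31 + m11*m32)
            + (-1) * (m32 - m13*m21 + m11*m23)"
        by (simp add: algebra_simps)
      then show "(m13 - m31) * (m21 - m12) = (1 + m11 + m22 + m33) * (m23 + m32)"
        unfolding cz rz k1z k2z k3z by simp
    qed
  next
    case 2
    show thesis
    proof (rule main[OF 2, of "m32 - m23" "1 + m11 - m22 - m33" "m12 + m21" "m13 + m31"])
      have "(m32 - m23) * (m32 - m23) = (1 + m11 - m22 - m33) * (1 + m11 + m22 + m33)
            + (-1) * (m11*m11 + m12*m12 + m13*m13 - 1)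
            + (1) * (m12*m12 + m22*m22 + m32*m32 - 1)
            + (1) * (m13*m13 + m23*m23 + m33*m33 - 1)
            + (-2) * (m11 - m22*m33 + m23*m32)"
        by (simp add: algebra_simps)
      then show "(m32 - m23) * (m32 - m23) = (1 + m11 - m22 - m33) * (1 + m11 + m22 + m33)"
        unfolding cz rz k1z k2z k3z by simp
      show "(1 + m11 - m22 - m33) * (1 + m11 - m22 - m33) = (1 + m11 - m22 - m33) * (1 + m11 - m22 - m33)"
        by (simp add: algebra_simps)
      have "(m12 + m21) * (m12 + m21) = (1 + m11 - m22 - m33) * (1 - m11 + m22 - m33)
            + (1) * (m11*m11 + m12*m12 + m13*m13 - 1)
            + (1) * (m21*m21 + m22*m22 + m23*m23 - 1)
            + (-1) * (m13*m13 + m23*m23 + m33*m33 - 1)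
            + (2) * (m33 - m11*m22 + m12*m21)"
        by (simp add: algebra_simps)
      then show "(m12 + m21) * (m12 + m21) = (1 + m11 - m22 - m33) * (1 - m11 + m22 - m33)"
        unfolding cz rz k1z k2z k3z by simp
      have "(m13 + m31) * (m13 + m31) = (1 + m11 - m22 - m33) * (1 - m11 - m22 + m33)
            + (1) * (m11*m11 + m21*m21 + m31*m31 - 1)
            + (-1) * (m21*m21 + m22*m22 + m23*m23 - 1)
            + (1) * (m13*m13 + m23*m23 + m33*m33 - 1)
            + (2) * (m22 - m11*m33 + m13*m31)"
        by (simp add: algebra_simps)
      then show "(m13 + m31) * (m13 + m31) = (1 + m11 - m22 - m33) * (1 - m11 - m22 + m33)"
        unfolding cz rz k1z k2z k3z by simp
      show "(m32 - m23) * (1 + m11 - m22 - m33) = (1 + m11 - m22 - m33) * (m32 - m23)"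
        by (simp add: algebra_simps)
      have "(m32 - m23) * (m12 + m21) = (1 + m11 - m22 - m33) * (m13 - m31)
            + (-1) * (m11*m13 + m21*m23 + m31*m33)
            + (1) * (m11*m31 + m12*m32 + m13*m33)
            + (-1) * (m13 - m21*m32 + m22*m31)
            + (1) * (m31 - m12*m23 + m13*m22)"
        by (simp add: algebra_simps)
      then show "(m32 - m23) * (m12 + m21) = (1 + m11 - m22 - m33) * (m13 - m31)"
        unfolding cz rz k1z k2z k3z by simp
      have "(m32 - m23) * (m13 + m31) = (1 + m11 - m22 - m33) * (m21 - m12)
            + (1) * (m11*m12 + m21*m22 + m31*m32)
            + (-1) * (m11*m21 + m12*m22 + m13*m23)
            + (1) * (m12 - m23*m31 + m21*m33)
            + (-1) * (m21 - m13*m32 + m12*m33)"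
        by (simp add: algebra_simps)
      then show "(m32 - m23) * (m13 + m31) = (1 + m11 - m22 - m33) * (m21 - m12)"
        unfolding cz rz k1z k2z k3z by simp
      show "(1 + m11 - m22 - m33) * (m12 + m21) = (1 + m11 - m22 - m33) * (m12 + m21)"
        by (simp add: algebra_simps)
      show "(1 + m11 - m22 - m33) * (m13 + m31) = (1 + m11 - m22 - m33) * (m13 + m31)"
        by (simp add: algebra_simps)
      have "(m12 + m21) * (m13 + m31) = (1 + m11 - m22 - m33) * (m23 + m32)
            + (1) * (m12*m13 + m22*m23 + m32*m33)
            + (1) * (m21*m31 + m22*m32 + m23*m33)
            + (-1) * (m23 - m12*m31 + m11*m32)
            + (-1) * (m32 - m13*m21 + m11*m23)"
        by (simp add: algebra_simps)
      then show "(m12 + m21) * (m13 + m31) = (1 + m11 - m22 - m33) * (m23 + m32)"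
        unfolding cz rz k1z k2z k3z by simp
    qed
  next
    case 3
    show thesis
    proof (rule main[OF 3, of "m13 - m31" "m12 + m21" "1 - m11 + m22 - m33" "m23 + m32"])
      have "(m13 - m31) * (m13 - m31) = (1 - m11 + m22 - m33) * (1 + m11 + m22 + m33)
            + (1) * (m11*m11 + m21*m21 + m31*m31 - 1)
            + (-1) * (m21*m21 + m22*m22 + m23*m23 - 1)
            + (1) * (m13*m13 + m23*m23 + m33*m33 - 1)
            + (-2) * (m22 - m11*m33 + m13*m31)"
        by (simp add: algebra_simps)
      then show "(m13 - m31) * (m13 - m31) = (1 - m11 + m22 - m33) * (1 + m11 + m22 + m33)"
        unfolding cz rz k1z k2z k3z by simp
      have "(m12 + m21) * (m12 + m21) = (1 - m11 + m22 - m33) * (1 + m11 - m22 - m33)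
            + (1) * (m11*m11 + m12*m12 + m13*m13 - 1)
            + (1) * (m21*m21 + m22*m22 + m23*m23 - 1)
            + (-1) * (m13*m13 + m23*m23 + m33*m33 - 1)
            + (2) * (m33 - m11*m22 + m12*m21)"
        by (simp add: algebra_simps)
      then show "(m12 + m21) * (m12 + m21) = (1 - m11 + m22 - m33) * (1 + m11 - m22 - m33)"
        unfolding cz rz k1z k2z k3z by simp
      show "(1 - m11 + m22 - m33) * (1 - m11 + m22 - m33) = (1 - m11 + m22 - m33) * (1 - m11 + m22 - m33)"
        by (simp add: algebra_simps)
      have "(m23 + m32) * (m23 + m32) = (1 - m11 + m22 - m33) * (1 - m11 - m22 + m33)
            + (-1) * (m11*m11 + m12*m12 + m13*m13 - 1)
            + (1) * (m12*m12 + m22*m22 + m32*m32 - 1)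
            + (1) * (m13*m13 + m23*m23 + m33*m33 - 1)
            + (2) * (m11 - m22*m33 + m23*m32)"
        by (simp add: algebra_simps)
      then show "(m23 + m32) * (m23 + m32) = (1 - m11 + m22 - m33) * (1 - m11 - m22 + m33)"
        unfolding cz rz k1z k2z k3z by simp
      have "(m13 - m31) * (m12 + m21) = (1 - m11 + m22 - m33) * (m32 - m23)
            + (1) * (m12*m13 + m22*m23 + m32*m33)
            + (-1) * (m21*m31 + m22*m32 + m23*m33)
            + (1) * (m23 - m12*m31 + m11*m32)
            + (-1) * (m32 - m13*m21 + m11*m23)"
        by (simp add: algebra_simps)
      then show "(m13 - m31) * (m12 + m21) = (1 - m11 + m22 - m33) * (m32 - m23)"
        unfolding cz rz k1z k2z k3z by simp
      show "(m13 - m31) * (1 - m11 + m22 - m33) = (1 - m11 + m22 - m33) * (m13 - m31)"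
        by (simp add: algebra_simps)
      have "(m13 - m31) * (m23 + m32) = (1 - m11 + m22 - m33) * (m21 - m12)
            + (-1) * (m11*m12 + m21*m22 + m31*m32)
            + (1) * (m11*m21 + m12*m22 + m13*m23)
            + (1) * (m12 - m23*m31 + m21*m33)
            + (-1) * (m21 - m13*m32 + m12*m33)"
        by (simp add: algebra_simps)
      then show "(m13 - m31) * (m23 + m32) = (1 - m11 + m22 - m33) * (m21 - m12)"
        unfolding cz rz k1z k2z k3z by simp
      show "(m12 + m21) * (1 - m11 + m22 - m33) = (1 - m11 + m22 - m33) * (m12 + m21)"
        by (simp add: algebra_simps)
      have "(m12 + m21) * (m23 + m32) = (1 - m11 + m22 - m33) * (m13 + m31)
            + (1) * (m11*m13 + m21*m23 + m31*m33)
            + (1) * (m11*m31 + m12*m32 + m13*m33)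
            + (-1) * (m13 - m21*m32 + m22*m31)
            + (-1) * (m31 - m12*m23 + m13*m22)"
        by (simp add: algebra_simps)
      then show "(m12 + m21) * (m23 + m32) = (1 - m11 + m22 - m33) * (m13 + m31)"
        unfolding cz rz k1z k2z k3z by simp
      show "(1 - m11 + m22 - m33) * (m23 + m32) = (1 - m11 + m22 - m33) * (m23 + m32)"
        by (simp add: algebra_simps)
    qed
  next
    case 4
    show thesis
    proof (rule main[OF 4, of "m21 - m12" "m13 + m31" "m23 + m32" "1 - m11 - m22 + m33"])
      have "(m21 - m12) * (m21 - m12) = (1 - m11 - m22 + m33) * (1 + m11 + m22 + m33)
            + (1) * (m11*m11 + m12*m12 + m13*m13 - 1)
            + (1) * (m21*m21 + m22*m22 + m23*m23 - 1)
            + (-1) * (m13*m13 + m23*m23 + m33*m33 - 1)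
            + (-2) * (m33 - m11*m22 + m12*m21)"
        by (simp add: algebra_simps)
      then show "(m21 - m12) * (m21 - m12) = (1 - m11 - m22 + m33) * (1 + m11 + m22 + m33)"
        unfolding cz rz k1z k2z k3z by simp
      have "(m13 + m31) * (m13 + m31) = (1 - m11 - m22 + m33) * (1 + m11 - m22 - m33)
            + (1) * (m11*m11 + m21*m21 + m31*m31 - 1)
            + (-1) * (m21*m21 + m22*m22 + m23*m23 - 1)
            + (1) * (m13*m13 + m23*m23 + m33*m33 - 1)
            + (2) * (m22 - m11*m33 + m13*m31)"
        by (simp add: algebra_simps)
      then show "(m13 + m31) * (m13 + m31) = (1 - m11 - m22 + m33) * (1 + m11 - m22 - m33)"
        unfolding cz rz k1z k2z k3z by simp
      have "(m23 + m32) * (m23 + m32) = (1 - m11 - m22 + m33) * (1 - m11 + m22 - m33)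
            + (-1) * (m11*m11 + m12*m12 + m13*m13 - 1)
            + (1) * (m12*m12 + m22*m22 + m32*m32 - 1)
            + (1) * (m13*m13 + m23*m23 + m33*m33 - 1)
            + (2) * (m11 - m22*m33 + m23*m32)"
        by (simp add: algebra_simps)
      then show "(m23 + m32) * (m23 + m32) = (1 - m11 - m22 + m33) * (1 - m11 + m22 - m33)"
        unfolding cz rz k1z k2z k3z by simp
      show "(1 - m11 - m22 + m33) * (1 - m11 - m22 + m33) = (1 - m11 - m22 + m33) * (1 - m11 - m22 + m33)"
        by (simp add: algebra_simps)
      have "(m21 - m12) * (m13 + m31) = (1 - m11 - m22 + m33) * (m32 - m23)
            + (-1) * (m12*m13 + m22*m23 + m32*m33)
            + (1) * (m21*m31 + m22*m32 + m23*m33)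
            + (1) * (m23 - m12*m31 + m11*m32)
            + (-1) * (m32 - m13*m21 + m11*m23)"
        by (simp add: algebra_simps)
      then show "(m21 - m12) * (m13 + m31) = (1 - m11 - m22 + m33) * (m32 - m23)"
        unfolding cz rz k1z k2z k3z by simp
      have "(m21 - m12) * (m23 + m32) = (1 - m11 - m22 + m33) * (m13 - m31)
            + (1) * (m11*m13 + m21*m23 + m31*m33)
            + (-1) * (m11*m31 + m12*m32 + m13*m33)
            + (-1) * (m13 - m21*m32 + m22*m31)
            + (1) * (m31 - m12*m23 + m13*m22)"
        by (simp add: algebra_simps)
      then show "(m21 - m12) * (m23 + m32) = (1 - m11 - m22 + m33) * (m13 - m31)"
        unfolding cz rz k1z k2z k3z by simp
      show "(m21 - m12) * (1 - m11 - m22 + m33) = (1 - m11 - m22 + m33) * (m21 - m12)"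
        by (simp add: algebra_simps)
      have "(m13 + m31) * (m23 + m32) = (1 - m11 - m22 + m33) * (m12 + m21)
            + (1) * (m11*m12 + m21*m22 + m31*m32)
            + (1) * (m11*m21 + m12*m22 + m13*m23)
            + (-1) * (m12 - m23*m31 + m21*m33)
            + (-1) * (m21 - m13*m32 + m12*m33)"
        by (simp add: algebra_simps)
      then show "(m13 + m31) * (m23 + m32) = (1 - m11 - m22 + m33) * (m12 + m21)"
        unfolding cz rz k1z k2z k3z by simp
      show "(m13 + m31) * (1 - m11 - m22 + m33) = (1 - m11 - m22 + m33) * (m13 + m31)"
        by (simp add: algebra_simps)
      show "(m23 + m32) * (1 - m11 - m22 + m33) = (1 - m11 - m22 + m33) * (m23 + m32)"
        by (simp add: algebra_simps)
    qed
  qed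
qed

lemma real_polynomial_function_rational_curve:
  fixes p :: "real^3^3 \<Rightarrow> real" and G :: "3 \<Rightarrow> 3 \<Rightarrow> real poly" and N :: "real poly"
  assumes "real_polynomial_function p"
  shows "\<exists>d P. \<forall>t. poly N t \<noteq> 0 \<longrightarrow>
           p (\<chi> i j. poly (G i j) t / poly N t) * poly N t ^ d = poly P t"
  using assms
proof (induction rule: real_polynomial_function.induct)
  case (linear f)
  then interpret f: bounded_linear f .
  have mexp: "M = (\<Sum>i\<in>UNIV. \<Sum>j\<in>UNIV. (M$i$j) *\<^sub>R axis i (axis j 1))" for M :: "real^3^3"
    by (simp add: vec_eq_iff forall_3 sum_3 axis_def)
  have fexp: "f M = (\<Sum>i\<in>UNIV. \<Sum>j\<in>UNIV. (M$i$j) * f (axis i (axis j 1)))" for M :: "real^3^3"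
    by (subst mexp) (simp add: f.sum f.scaleR)
  show ?case
    by (rule exI[of _ 1],
        rule exI[of _ "\<Sum>i\<in>UNIV. \<Sum>j\<in>UNIV. Polynomial.smult (f (axis i (axis j 1))) (G i j)"])
       (simp add: fexp[of "\<chi> i j. u i j / w" for u w] poly_sum mult.commute flip: sum_divide_distrib)
next
  case (const c)
  show ?case
    by (rule exI[of _ 0], rule exI[of _ "[:c:]"]) simp
next
  case (add f g)
  then obtain d1 P1 d2 P2 where
    "\<And>t. poly N t \<noteq> 0 \<Longrightarrow> f (\<chi> i j. poly (G i j) t / poly N t) * poly N t ^ d1 = poly P1 t"
    "\<And>t. poly N t \<noteq> 0 \<Longrightarrow> g (\<chi> i j. poly (G i j) t / poly N t) * poly N t ^ d2 = poly P2 t"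
    by blast
  note e = this[symmetric]
  show ?case
    by (rule exI[of _ "d1 + d2"], rule exI[of _ "P1 * N ^ d2 + P2 * N ^ d1"])
       (simp add: e algebra_simps power_add)
next
  case (mult f g)
  then obtain d1 P1 d2 P2 where
    "\<And>t. poly N t \<noteq> 0 \<Longrightarrow> f (\<chi> i j. poly (G i j) t / poly N t) * poly N t ^ d1 = poly P1 t"
    "\<And>t. poly N t \<noteq> 0 \<Longrightarrow> g (\<chi> i j. poly (G i j) t / poly N t) * poly N t ^ d2 = poly P2 t"
    by blast
  note e = this[symmetric]
  show ?case
    by (rule exI[of _ "d1 + d2"], rule exI[of _ "P1 * P2"])
       (simp add: e algebra_simps power_add)
qed

lemma rotation_irreducible:
  fixes p q :: "real^3^3 \<Rightarrow> real"
  assumes p: "real_polynomial_function p" and q: "real_polynomial_function q"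
    and pq: "\<And>M. rotation_matrix M \<Longrightarrow> p M * q M = 0"
    and M0: "rotation_matrix M0" "p M0 \<noteq> 0" and M1: "rotation_matrix M1" "q M1 \<noteq> 0"
  shows False
proof -
  obtain a b c d where n0: "quat_norm a b c d \<noteq> 0"
    and m0: "M0 = (\<chi> i j. quat_mat a b c d $ i $ j / quat_norm a b c d)"
    using rotation_matrix_quat_ex M0(1) .
  obtain a' b' c' d' where n1: "quat_norm a' b' c' d' \<noteq> 0"
    and m1: "M1 = (\<chi> i j. quat_mat a' b' c' d' $ i $ j / quat_norm a' b' c' d')"
    using rotation_matrix_quat_ex M1(1) .
  define l where "l = (\<lambda>u v::real. [:u, v - u:])"
  define N where "N = l a a' * l a a' + l b b' * l b b' + l c c' * l c c' + l d d' * l d d'"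
  define G where "G = (\<lambda>i j. quat_mat (l a a') (l b b') (l c c') (l d d') $ i $ j)"
  have l: "poly (l u v) 0 = u" "poly (l u v) 1 = v" for u v by (auto simp: l_def)
  have N: "poly N t = quat_norm (poly (l a a') t) (poly (l b b') t) (poly (l c c') t) (poly (l d d') t)"
    for t by (simp add: N_def quat_norm_def)
  have G': "\<forall>i j. poly (G i j) t =
      quat_mat (poly (l a a') t) (poly (l b b') t) (poly (l c c') t) (poly (l d d') t) $ i $ j" for t
    unfolding forall_3 G_def quat_mat_def vector_3 by simp
  define M where "M = (\<lambda>t. (\<chi> i j. poly (G i j) t / poly N t) :: real^3^3)"
  have rot: "rotation_matrix (M t)" if "poly N t \<noteq> 0" for t
    using rotation_matrix_quat that N G' unfolding M_def by simp
  have ends: "M 0 = M0" "M 1 = M1" "poly N 0 \<noteq> 0" "poly N 1 \<noteq> 0"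
    using m0 m1 n0 n1 unfolding M_def N using G' by (simp_all add: l)
  obtain d1 P where P: "\<And>t. poly N t \<noteq> 0 \<Longrightarrow> p (M t) * poly N t ^ d1 = poly P t"
    using real_polynomial_function_rational_curve[OF p, of N G] unfolding M_def by blast
  obtain d2 Q where Q: "\<And>t. poly N t \<noteq> 0 \<Longrightarrow> q (M t) * poly N t ^ d2 = poly Q t"
    using real_polynomial_function_rational_curve[OF q, of N G] unfolding M_def by blast
  have "poly (N * P * Q) t = 0" for t
  proof (cases "poly N t = 0")
    case False
    have "poly P t * poly Q t = (p (M t) * q (M t)) * (poly N t ^ d1 * poly N t ^ d2)"
      using P[OF False] Q[OF False] by (simp add: algebra_simps flip: P[OF False] Q[OF False])
    also have "\<dots> = 0" using pq[OF rot[OF False]] by simp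
    finally show ?thesis by simp
  qed simp
  then have "N * P * Q = 0"
    using poly_all_0_iff_0 by blast
  moreover have "N \<noteq> 0" using ends(3) by auto
  moreover have "P \<noteq> 0" using P[OF ends(3)] ends M0(2) by auto
  moreover have "Q \<noteq> 0" using Q[OF ends(4)] ends M1(2) by auto
  ultimately show False by simp
qed


section \<open>The field of rational functions on SO(3)\<close>

text \<open>Polynomial functions on SO(3) are restrictions of polynomial functions on
  3 by 3 matrices; the value 0 outside SO(3) only serves to make functions
  that agree on SO(3) equal.\<close>

typedef so3_fun =
  "{f :: real^3^3 \<Rightarrow> real. \<exists>p. real_polynomial_function p \<and>
      f = (\<lambda>M. if rotation_matrix M then p M else 0)}"
  by (rule exI[of _ "\<lambda>M. 0"], simp, rule exI[of _ "\<lambda>M. 0"]) auto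

setup_lifting type_definition_so3_fun

lift_definition so3_const :: "real \<Rightarrow> so3_fun" is
  "\<lambda>c M. if rotation_matrix M then c else 0"
  by (rule exI[of _ "\<lambda>_. _"]) auto

lift_definition so3_entry :: "3 \<Rightarrow> 3 \<Rightarrow> so3_fun" is
  "\<lambda>i j M. if rotation_matrix M then M $ i $ j else 0"
  subgoal for i j
    by (rule exI[of _ "\<lambda>M. M $ i $ j"])
       (auto intro!: real_polynomial_function.intros(1) bounded_linear_compose[OF bounded_linear_vec_nth]
         bounded_linear_vec_nth)
  done

instantiation so3_fun :: idom
begin

lift_definition zero_so3_fun :: so3_fun is "\<lambda>M. 0"
  by (rule exI[of _ "\<lambda>_. 0"]) auto

lift_definition one_so3_fun :: so3_fun is "\<lambda>M. if rotation_matrix M then 1 else 0"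
  by (rule exI[of _ "\<lambda>_. 1"]) auto

lift_definition plus_so3_fun :: "so3_fun \<Rightarrow> so3_fun \<Rightarrow> so3_fun" is "\<lambda>f g M. f M + g M"
  subgoal for f g
    by (elim exE conjE, rename_tac p q, rule_tac x = "\<lambda>x. p x + q x" in exI) auto
  done

lift_definition times_so3_fun :: "so3_fun \<Rightarrow> so3_fun \<Rightarrow> so3_fun" is "\<lambda>f g M. f M * g M"
  subgoal for f g
    by (elim exE conjE, rename_tac p q, rule_tac x = "\<lambda>x. p x * q x" in exI) auto
  done

lift_definition uminus_so3_fun :: "so3_fun \<Rightarrow> so3_fun" is "\<lambda>f M. - f M"
  subgoal for f
    by (elim exE conjE, rename_tac p, rule_tac x = "\<lambda>x. - p x" in exI) auto
  done

lift_definition minus_so3_fun :: "so3_fun \<Rightarrow> so3_fun \<Rightarrow> so3_fun" is "\<lambda>f g M. f M - g M"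
  subgoal for f g
    by (elim exE conjE, rename_tac p q, rule_tac x = "\<lambda>x. p x - q x" in exI) auto
  done

instance
proof
  fix a b c :: so3_fun
  show "a * b * c = a * (b * c)" by transfer (simp add: mult.assoc)
  show "a * b = b * a" by transfer (simp add: mult.commute)
  show "1 * a = a" by transfer auto
  show "a + b + c = a + (b + c)" by transfer (simp add: add.assoc)
  show "a + b = b + a" by transfer (simp add: add.commute)
  show "0 + a = a" by transfer auto
  show "- a + a = 0" by transfer auto
  show "a - b = a + - b" by transfer auto
  show "(a + b) * c = a * c + b * c" by transfer (simp add: distrib_right)
  show "a * (b + c) = a * b + a * c" by transfer (simp add: distrib_left)
  show "0 * a = 0" by transfer simp
  show "a * 0 = 0" by transfer simp
  have "rotation_matrix (mat 1 :: real^3^3)"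
    by (simp add: rotation_matrix_def orthogonal_matrix_id)
  then show "(0::so3_fun) \<noteq> 1" by transfer (metis zero_neq_one)
  show "a \<noteq> 0 \<Longrightarrow> b \<noteq> 0 \<Longrightarrow> a * b \<noteq> 0"
  proof transfer
    fix a b :: "real^3^3 \<Rightarrow> real"
    assume "\<exists>p. real_polynomial_function p \<and> a = (\<lambda>M. if rotation_matrix M then p M else 0)"
      "\<exists>p. real_polynomial_function p \<and> b = (\<lambda>M. if rotation_matrix M then p M else 0)"
      and nz: "a \<noteq> (\<lambda>M. 0)" "b \<noteq> (\<lambda>M. 0)"
    then obtain p q where
      p: "real_polynomial_function p" "a = (\<lambda>M. if rotation_matrix M then p M else 0)" and
      q: "real_polynomial_function q" "b = (\<lambda>M. if rotation_matrix M then q M else 0)"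
      by blast
    from nz obtain M0 M1 where "a M0 \<noteq> 0" "b M1 \<noteq> 0" by (auto simp: fun_eq_iff)
    then have "rotation_matrix M0" "p M0 \<noteq> 0" "rotation_matrix M1" "q M1 \<noteq> 0"
      using p q by (auto split: if_splits)
    then obtain M where "rotation_matrix M" "p M * q M \<noteq> 0"
      using rotation_irreducible[OF p(1) q(1)] by blast
    then show "(\<lambda>M. a M * b M) \<noteq> (\<lambda>M. 0)"
      using p q by (auto simp: fun_eq_iff)
  qed
qed

end

text \<open>SO(3) is affine and irreducible, so its rational functions are the quotients of polynomial
  functions.\<close>

type_synonym so3_field = "so3_fun fract"

definition real_to_K :: "real \<Rightarrow> so3_field" where
  "real_to_K c = Fract (so3_const c) 1"

definition generic_rotation :: "so3_field^3^3" where
  "generic_rotation = (\<chi> i j. Fract (so3_entry i j) 1)"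


section \<open>Vector algebra over a commutative ring\<close>

definition dot :: "'a::comm_ring_1^3 \<Rightarrow> 'a^3 \<Rightarrow> 'a" where
  "dot u v = (\<Sum>i\<in>UNIV. u$i * v$i)"

definition cross :: "'a::comm_ring_1^3 \<Rightarrow> 'a^3 \<Rightarrow> 'a^3" where
  "cross u v = vector [u$2 * v$3 - u$3 * v$2, u$3 * v$1 - u$1 * v$3, u$1 * v$2 - u$2 * v$1]"

definition mixed :: "'a::comm_ring_1^3 \<Rightarrow> 'a^3 \<Rightarrow> 'a^3 \<Rightarrow> 'a" where
  "mixed u v w = det (transpose (vector [u, v, w]))"

definition stack :: "'a::zero^3 \<Rightarrow> 'a^3 \<Rightarrow> 'a^6" where
  "stack u v = vector [u$1, u$2, u$3, v$1, v$2, v$3]"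


section \<open>Projective varieties over a field\<close>

text \<open>A variety over a field \<open>k\<close> is represented by its set of points over the algebraic
  closure of \<open>k\<close>; the topology and the regular mappings are defined by homogeneous
  polynomials with coefficients in \<open>k\<close>. A point of projective space is a line through the
  origin. A polynomial in variables indexed by \<open>'n\<close> maps exponent vectors to coefficients.\<close>

definition pt :: "'a::field^'n \<Rightarrow> ('a^'n) set" where
  "pt v = range (\<lambda>c. c *s v)"

type_synonym ('n, 'k) mpoly = "('n \<Rightarrow>\<^sub>0 nat) \<Rightarrow>\<^sub>0 'k"

definition homogeneous :: "nat \<Rightarrow> ('n::finite, 'k::zero) mpoly \<Rightarrow> bool" where
  "homogeneous d p \<longleftrightarrow> (\<forall>m\<in>Poly_Mapping.keys p. (\<Sum>i\<in>UNIV. Poly_Mapping.lookup m i) = d)"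

definition peval :: "('n::finite, 'k::field) mpoly \<Rightarrow> 'k alg_closure^'n \<Rightarrow> 'k alg_closure" where
  "peval p v = (\<Sum>m\<in>Poly_Mapping.keys p. to_ac (Poly_Mapping.lookup p m) * (\<Prod>i\<in>UNIV. v$i ^ Poly_Mapping.lookup m i))"

definition zariski_closed :: "('k::field alg_closure^'n::finite) set set \<Rightarrow> bool" where
  "zariski_closed Z \<longleftrightarrow> (\<exists>F :: ('n, 'k) mpoly set. (\<forall>p\<in>F. \<exists>d. homogeneous d p) \<and>
     Z = {pt v | v. v \<noteq> 0 \<and> (\<forall>p\<in>F. peval p v = 0)})"

definition zariski_closure ::
    "('k::field alg_closure^'n::finite) set set \<Rightarrow> ('k alg_closure^'n) set set" where
  "zariski_closure S = Inter {Z. zariski_closed Z \<and> S \<subseteq> Z}"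

definition affine_pt :: "'a::field^3 \<Rightarrow> ('a^4) set" where
  "affine_pt P = pt (vector [1, P$1, P$2, P$3])"

definition infinite_pt :: "'a::field^3 \<Rightarrow> ('a^4) set" where
  "infinite_pt P = pt (vector [0, P$1, P$2, P$3])"

definition regular_mapping ::
    "('k::field alg_closure^'m::finite) set set \<Rightarrow> ('k alg_closure^'n::finite) set set \<Rightarrow>
     (('k alg_closure^'m) set \<Rightarrow> ('k alg_closure^'n) set) \<Rightarrow> bool" where
  "regular_mapping S T f \<longleftrightarrow> f ` S \<subseteq> T \<and>
     (\<forall>x\<in>S. \<exists>Z d. \<exists>F :: 'n \<Rightarrow> ('m, 'k) mpoly.
        zariski_closed Z \<and> x \<notin> Z \<and> (\<forall>j. homogeneous d (F j)) \<and>
        (\<forall>v. v \<noteq> 0 \<and> pt v \<in> S - Z \<longrightarrow>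
           (\<chi> j. peval (F j) v) \<noteq> 0 \<and> f (pt v) = pt (\<chi> j. peval (F j) v)))"


section \<open>Gough-Stewart platforms\<close>

text \<open>Indices 1 to 6 are the elements of the type \<open>6\<close> (where \<open>6 = 0\<close>).\<close>

type_synonym architecture = "(real^3^6) \<times> (real^3^6)"

definition architectures :: "architecture set" where
  "architectures = {(A, b). A$1 = 0 \<and> b$1 = 0}"

definition zariski_open_architectures :: "architecture set \<Rightarrow> bool" where
  "zariski_open_architectures U \<longleftrightarrow> (\<exists>F. (\<forall>f\<in>F. real_polynomial_function f) \<and>
     U = {a \<in> architectures. \<exists>f\<in>F. f a \<noteq> 0})"

definition generic_platform :: "(real^3^6 \<Rightarrow> real^3^6 \<Rightarrow> bool) \<Rightarrow> bool" where
  "generic_platform \<Phi> \<longleftrightarrow>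
     (\<exists>U. zariski_open_architectures U \<and> U \<noteq> {} \<and> (\<forall>(A, b)\<in>U. \<Phi> A b))"

type_synonym Kbar = "so3_field alg_closure"

definition base_pts :: "real^3^6 \<Rightarrow> so3_field^3^6" where
  "base_pts A = (\<chi> i j. real_to_K (A$i$j))"

definition limbs :: "real^3^6 \<Rightarrow> real^3^6 \<Rightarrow> so3_field^3^6" where
  "limbs A b = (\<chi> i. generic_rotation *v (\<chi> j. real_to_K (b$i$j)) - base_pts A $ i)"

definition to_Kbar :: "so3_field^3^6 \<Rightarrow> Kbar^3^6" where
  "to_Kbar U = (\<chi> i j. to_ac (U$i$j))"

text \<open>In the following, \<open>A\<close> is the family of the $A_i$ and \<open>C\<close> the family of the
  $C_i = R b_i - A_i$; both are then extended to the algebraic closure. Twists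
  $(\Omega, V)$ are written \<open>stack \<Omega> V\<close>.\<close>

definition Jac :: "'a::field^3^6 \<Rightarrow> 'a^3^6 \<Rightarrow> 'a^3 \<Rightarrow> 'a^6^6" where
  "Jac A C P = (\<chi> i. stack (C$i + P) (cross (A$i) (C$i + P)))"

definition Sigma_aff :: "'a::field^3^6 \<Rightarrow> 'a^3^6 \<Rightarrow> ('a^3) set" where
  "Sigma_aff A C = {P. det (Jac A C P) = 0}"

definition Sigma_proj :: "Kbar^3^6 \<Rightarrow> Kbar^3^6 \<Rightarrow> (Kbar^4) set set" where
  "Sigma_proj A C = zariski_closure (affine_pt ` Sigma_aff A C)"

definition reciprocal :: "'a::field^3^6 \<Rightarrow> 'a^3^6 \<Rightarrow> 'a^3 \<Rightarrow> 'a^3 \<Rightarrow> 'a^3 \<Rightarrow> bool" where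
  "reciprocal A C P \<Omega> V \<longleftrightarrow> (\<forall>i. dot (C$i + P) V + dot (cross (A$i) (C$i + P)) \<Omega> = 0)"

text \<open>A point of projective space being a line, \<open>Rec A C P\<close> is one exactly when the space of
  reciprocal twists has dimension 1.\<close>

definition Rec :: "'a::field^3^6 \<Rightarrow> 'a^3^6 \<Rightarrow> 'a^3 \<Rightarrow> ('a^6) set" where
  "Rec A C P = {stack \<Omega> V | \<Omega> V. reciprocal A C P \<Omega> V}"

definition quadric :: "'a::field^3^6 \<Rightarrow> 'a^3^6 \<Rightarrow> (6 \<Rightarrow> 'a) \<Rightarrow> (6 \<Rightarrow> 'a) \<Rightarrow> ('a^6) set set" where
  "quadric A C \<alpha> \<beta> = {pt (stack \<Omega> V) | \<Omega> V. stack \<Omega> V \<noteq> 0 \<and>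
     dot V (C$5 - (\<Sum>i\<in>{2,3,4}. \<alpha> i *s C$i)) + mixed \<Omega> (A$5) (C$5)
       - (\<Sum>i\<in>{2,3,4}. \<alpha> i * mixed \<Omega> (A$i) (C$i)) = 0 \<and>
     dot V (C$6 - (\<Sum>i\<in>{2,3,4}. \<beta> i *s C$i)) + mixed \<Omega> (A$6) (C$6)
       - (\<Sum>i\<in>{2,3,4}. \<beta> i * mixed \<Omega> (A$i) (C$i)) = 0 \<and>
     mixed \<Omega> (A$3) (A$4) * (dot V (C$2) + mixed \<Omega> (A$2) (C$2))
       + mixed \<Omega> (A$4) (A$2) * (dot V (C$3) + mixed \<Omega> (A$3) (C$3))
       + mixed \<Omega> (A$2) (A$3) * (dot V (C$4) + mixed \<Omega> (A$4) (C$4)) = 0}"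

definition V_inf :: "'a::field^3^6 \<Rightarrow> 'a^3^6 \<Rightarrow> 'a^3 \<Rightarrow> 'a^3" where
  "V_inf A C P = (- 1 / 4) *s (\<Sum>\<sigma> | \<sigma> permutes (UNIV :: 6 set).
     (of_int (sign \<sigma>) * mixed (A $ \<sigma> 1) (A $ \<sigma> 2) P * mixed (A $ \<sigma> 3) (C $ \<sigma> 3) P)
       *s cross (C $ \<sigma> 4) (C $ \<sigma> 5))"

definition Omega_inf :: "'a::field^3^6 \<Rightarrow> 'a^3^6 \<Rightarrow> 'a^3 \<Rightarrow> 'a^3" where
  "Omega_inf A C P = ((1 / 12) * (\<Sum>\<sigma> | \<sigma> permutes (UNIV :: 6 set).
     of_int (sign \<sigma>) * mixed (C $ \<sigma> 1) (C $ \<sigma> 2) (C $ \<sigma> 3)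
       * mixed (A $ \<sigma> 4) (A $ \<sigma> 5) P)) *s P"

end

theory Submission
  imports Defs
begin

text \<open>
  The relations among $A_2, \dots, A_6$ turn the conditions on a twist $(\Omega, V)$ to be reciprocal
  at $P$ into a system that is linear in $(\Omega, V)$: two equations not involving $P$, and five
  equations that are linear in the homogeneous coordinates $(w, P)$ and still make sense at $w = 0$.
  The extended mapping sends a point of the surface to the kernel of this system.
  The maximal minors vanish on the surface, so the kernel is nonzero there, and whenever a vector of
  $5 \times 5$ minors is nonzero, it spans the kernel; hence the mapping is regular once these minors,
  which are cubic forms in $(w, P)$, have no common zero. For a generic platform they even
  span all cubic forms: this is an open condition, and it holds in an explicit example.
  At infinity $\Omega = t P$, and $(t, V)$ is the generalised cross product of three vectors of a
  four-dimensional space, which an alternating sum over permutations rewrites as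
  $(\Omega_\infty, V_\infty)$.
\<close>

section \<open>Coordinates\<close>

text \<open>Absence of common zeros over an algebraic closure is hard to transfer between fields,
  whereas spanning all cubic forms is witnessed by one nonzero determinant. That determinant is a
  polynomial in the architecture and the rotation, so ring homomorphisms transport it: its value at
  the identity rotation is a real number, and when this is nonzero, so is the determinant over the
  algebraic closure of K. To keep everything polynomial, the coefficients alpha and beta, which are
  quotients of brackets of base points, are replaced by these brackets.

  About the points that the closure adds at infinity only one thing is known: forms vanishing on the
  affine surface vanish there too. Hence existence of a nonzero kernel vector is expressed by
  maximal minors, of degree 4, and its uniqueness up to scaling by the vectors of cubic minors. The
  formulas at infinity have degree 2; they are obtained by solving the system at w = 0 directly, not
  from the cubic minors.\<close>

lemma exhaust_5: "(x::5) = 1 \<or> x = 2 \<or> x = 3 \<or> x = 4 \<or> x = 5"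
proof (induct x)
  case (of_int z)
  then have "z = 0 \<or> z = 1 \<or> z = 2 \<or> z = 3 \<or> z = 4" by fastforce
  then show ?case by auto
qed

lemma forall_5: "(\<forall>i::5. P i) \<longleftrightarrow> P 1 \<and> P 2 \<and> P 3 \<and> P 4 \<and> P 5"
  by (metis exhaust_5)

lemma exhaust_6: "(x::6) = 1 \<or> x = 2 \<or> x = 3 \<or> x = 4 \<or> x = 5 \<or> x = 6"
proof (induct x)
  case (of_int z)
  then have "z = 0 \<or> z = 1 \<or> z = 2 \<or> z = 3 \<or> z = 4 \<or> z = 5" by fastforce
  then show ?case by auto
qed

lemma forall_6: "(\<forall>i::6. P i) \<longleftrightarrow> P 1 \<and> P 2 \<and> P 3 \<and> P 4 \<and> P 5 \<and> P 6"
  by (metis exhaust_6)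

lemma UNIV_6: "(UNIV :: 6 set) = {1, 2, 3, 4, 5, 6}"
  using exhaust_6 by auto

lemma sum_6: "sum f (UNIV::6 set) = f 1 + f 2 + f 3 + f 4 + f 5 + f 6"
  unfolding UNIV_6 by (simp add: ac_simps)

lemma vector_4 [simp]:
  "(vector [a,b,c,d] :: 'a::zero^4)$1 = a"
  "(vector [a,b,c,d] :: 'a::zero^4)$2 = b"
  "(vector [a,b,c,d] :: 'a::zero^4)$3 = c"
  "(vector [a,b,c,d] :: 'a::zero^4)$4 = d"
  unfolding vector_def by simp_all

lemma stack_nth [simp]:
  "stack u v $ 1 = u$1" "stack u v $ 2 = u$2" "stack u v $ 3 = u$3"
  "stack u v $ 4 = v$1" "stack u v $ 5 = v$2" "stack u v $ 6 = v$3"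
  unfolding stack_def vector_def by simp_all

lemma cross_nth [simp]:
  "cross u v $ 1 = u$2 * v$3 - u$3 * v$2"
  "cross u v $ 2 = u$3 * v$1 - u$1 * v$3"
  "cross u v $ 3 = u$1 * v$2 - u$2 * v$1"
  unfolding cross_def by simp_all

lemma dot_3: "dot u v = u$1 * v$1 + u$2 * v$2 + u$3 * v$3"
  unfolding dot_def by (simp add: sum_3)

lemma mixed_3: "mixed u v w = u$1 * (v$2 * w$3 - v$3 * w$2) + u$2 * (v$3 * w$1 - v$1 * w$3)
    + u$3 * (v$1 * w$2 - v$2 * w$1)"
  unfolding mixed_def by (simp add: det_3 transpose_def algebra_simps)

lemma stack_surj: "\<exists>u v. T = stack u v"
  by (rule exI[of _ "vector [T$1, T$2, T$3]"], rule exI[of _ "vector [T$4, T$5, T$6]"])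
     (simp add: vec_eq_iff forall_6)

definition dotn :: "'a::comm_ring_1^'n::finite \<Rightarrow> 'a^'n \<Rightarrow> 'a" where
  "dotn x y = (\<Sum>i\<in>UNIV. x$i * y$i)"

lemma dotn_stack: "dotn (stack a b) (stack u v) = dot a u + dot b v"
  unfolding dotn_def by (simp add: sum_6 dot_3)

lemma dotn_simps:
  "dotn (x + y) z = dotn x z + dotn y z" "dotn (x - y) z = dotn x z - dotn y z"
  "dotn (c *s x) z = c * dotn x z" "dotn x (c *s z) = c * dotn x z" "dotn 0 z = 0" "dotn z 0 = 0"
  unfolding dotn_def
  by (simp_all add: sum.distrib sum_subtractf distrib_right left_diff_distrib sum_distrib_left
      mult.assoc mult.left_commute)

lemma dotn_diff_scale: "dotn x (y - c *s z) = dotn x y - c * dotn x z"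
  unfolding dotn_def
  by (simp add: sum_subtractf right_diff_distrib sum_distrib_left mult.left_commute)

lemma dotn_axis: "dotn (axis i 1) x = x $ i"
proof -
  have "dotn (axis i 1) x = (\<Sum>j\<in>UNIV. if j = i then x $ j else 0)"
    unfolding dotn_def axis_def by (intro sum.cong) auto
  then show ?thesis by simp
qed

section \<open>Determinants given by their rows\<close>

text \<open>The rows are separate arguments so that linearity in a single row can be stated. The
  nested conditionals have the shape that \<open>det_linear_row_sum\<close> expects for row
  1.\<close>

definition det6 :: "'a::comm_ring_1^6 \<Rightarrow> 'a^6 \<Rightarrow> 'a^6 \<Rightarrow> 'a^6 \<Rightarrow> 'a^6 \<Rightarrow> 'a^6 \<Rightarrow> 'a" where
  "det6 r1 r2 r3 r4 r5 r6 = det (\<chi> i. if i = 1 then r1 else if i = 2 then r2 else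
     if i = 3 then r3 else if i = 4 then r4 else if i = 5 then r5 else r6)"

lemma det_row_lincomb:
  fixes a :: "'j \<Rightarrow> 'a::comm_ring_1^'n::finite"
  assumes "finite S"
  shows "det (\<chi> i. if i = k then (\<Sum>j\<in>S. c j *s a j) else f i) =
         (\<Sum>j\<in>S. c j * det (\<chi> i. if i = k then a j else f i))"
  using det_linear_row_sum[OF assms, of k "\<lambda>i j. c j *s a j" f]
  by (simp add: det_row_mul)

lemma det6_lincomb:
  assumes "finite S"
  shows "det6 (\<Sum>j\<in>S. c j *s a j) r2 r3 r4 r5 r6 = (\<Sum>j\<in>S. c j * det6 (a j) r2 r3 r4 r5 r6)"
    and "det6 r1 r2 r3 (\<Sum>j\<in>S. c j *s a j) r5 r6 = (\<Sum>j\<in>S. c j * det6 r1 r2 r3 (a j) r5 r6)"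
    and "det6 r1 r2 r3 r4 (\<Sum>j\<in>S. c j *s a j) r6 = (\<Sum>j\<in>S. c j * det6 r1 r2 r3 r4 (a j) r6)"
    and "det6 r1 r2 r3 r4 r5 (\<Sum>j\<in>S. c j *s a j) = (\<Sum>j\<in>S. c j * det6 r1 r2 r3 r4 r5 (a j))"
proof -
  have 1: "det6 x r2 r3 r4 r5 r6 = det (\<chi> i. if i = 1 then x else if i = 2 then r2 else
     if i = 3 then r3 else if i = 4 then r4 else if i = 5 then r5 else r6)" for x
    unfolding det6_def ..
  show "det6 (\<Sum>j\<in>S. c j *s a j) r2 r3 r4 r5 r6 = (\<Sum>j\<in>S. c j * det6 (a j) r2 r3 r4 r5 r6)"
    unfolding 1 by (rule det_row_lincomb[OF assms])
  \<comment> \<open>The tests are reordered so that the varying row comes first, as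
    \<open>det_row_lincomb\<close> requires.\<close>
  have 4: "det6 r1 r2 r3 x r5 r6 = det (\<chi> i. if i = 4 then x else if i = 1 then r1 else
     if i = 2 then r2 else if i = 3 then r3 else if i = 5 then r5 else r6)" for x
    unfolding det6_def by (rule arg_cong[of _ _ det], rule arg_cong[of _ _ vec_lambda], rule ext)
      (use exhaust_6 in auto)
  show "det6 r1 r2 r3 (\<Sum>j\<in>S. c j *s a j) r5 r6 = (\<Sum>j\<in>S. c j * det6 r1 r2 r3 (a j) r5 r6)"
    unfolding 4 by (rule det_row_lincomb[OF assms])
  have 5: "det6 r1 r2 r3 r4 x r6 = det (\<chi> i. if i = 5 then x else if i = 1 then r1 else
     if i = 2 then r2 else if i = 3 then r3 else if i = 4 then r4 else r6)" for x
    unfolding det6_def by (rule arg_cong[of _ _ det], rule arg_cong[of _ _ vec_lambda], rule ext)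
      (use exhaust_6 in auto)
  show "det6 r1 r2 r3 r4 (\<Sum>j\<in>S. c j *s a j) r6 = (\<Sum>j\<in>S. c j * det6 r1 r2 r3 r4 (a j) r6)"
    unfolding 5 by (rule det_row_lincomb[OF assms])
  have 6: "det6 r1 r2 r3 r4 r5 x = det (\<chi> i. if i = 6 then x else if i = 1 then r1 else
     if i = 2 then r2 else if i = 3 then r3 else if i = 4 then r4 else r5)" for x
    unfolding det6_def by (rule arg_cong[of _ _ det], rule arg_cong[of _ _ vec_lambda], rule ext)
      (use exhaust_6 in auto)
  show "det6 r1 r2 r3 r4 r5 (\<Sum>j\<in>S. c j *s a j) = (\<Sum>j\<in>S. c j * det6 r1 r2 r3 r4 r5 (a j))"
    unfolding 6 by (rule det_row_lincomb[OF assms])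
qed

lemma det6_eq_0:
  assumes "r1 \<in> {r2, r3, r4, r5, r6}"
  shows "det6 r1 r2 r3 r4 r5 r6 = 0"
proof -
  let ?M = "\<chi> i. if i = (1::6) then r1 else if i = 2 then r2 else
     if i = 3 then r3 else if i = 4 then r4 else if i = 5 then r5 else r6"
  obtain j where "j \<noteq> 1" "row 1 ?M = row j ?M"
  proof -
    consider "r1 = r2" | "r1 = r3" | "r1 = r4" | "r1 = r5" | "r1 = r6" using assms by auto
    then show thesis
    proof cases
      case 1 show thesis using 1 by (intro that[of 2]) (auto simp: row_def vec_eq_iff)
    next
      case 2 show thesis using 2 by (intro that[of 3]) (auto simp: row_def vec_eq_iff)
    next
      case 3 show thesis using 3 by (intro that[of 4]) (auto simp: row_def vec_eq_iff)
    next
      case 4 show thesis using 4 by (intro that[of 5]) (auto simp: row_def vec_eq_iff)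
    next
      case 5 show thesis using 5 by (intro that[of 6]) (auto simp: row_def vec_eq_iff)
    qed
  qed
  then show ?thesis unfolding det6_def by (intro det_identical_rows[of 1 j]) auto
qed

text \<open>The generalised cross product of five vectors in six-space: its coordinates are their
  signed maximal minors.\<close>

definition wedge5 :: "'a::comm_ring_1^6 \<Rightarrow> 'a^6 \<Rightarrow> 'a^6 \<Rightarrow> 'a^6 \<Rightarrow> 'a^6 \<Rightarrow> 'a^6" where
  "wedge5 r2 r3 r4 r5 r6 = (\<chi> c. det6 (axis c 1) r2 r3 r4 r5 r6)"

lemma dotn_wedge5: "dotn x (wedge5 r2 r3 r4 r5 r6) = det6 x r2 r3 r4 r5 r6"
proof -
  have "det6 x r2 r3 r4 r5 r6 = det6 (\<Sum>c\<in>UNIV. x$c *s axis c 1) r2 r3 r4 r5 r6"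
    unfolding basis_expansion ..
  also have "\<dots> = dotn x (wedge5 r2 r3 r4 r5 r6)"
    by (subst det6_lincomb) (simp_all add: wedge5_def dotn_def)
  finally show ?thesis ..
qed

text \<open>A nonzero coordinate c of the wedge makes the five rows, completed by the basis vector
  c, an invertible matrix. Subtracting from T the multiple of the wedge with the same coordinate c
  leaves a vector killed by all six rows.\<close>

lemma wedge5_kernel:
  fixes T :: "'a::field^6"
  assumes nz: "wedge5 r2 r3 r4 r5 r6 \<noteq> 0"
    and T: "dotn r2 T = 0" "dotn r3 T = 0" "dotn r4 T = 0" "dotn r5 T = 0" "dotn r6 T = 0"
  shows "T \<in> pt (wedge5 r2 r3 r4 r5 r6)"
proof -
  define G where "G = wedge5 r2 r3 r4 r5 r6"
  obtain c where c: "G $ c \<noteq> 0" using nz by (auto simp: G_def vec_eq_iff)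
  define M :: "'a^6^6" where "M = (\<chi> i. if i = 1 then axis c 1 else if i = 2 then r2 else
     if i = 3 then r3 else if i = 4 then r4 else if i = 5 then r5 else r6)"
  have detM: "det M \<noteq> 0" using c by (simp add: G_def wedge5_def det6_def M_def)
  have G0: "dotn r2 G = 0" "dotn r3 G = 0" "dotn r4 G = 0" "dotn r5 G = 0" "dotn r6 G = 0"
    unfolding G_def dotn_wedge5 by (simp_all add: det6_eq_0)
  define Y where "Y = T - (T$c / G$c) *s G"
  have dY: "dotn r Y = dotn r T - (T$c / G$c) * dotn r G" for r
    unfolding Y_def by (rule dotn_diff_scale)
  have "M *v Y = 0"
    unfolding vec_eq_iff forall_6 matrix_vector_mult_def
    using T G0 dY c dotn_axis[of c Y]
    by (simp add: M_def flip: dotn_def) (simp add: Y_def)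
  then have "Y = 0"
    using detM by (metis invertible_det_nz invertible_def matrix_vector_mul_assoc
        matrix_vector_mul_lid matrix_vector_mult_0_right)
  then show ?thesis
    unfolding pt_def G_def[symmetric] Y_def by auto
qed

section \<open>The equations of the reciprocal twists\<close>

text \<open>The moment comes first, opposite to the rows of \<open>Jac\<close>, so that
  \<open>dotn\<close> with \<open>stack \<Omega> V\<close> is the reciprocity pairing at P =
  0.\<close>

definition limb_row :: "'a::comm_ring_1^3^6 \<Rightarrow> 'a^3^6 \<Rightarrow> 6 \<Rightarrow> 'a^6" where
  "limb_row A C i = stack (cross (A$i) (C$i)) (C$i)"

text \<open>$[A_2, A_3, A_4]$ times the combination of rows $j$, 2, 3, 4 in which the $A_i$ cancel.\<close>

definition dep_row :: "'a::comm_ring_1^3^6 \<Rightarrow> 'a^3^6 \<Rightarrow> 6 \<Rightarrow> 'a^6" where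
  "dep_row A C j = mixed (A$2) (A$3) (A$4) *s limb_row A C j
     - mixed (A$j) (A$3) (A$4) *s limb_row A C 2 - mixed (A$2) (A$j) (A$4) *s limb_row A C 3
     - mixed (A$2) (A$3) (A$j) *s limb_row A C 4"

definition dir :: "'a::zero^4 \<Rightarrow> 'a^3" where
  "dir v = vector [v$2, v$3, v$4]"

text \<open>With $v = (w, P)$, the limbs 2, 3, 4 give rows 2, 3, 4 and the first limb gives row 1. Row 5
  is the combination of rows 2, 3, 4 that eliminates $P \times \Omega$, divided by $w$; it is
  what makes the system have rank 5 also at infinity.\<close>

definition lin_row :: "'a::comm_ring_1^3^6 \<Rightarrow> 'a^3^6 \<Rightarrow> 5 \<Rightarrow> 'a^4 \<Rightarrow> 'a^6" where
  "lin_row A C k v =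
     (if k = 1 then stack 0 (dir v)
      else if k = 2 then v$1 *s limb_row A C 2 + stack (cross (A$2) (dir v)) 0
      else if k = 3 then v$1 *s limb_row A C 3 + stack (cross (A$3) (dir v)) 0
      else if k = 4 then v$1 *s limb_row A C 4 + stack (cross (A$4) (dir v)) 0
      else mixed (dir v) (A$3) (A$4) *s limb_row A C 2
         + mixed (dir v) (A$4) (A$2) *s limb_row A C 3
         + mixed (dir v) (A$2) (A$3) *s limb_row A C 4)"

text \<open>Three vector arguments polarise the cubic forms: the result is trilinear, so it is
  determined by its values on basis vectors. The minors at v are obtained for x = y = z = v.\<close>

definition minor_vec :: "'a::comm_ring_1^3^6 \<Rightarrow> 'a^3^6 \<Rightarrow> 5 \<Rightarrow> 5 \<Rightarrow> 5 \<Rightarrow> 'a^4 \<Rightarrow> 'a^4 \<Rightarrow> 'a^4 \<Rightarrow> 'a^6" where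
  "minor_vec A C k l m x y z = wedge5 (dep_row A C 5) (dep_row A C 6)
     (lin_row A C k x) (lin_row A C l y) (lin_row A C m z)"

lemma dir_nth [simp]: "dir v $ 1 = v$2" "dir v $ 2 = v$3" "dir v $ 3 = v$4"
    by (simp_all add: dir_def)

lemma lin_row_add: "lin_row A C k (x + y) = lin_row A C k x + lin_row A C k y"
proof -
  have "lin_row A C k (x + y) $ i = lin_row A C k x $ i + lin_row A C k y $ i" for i
    using exhaust_5[of k] exhaust_6[of i]
    by (elim disjE) (simp_all add: lin_row_def mixed_3 algebra_simps)
  then show ?thesis by (simp add: vec_eq_iff)
qed

lemma lin_row_scale: "lin_row A C k (c *s x) = c *s lin_row A C k x"
proof -
  have "lin_row A C k (c *s x) $ i = c * lin_row A C k x $ i" for i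
    using exhaust_5[of k] exhaust_6[of i]
    by (elim disjE) (simp_all add: lin_row_def mixed_3 algebra_simps)
  then show ?thesis by (simp add: vec_eq_iff)
qed

lemma lin_row_sum: "lin_row A C k (sum f S) = (\<Sum>a\<in>S. lin_row A C k (f a))"
proof (induction S rule: infinite_finite_induct)
  case (infinite S)
  then show ?case using lin_row_scale[of A C k 0 0] by simp
next
  case empty
  then show ?case using lin_row_scale[of A C k 0 0] by simp
qed (simp add: lin_row_add)

lemma lin_row_expand: "lin_row A C k v = (\<Sum>a\<in>UNIV. v$a *s lin_row A C k (axis a 1))"
proof -
  have "lin_row A C k v = lin_row A C k (\<Sum>a\<in>UNIV. v$a *s axis a 1)"
    unfolding basis_expansion ..
  then show ?thesis by (simp add: lin_row_sum lin_row_scale)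
qed

lemma minor_vec_expand:
  "minor_vec A C k l m x y z $ c = (\<Sum>a\<in>UNIV. \<Sum>b\<in>UNIV. \<Sum>d\<in>UNIV.
     minor_vec A C k l m (axis a 1) (axis b 1) (axis d 1) $ c * (x$a * y$b * z$d))"
proof -
  have "minor_vec A C k l m x y z $ c = (\<Sum>a\<in>UNIV. x$a * (\<Sum>b\<in>UNIV. y$b * (\<Sum>d\<in>UNIV. z$d *
     minor_vec A C k l m (axis a 1) (axis b 1) (axis d 1) $ c)))"
    unfolding minor_vec_def wedge5_def vec_lambda_beta
    by (subst lin_row_expand[of A C k x], subst det6_lincomb(2), simp,
        subst lin_row_expand[of A C l y], subst det6_lincomb(3), simp,
        subst lin_row_expand[of A C m z], subst det6_lincomb(4), simp, rule refl)
  then show ?thesis by (simp add: sum_distrib_left mult_ac)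
qed

section \<open>Change of rings\<close>

text \<open>Stated for commutative rings because \<open>so3_fun\<close> is not a field. The maps
  that matter are evaluation at the identity rotation, the embedding of \<open>so3_fun\<close> into
  the algebraic closure, and \<open>to_ac\<close>.\<close>

definition ring_map :: "('a::comm_ring_1 \<Rightarrow> 'b::comm_ring_1) \<Rightarrow> bool" where
  "ring_map h \<longleftrightarrow> h 1 = 1 \<and> (\<forall>x y. h (x + y) = h x + h y) \<and> (\<forall>x y. h (x * y) = h x * h y)"

lemma ring_mapD:
  assumes "ring_map h"
  shows "h 1 = 1" "h (x + y) = h x + h y" "h (x * y) = h x * h y"
    "h 0 = 0" "h (- x) = - h x" "h (x - y) = h x - h y"
proof -
  show 1: "h 1 = 1" "h (x + y) = h x + h y" "h (x * y) = h x * h y" for x y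
    using assms by (auto simp: ring_map_def)
  show 0: "h 0 = 0" using 1(2)[of 0 0] by simp
  show 2: "h (- x) = - h x" for x using 1(2)[of x "- x"] 0 by (simp add: add_eq_0_iff)
  show "h (x - y) = h x - h y" using 1(2)[of x "- y"] 2 by simp
qed

lemma ring_map_sum:
  assumes "ring_map h"
  shows "h (sum f S) = (\<Sum>i\<in>S. h (f i))"
  by (induction S rule: infinite_finite_induct) (simp_all add: ring_mapD[OF assms])

lemma ring_map_prod:
  assumes "ring_map h"
  shows "h (prod f S) = (\<Prod>i\<in>S. h (f i))"
  by (induction S rule: infinite_finite_induct) (simp_all add: ring_mapD[OF assms])

lemma ring_map_of_int:
  assumes "ring_map h"
  shows "h (of_int n) = of_int n"
proof -
  have "h (of_nat m) = of_nat m" for m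
    by (induction m) (simp_all add: ring_mapD[OF assms])
  then show ?thesis
    by (cases n rule: int_cases2) (simp_all add: ring_mapD[OF assms])
qed

lemma ring_map_det:
  fixes M :: "'a::comm_ring_1^'n::finite^'n"
  assumes "ring_map h"
  shows "h (det M) = det (\<chi> i j. h (M$i$j))"
  unfolding det_def
  by (simp add: ring_map_sum[OF assms] ring_map_prod[OF assms] ring_map_of_int[OF assms]
      ring_mapD[OF assms])

definition map_vec :: "('a \<Rightarrow> 'b) \<Rightarrow> 'a^'n \<Rightarrow> 'b^'n" where
  "map_vec h x = (\<chi> i. h (x$i))"

lemma map_vec_nth [simp]: "map_vec h x $ i = h (x$i)"
  by (simp add: map_vec_def)

context
  fixes h :: "'a::comm_ring_1 \<Rightarrow> 'b::comm_ring_1"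
  assumes h: "ring_map h"
begin

lemma map_vec_simps:
  "map_vec h (x + y) = map_vec h x + map_vec h y"
  "map_vec h (x - y) = map_vec h x - map_vec h y"
  "map_vec h (c *s x) = h c *s map_vec h x"
  "map_vec h 0 = 0"
  "map_vec h (axis i 1) = axis i 1"
  by (simp_all add: vec_eq_iff ring_mapD[OF h] axis_def)

lemma map_vec_cross: "map_vec h (cross u v) = cross (map_vec h u) (map_vec h v)"
  by (simp add: vec_eq_iff forall_3 ring_mapD[OF h])

lemma map_vec_stack: "map_vec h (stack u v) = stack (map_vec h u) (map_vec h v)"
  by (simp add: vec_eq_iff forall_6)

lemma map_vec_dir: "map_vec h (dir v) = dir (map_vec h v)"
  by (simp add: vec_eq_iff forall_3)

lemma ring_map_mixed: "h (mixed u v w) = mixed (map_vec h u) (map_vec h v) (map_vec h w)"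
  by (simp add: mixed_3 ring_mapD[OF h])

lemma ring_map_det6: "h (det6 a b c d e f) = det6 (map_vec h a) (map_vec h b) (map_vec h c)
    (map_vec h d) (map_vec h e) (map_vec h f)"
  unfolding det6_def ring_map_det[OF h]
  by (rule arg_cong[of _ _ det]) (simp add: vec_eq_iff)

lemma map_vec_dep_row: "map_vec h (dep_row A C j) =
    dep_row (map_vec (map_vec h) A) (map_vec (map_vec h) C) j"
  by (simp add: dep_row_def limb_row_def map_vec_simps map_vec_cross map_vec_stack ring_map_mixed)

lemma map_vec_lin_row: "map_vec h (lin_row A C k v) =
    lin_row (map_vec (map_vec h) A) (map_vec (map_vec h) C) k (map_vec h v)"
  by (simp add: lin_row_def limb_row_def map_vec_simps map_vec_cross map_vec_stack
      ring_map_mixed map_vec_dir)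

lemma map_vec_minor_vec: "map_vec h (minor_vec A C k l m x y z) =
    minor_vec (map_vec (map_vec h) A) (map_vec (map_vec h) C) k l m
      (map_vec h x) (map_vec h y) (map_vec h z)"
  by (simp add: vec_eq_iff minor_vec_def wedge5_def ring_map_det6 map_vec_dep_row map_vec_lin_row
      map_vec_simps)

end

section \<open>Cubic forms without common zeros\<close>

text \<open>A cubic form in four variables is a linear functional on $v \otimes v \otimes v$. The rows
  below are the coefficients of the $5 \times 5$ minors, together with functionals that vanish on
  symmetric tensors. As soon as they span the dual of the space of all tensors, the minors
  have no common zero in projective space, over any extension field.\<close>

type_synonym tensor_index = "4 \<times> 4 \<times> 4"

definition tensor_row ::
    "'a::comm_ring_1^3^6 \<Rightarrow> 'a^3^6 \<Rightarrow> (6 \<times> 5 \<times> 5 \<times> 5) + (tensor_index \<times> bool) \<Rightarrow> 'a^tensor_index" where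
  "tensor_row A C j = (case j of
     Inl (c, k, l, m) \<Rightarrow>
       (\<chi> t. minor_vec A C k l m (axis (fst t) 1) (axis (fst (snd t)) 1) (axis (snd (snd t)) 1) $ c)
   | Inr ((a, b, d), sw) \<Rightarrow> axis (a, b, d) 1 - axis (if sw then (b, a, d) else (a, d, b)) 1)"

text \<open>The map \<open>s\<close> selects a square matrix among the tensor rows. The bracket is a
  factor so that one polynomial also records the independence of the base points 2, 3 and 4.\<close>

definition tensor_det where
  "tensor_det s A C = mixed (A$2) (A$3) (A$4) * det (\<chi> t. tensor_row A C (s t))"

lemma ring_map_tensor_det:
  assumes "ring_map h"
  shows "h (tensor_det s A C) = tensor_det s (map_vec (map_vec h) A) (map_vec (map_vec h) C)"
proof -
  have "h (tensor_row A C j $ t) = tensor_row (map_vec (map_vec h) A) (map_vec (map_vec h) C) j $ t"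
    for j t
  proof (cases j)
    case (Inl j')
    obtain c k l m where j': "j' = (c, k, l, m)" by (cases j') auto
    show ?thesis
      using map_vec_minor_vec[OF assms, of A C k l m "axis (fst t) 1" "axis (fst (snd t)) 1"
          "axis (snd (snd t)) 1"]
      unfolding map_vec_simps[OF assms] by (auto simp: Inl j' tensor_row_def vec_eq_iff)
  next
    case (Inr j')
    then show ?thesis
      by (auto simp: tensor_row_def ring_mapD[OF assms] axis_def split: prod.splits)
  qed
  then show ?thesis
    by (simp add: tensor_det_def ring_mapD[OF assms] ring_map_mixed[OF assms] ring_map_det[OF assms])
qed

lemma sum_triple: "(\<Sum>t\<in>(UNIV :: (4 \<times> 4 \<times> 4) set). f t) =
    (\<Sum>a\<in>UNIV. \<Sum>b\<in>UNIV. \<Sum>d\<in>UNIV. f (a, b, d))"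
  by (simp add: sum.cartesian_product)

lemma det_nonzero_kernel:
  fixes M :: "'a::field^'n::finite^'n"
  assumes "det M \<noteq> 0" "\<And>i. dotn (M$i) y = 0"
  shows "y = 0"
proof -
  have "M *v y = 0"
    using assms(2) by (simp add: vec_eq_iff matrix_vector_mult_def dotn_def)
  then show ?thesis
    using assms(1) by (metis invertible_det_nz invertible_def matrix_vector_mul_assoc
        matrix_vector_mul_lid matrix_vector_mult_0_right)
qed

lemma minor_vec_nonzero:
  fixes A C :: "'a::field^3^6"
  assumes s: "tensor_det s A C \<noteq> 0" and v: "v \<noteq> 0"
  obtains k l m where "minor_vec A C k l m v v v \<noteq> 0"
proof (rule ccontr)
  assume "\<not> thesis"
  then have z: "minor_vec A C k l m v v v = 0" for k l m using that by blast
  define y :: "'a^tensor_index" where "y = (\<chi> t. v$(fst t) * v$(fst (snd t)) * v$(snd (snd t)))"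
  have "dotn (tensor_row A C j) y = 0" for j
  proof (cases j)
    case (Inl j')
    obtain c k l m where j': "j' = (c, k, l, m)" by (cases j') auto
    have "dotn (tensor_row A C j) y = minor_vec A C k l m v v v $ c"
      unfolding minor_vec_expand[of A C k l m v v v c]
      by (simp add: Inl j' dotn_def tensor_row_def y_def sum_triple)
    then show ?thesis by (simp add: z)
  next
    case (Inr j')
    obtain a b d sw where j': "j' = ((a, b, d), sw)" by (cases j') auto
    show ?thesis
      by (simp add: Inr j' tensor_row_def dotn_simps dotn_axis y_def)
  qed
  then have "y = 0"
    using s by (intro det_nonzero_kernel[of "\<chi> t. tensor_row A C (s t)"]) (auto simp: tensor_det_def)
  \<comment> \<open>The entry at (a, a, a) is the cube of the coordinate a of v.\<close>
  then have "y $ (a, a, a) = 0" for a by simp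
  then have "v$a = 0" for a by (simp add: y_def)
  then show False using v by (simp add: vec_eq_iff)
qed

text \<open>Over the reals a proper subspace has a nonzero orthogonal vector, so the hypothesis says
  that the vectors span. A basis chosen among them and listed by a bijection from \<open>'n\<close>
  gives the rows of a nonsingular matrix.\<close>

lemma det_selection:
  fixes r :: "'j \<Rightarrow> real^'n::finite"
  assumes "\<And>y. (\<And>j. dotn (r j) y = 0) \<Longrightarrow> y = 0"
  obtains s where "det (\<chi> i. r (s i)) \<noteq> 0"
proof -
  have inner: "dotn x y = y \<bullet> x" for x y :: "real^'n"
    by (simp add: dotn_def inner_vec_def mult.commute)
  have sp: "span (range r) = UNIV"
  proof (rule ccontr)
    assume "span (range r) \<noteq> UNIV"
    then obtain a where "a \<noteq> 0" "\<forall>x\<in>span (range r). a \<bullet> x = 0"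
      using span_not_UNIV_orthogonal by blast
    then show False using assms[of a] by (simp add: inner span_base)
  qed
  obtain B where B: "B \<subseteq> range r" "independent B" "range r \<subseteq> span B"
    using maximal_independent_subset by blast
  have spB: "span B = UNIV" using B(3) sp by (metis span_mono span_span top.extremum_unique)
  have "card B = CARD('n)"
    using basis_card_eq_dim[of B UNIV] B(2) spB by (simp add: dim_UNIV)
  moreover have "finite B" using B(2) independent_imp_finite by blast
  ultimately obtain f where f: "bij_betw f (UNIV :: 'n set) B"
    using finite_same_card_bij[of "UNIV :: 'n set" B] by auto
  define s where "s i = inv_into UNIV r (f i)" for i
  have rs: "r (s i) = f i" for i
    unfolding s_def using B(1) f by (auto intro!: f_inv_into_f simp: bij_betw_def)
  let ?M = "\<chi> i. r (s i)"
  have "y = 0" if "?M *v y = 0" for y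
  proof -
    have "y \<bullet> f i = 0" for i
      using that rs by (simp add: vec_eq_iff matrix_vector_mult_def flip: dotn_def inner)
    then have "y \<bullet> b = 0" if "b \<in> B" for b using f that by (auto simp: bij_betw_def)
    then have "orthogonal y x" if "x \<in> span B" for x
      using orthogonal_to_span[OF that] by (simp add: orthogonal_def)
    then show ?thesis using spB by (metis UNIV_I orthogonal_self)
  qed
  then have "det ?M \<noteq> 0"
    by (metis invertible_det_nz invertible_left_inverse matrix_left_invertible_ker)
  then show thesis by (rule that)
qed

section \<open>An example where the minors span all cubic forms\<close>

text \<open>The Leibniz sum over a subset of the indices. Removing the indices one at a time expands
  a concrete determinant without listing all 720 permutations.\<close>

definition perm_det :: "6 set \<Rightarrow> (6 \<Rightarrow> 6 \<Rightarrow> 'a::comm_ring_1) \<Rightarrow> 'a" where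
  "perm_det S f = (\<Sum>p | p permutes S. of_int (sign p) * (\<Prod>i\<in>S. f i (p i)))"

text \<open>Each permutation of \<open>insert k S\<close> is uniquely a permutation q of S followed
  by the exchange of k and some b. As q fixes k, row k contributes \<open>f k b\<close>, and the
  exchange contributes the sign.\<close>

lemma perm_det_insert:
  assumes "k \<notin> S"
  shows "perm_det (insert k S) f = (\<Sum>b\<in>insert k S.
     (if b = k then 1 else - 1) * f k b * perm_det S (\<lambda>i j. f i (Transposition.transpose k b j)))"
proof -
  have fin: "finite S" by simp
  have "perm_det (insert k S) f = (\<Sum>b\<in>insert k S. \<Sum>q | q permutes S.
     of_int (sign (Transposition.transpose k b \<circ> q)) * (\<Prod>i\<in>insert k S. f i ((Transposition.transpose k b \<circ> q) i)))"
    unfolding perm_det_def by (rule sum_over_permutations_insert[OF fin assms])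
  also have "\<dots> = (\<Sum>b\<in>insert k S.
     (if b = k then 1 else - 1) * f k b * perm_det S (\<lambda>i j. f i (Transposition.transpose k b j)))"
    unfolding perm_det_def sum_distrib_left
  proof (intro sum.cong refl)
    fix b q assume "q \<in> {q. q permutes S}"
    then have q: "q permutes S" by simp
    have "sign (Transposition.transpose k b \<circ> q) = sign (Transposition.transpose k b) * sign q"
      using q fin permutation_permutes by (intro sign_compose permutation_swap_id) blast
    moreover have "q k = k" using q assms by (metis permutes_not_in)
    ultimately show "of_int (sign (Transposition.transpose k b \<circ> q)) * (\<Prod>i\<in>insert k S. f i ((Transposition.transpose k b \<circ> q) i))
      = (if b = k then 1 else - 1) * f k b * (of_int (sign q) * (\<Prod>i\<in>S. f i (Transposition.transpose k b (q i))))"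
      using assms by (auto simp: sign_swap_id)
  qed
  finally show ?thesis .
qed

lemma perm_det_sing: "perm_det {k} f = f k k"
proof -
  have "{p. p permutes {k}} = {id}" by (auto simp: permutes_sing)
  then show ?thesis by (simp add: perm_det_def)
qed

lemma det6_perm_det: "det6 a b c d e f = perm_det {1, 2, 3, 4, 5, 6} (\<lambda>i j.
  (if i = 1 then a else if i = 2 then b else if i = 3 then c else if i = 4 then d
   else if i = 5 then e else f) $ j)"
  unfolding det6_def det_def perm_det_def UNIV_6 by simp

lemma perm_det_456: "perm_det {4, 5, 6} f =
    f 4 4 * (f 5 5 * f 6 6 - f 5 6 * f 6 5) + f 4 5 * (f 5 6 * f 6 4 - f 5 4 * f 6 6)
    + f 4 6 * (f 5 4 * f 6 5 - f 5 5 * f 6 4)"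
  by (simp add: perm_det_insert perm_det_sing Transposition.transpose_def algebra_simps)

text \<open>On the twists killed by $n$ and $p$ we have $V_2 = - \Omega_3$ and $V_3 = 2 \Omega_2$, so the
  determinants become minors in the coordinates $\Omega_1, \Omega_2, \Omega_3, V_1$.\<close>

lemma det6_example:
  fixes n p x y z :: "'a::comm_ring_1^6"
  assumes n: "n = stack (vector [0,0,1]) (vector [0,1,0])"
   and p: "p = stack (vector [0,-2,0]) (vector [0,0,1])"
  defines "q u \<equiv> u$2 + 2 * u$6" and "r u \<equiv> u$3 - u$5"
  shows "det6 (axis 1 1) n p x y z = mixed (vector [x$4, q x, r x]) (vector [y$4, q y, r y]) (vector [z$4, q z, r z])"
    and "det6 (axis 2 1) n p x y z = - mixed (vector [x$4, x$1, r x]) (vector [y$4, y$1, r y]) (vector [z$4, z$1, r z])"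
    and "det6 (axis 3 1) n p x y z = mixed (vector [x$4, x$1, q x]) (vector [y$4, y$1, q y]) (vector [z$4, z$1, q z])"
    and "det6 (axis 4 1) n p x y z = - mixed (vector [x$1, q x, r x]) (vector [y$1, q y, r y]) (vector [z$1, q z, r z])"
proof -
  have np: "n$1 = 0" "n$2 = 0" "n$3 = 1" "n$4 = 0" "n$5 = 1" "n$6 = 0"
    "p$1 = 0" "p$2 = -2" "p$3 = 0" "p$4 = 0" "p$5 = 0" "p$6 = 1" by (simp_all add: n p)
  note t = Transposition.transpose_def
  have insert1: "perm_det {1, 2, 3, 4, 5, 6} f = (\<Sum>b\<in>{1, 2, 3, 4, 5, 6}. (if b = 1 then 1 else - 1) * f 1 b *
      perm_det {2, 3, 4, 5, 6} (\<lambda>i j. f i (Transposition.transpose 1 b j)))"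
    and insert2: "perm_det {2, 3, 4, 5, 6} f = (\<Sum>b\<in>{2, 3, 4, 5, 6}. (if b = 2 then 1 else - 1) * f 2 b *
      perm_det {3, 4, 5, 6} (\<lambda>i j. f i (Transposition.transpose 2 b j)))"
    and insert3: "perm_det {3, 4, 5, 6} f = (\<Sum>b\<in>{3, 4, 5, 6}. (if b = 3 then 1 else - 1) * f 3 b *
      perm_det {4, 5, 6} (\<lambda>i j. f i (Transposition.transpose 3 b j)))" for f :: "6 \<Rightarrow> 6 \<Rightarrow> 'a"
    by (rule perm_det_insert, simp)+
  show "det6 (axis 1 1) n p x y z = mixed (vector [x$4, q x, r x]) (vector [y$4, q y, r y]) (vector [z$4, q z, r z])"
    \<comment> \<open>The sparse rows 1, 2 and 3 are expanded first: their zeros discard most terms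
      before the remaining 3 x 3 determinants are written out.\<close>
    unfolding det6_perm_det by (simp add: insert1 axis_def, simp add: insert2 t np,
        simp add: insert3 t np perm_det_456, simp add: mixed_3 q_def r_def, simp add: algebra_simps)
  show "det6 (axis 2 1) n p x y z = - mixed (vector [x$4, x$1, r x]) (vector [y$4, y$1, r y]) (vector [z$4, z$1, r z])"
    unfolding det6_perm_det by (simp add: insert1 axis_def, simp add: insert2 t np,
        simp add: insert3 t np perm_det_456, simp add: mixed_3 q_def r_def, simp add: algebra_simps)
  show "det6 (axis 3 1) n p x y z = mixed (vector [x$4, x$1, q x]) (vector [y$4, y$1, q y]) (vector [z$4, z$1, q z])"
    unfolding det6_perm_det by (simp add: insert1 axis_def, simp add: insert2 t np,
        simp add: insert3 t np perm_det_456, simp add: mixed_3 q_def r_def, simp add: algebra_simps)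
  show "det6 (axis 4 1) n p x y z = - mixed (vector [x$1, q x, r x]) (vector [y$1, q y, r y]) (vector [z$1, q z, r z])"
    unfolding det6_perm_det by (simp add: insert1 axis_def, simp add: insert2 t np,
        simp add: insert3 t np perm_det_456, simp add: mixed_3 q_def r_def, simp add: algebra_simps)
qed

text \<open>A sparse example found by computer search; the identity rotation is used, so that the family
  $C$ can be prescribed.\<close>

definition example_base :: "real^3^6" where
  "example_base = vector [0, vector [1,0,0], vector [0,1,0], vector [0,0,1], vector [1,0,0], vector [2,0,0]]"

definition example_limbs :: "real^3^6" where
  "example_limbs = vector [0, vector [-1,0,0], vector [0,0,1], vector [0,1,0], vector [-1,1,0], vector [-2,0,1]]"

lemma vector_6 [simp]:
  "(vector [a,b,c,d,e,f] :: 'a::zero^6)$1 = a"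
  "(vector [a,b,c,d,e,f] :: 'a::zero^6)$2 = b"
  "(vector [a,b,c,d,e,f] :: 'a::zero^6)$3 = c"
  "(vector [a,b,c,d,e,f] :: 'a::zero^6)$4 = d"
  "(vector [a,b,c,d,e,f] :: 'a::zero^6)$5 = e"
  "(vector [a,b,c,d,e,f] :: 'a::zero^6)$6 = f"
  unfolding vector_def by simp_all

lemma example_dep_rows:
  "dep_row example_base example_limbs 5 = stack (vector [0,0,1]) (vector [0,1,0])"
  "dep_row example_base example_limbs 6 = stack (vector [0,-2,0]) (vector [0,0,1])"
  by (simp_all add: vec_eq_iff forall_6 dep_row_def limb_row_def mixed_3 example_base_def example_limbs_def)

text \<open>For each row, the four combinations are its coefficients in the coordinates Omega_1,
  Omega_2, Omega_3, V_1 that remain on the kernel of the two constant rows.\<close>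

lemma example_lin_rows:
  fixes v :: "real^4"
  defines "u k \<equiv> lin_row example_base example_limbs k v"
  shows
  "u 1 $ 1 = 0" "u 1 $ 2 + 2 * u 1 $ 6 = 2 * v$4" "u 1 $ 3 - u 1 $ 5 = - v$3" "u 1 $ 4 = v$2"
  "u 2 $ 1 = 0" "u 2 $ 2 + 2 * u 2 $ 6 = - v$4" "u 2 $ 3 - u 2 $ 5 = v$3" "u 2 $ 4 = - v$1"
  "u 3 $ 1 = v$1 + v$4" "u 3 $ 2 + 2 * u 3 $ 6 = 2 * v$1" "u 3 $ 3 - u 3 $ 5 = - v$2" "u 3 $ 4 = 0"
  "u 4 $ 1 = - v$1 - v$3" "u 4 $ 2 + 2 * u 4 $ 6 = v$2" "u 4 $ 3 - u 4 $ 5 = - v$1" "u 4 $ 4 = 0"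
  "u 5 $ 1 = v$3 - v$4" "u 5 $ 2 + 2 * u 5 $ 6 = 2 * v$3" "u 5 $ 3 - u 5 $ 5 = - v$4" "u 5 $ 4 = - v$2"
  unfolding u_def
  by (simp_all add: lin_row_def limb_row_def mixed_3 example_base_def example_limbs_def)

text \<open>Symmetry leaves 20 unknowns, as many as there are cubic monomials in four variables. The
  20 minors selected below form a nonsingular linear system for them.\<close>

lemma example_injective:
  assumes "\<And>j. dotn (tensor_row example_base example_limbs j) y = 0"
  shows "y = 0"
proof -
  define Y where "Y a b d = y$(a, b, d)" for a b d
  \<comment> \<open>The exchanges of the first two and of the last two indices generate all
    permutations of the three, so \<open>Y\<close> is symmetric.\<close>
  have sw: "Y a b d = Y b a d" "Y a b d = Y a d b" for a b d
    using assms[of "Inr ((a, b, d), True)"] assms[of "Inr ((a, b, d), False)"]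
    by (simp_all add: tensor_row_def dotn_simps dotn_axis Y_def)
  \<comment> \<open>Bubble sort as rewriting: only descending neighbours are exchanged, so
    simplification terminates with one representative per monomial.\<close>
  note sorted =
    sw(1)[of 2 1] sw(1)[of 3 1] sw(1)[of 3 2] sw(1)[of 4 1]
    sw(1)[of 4 2] sw(1)[of 4 3] sw(2)[of _ 2 1] sw(2)[of _ 3 1]
    sw(2)[of _ 3 2] sw(2)[of _ 4 1] sw(2)[of _ 4 2] sw(2)[of _ 4 3]
  have eq: "(\<Sum>a\<in>UNIV. \<Sum>b\<in>UNIV. \<Sum>d\<in>UNIV.
     det6 (axis c 1) (dep_row example_base example_limbs 5) (dep_row example_base example_limbs 6)
       (lin_row example_base example_limbs k (axis a 1)) (lin_row example_base example_limbs l (axis b 1))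
       (lin_row example_base example_limbs m (axis d 1)) * Y a b d) = 0" for c k l m
    using assms[of "Inl (c, k, l, m)"]
    by (simp add: tensor_row_def dotn_def sum_triple minor_vec_def wedge5_def Y_def)
  have axis_nth: "axis i (1::real) $ j = (if j = i then 1 else 0)" for i j :: 4
    by (simp add: axis_def)
  note ev = det6_example[OF example_dep_rows] example_lin_rows axis_nth sum_4 mixed_3 sorted
  have e0: "Y 1 3 4 + Y 3 4 4 = 0"
    using eq[of 4 1 2 3] by (simp add: ev)
  have e1: "- Y 1 3 4 - Y 3 3 4 = 0"
    using eq[of 4 1 2 4] by (simp add: ev)
  have e2: "- 2 * Y 1 1 2 + Y 2 2 2 = 0"
    using eq[of 1 1 3 4] by (simp add: ev)
  have e3: "2 * Y 1 1 1 - Y 1 2 2 = 0"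
    using eq[of 1 2 3 4] by (simp add: ev)
  have e4: "- Y 2 2 4 + 2 * Y 1 1 4 = 0"
    using eq[of 1 2 3 5] by (simp add: ev)
  have e5: "Y 2 2 3 - 2 * Y 1 1 3 = 0"
    using eq[of 1 2 4 5] by (simp add: ev)
  have e6: "4 * Y 1 2 4 + 2 * Y 2 4 4 + 2 * Y 2 3 4 = 0"
    using eq[of 3 1 3 5] by (simp add: ev)
  have e7: "2 * Y 1 2 3 + Y 2 3 3 + Y 2 3 4 = 0"
    using eq[of 2 1 4 5] by (simp add: ev)
  have e8: "- 2 * Y 1 2 4 + 2 * Y 1 1 3 + Y 2 2 4 - 2 * Y 1 2 3 = 0"
    using eq[of 1 1 2 3] by (simp add: ev)
  have e9: "Y 1 1 3 + Y 1 3 4 - Y 1 2 3 - Y 2 3 4 = 0"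
    using eq[of 2 1 2 3] by (simp add: ev)
  have e10: "- 2 * Y 1 1 4 - 2 * Y 1 4 4 + Y 1 2 4 + Y 2 4 4 = 0"
    using eq[of 3 1 2 3] by (simp add: ev)
  have e11: "- 2 * Y 1 1 4 + Y 1 2 3 + Y 1 2 4 - Y 2 2 3 = 0"
    using eq[of 1 1 2 4] by (simp add: ev)
  have e12: "- Y 1 1 3 - Y 1 3 3 + Y 1 2 3 + Y 2 3 3 = 0"
    using eq[of 2 1 2 4] by (simp add: ev)
  have e13: "2 * Y 1 1 4 + 2 * Y 1 3 4 - Y 1 2 4 - Y 2 3 4 = 0"
    using eq[of 3 1 2 4] by (simp add: ev)
  have e14: "- Y 1 1 2 - Y 1 2 4 - Y 1 2 2 - Y 2 2 3 = 0"
    using eq[of 2 1 3 4] by (simp add: ev)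
  have e15: "Y 1 2 2 + Y 2 2 4 + 2 * Y 1 1 2 + 2 * Y 1 2 3 = 0"
    using eq[of 3 1 3 4] by (simp add: ev)
  have e16: "Y 2 3 4 + Y 1 1 4 + Y 1 4 4 + Y 1 2 4 = 0"
    using eq[of 2 2 3 5] by (simp add: ev)
  have e17: "Y 2 3 4 + 2 * Y 1 1 3 + 2 * Y 1 3 3 + Y 1 2 3 = 0"
    using eq[of 3 2 4 5] by (simp add: ev)
  have e18: "2 * Y 1 4 4 + 2 * Y 4 4 4 - 2 * Y 2 3 4 + 2 * Y 2 4 4 - 2 * Y 3 3 4 - 2 * Y 1 3 4 = 0"
    using eq[of 4 1 3 5] by (simp add: ev)
  have e19: "- 2 * Y 3 4 4 - 2 * Y 1 3 4 + 2 * Y 1 3 3 + 2 * Y 3 3 3 + Y 2 3 3 - Y 2 3 4 = 0"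
    using eq[of 4 1 4 5] by (simp add: ev)
  note eqs = e0 e1 e2 e3 e4 e5 e6 e7 e8 e9 e10 e11 e12 e13 e14 e15 e16 e17 e18 e19
  have Y0: "Y 1 1 1 = 0" "Y 1 1 2 = 0" "Y 1 1 3 = 0" "Y 1 1 4 = 0" "Y 1 2 2 = 0" "Y 1 2 3 = 0" "Y 1 2 4 = 0" "Y 1 3 3 = 0" "Y 1 3 4 = 0" "Y 1 4 4 = 0" "Y 2 2 2 = 0" "Y 2 2 3 = 0" "Y 2 2 4 = 0" "Y 2 3 3 = 0" "Y 2 3 4 = 0" "Y 2 4 4 = 0" "Y 3 3 3 = 0" "Y 3 3 4 = 0" "Y 3 4 4 = 0" "Y 4 4 4 = 0"
    using eqs by linarith+
  have "Y a b d = 0" for a b d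
    using exhaust_4[of a] exhaust_4[of b] exhaust_4[of d]
    by (elim disjE) (simp_all add: sorted Y0)
  then show ?thesis by (simp add: vec_eq_iff Y_def)
qed

section \<open>Generic platforms\<close>

lemma real_polynomial_function_det [intro]:
  fixes M :: "'x::real_normed_vector \<Rightarrow> real^'n::finite^'n"
  assumes "\<And>i j. real_polynomial_function (\<lambda>x. M x $ i $ j)"
  shows "real_polynomial_function (\<lambda>x. det (M x))"
  unfolding det_def using assms
  by (intro real_polynomial_function_sum real_polynomial_function.intros(4) real_polynomial_function.intros(2)
      real_polynomial_function_prod finite_permutations finite) auto

lemma real_polynomial_function_tensor_det:
  fixes A C :: "'x::real_normed_vector \<Rightarrow> real^3^6"
  assumes A: "\<And>i j. real_polynomial_function (\<lambda>x. A x $ i $ j)"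
    and C: "\<And>i j. real_polynomial_function (\<lambda>x. C x $ i $ j)"
  shows "real_polynomial_function (\<lambda>x. tensor_det s (A x) (C x))"
proof -
  have mixed: "real_polynomial_function (\<lambda>x. mixed (u x) (v x) (w x))"
    if "\<And>i. real_polynomial_function (\<lambda>x. u x $ i)" "\<And>i. real_polynomial_function (\<lambda>x. v x $ i)"
      "\<And>i. real_polynomial_function (\<lambda>x. w x $ i)" for u v w :: "'x \<Rightarrow> real^3"
    unfolding mixed_3 by (intro real_polynomial_function.intros(3,4) real_polynomial_function_diff that)
  have cross: "real_polynomial_function (\<lambda>x. cross (u x) (v x) $ i)"
    if "\<And>i. real_polynomial_function (\<lambda>x. u x $ i)" "\<And>i. real_polynomial_function (\<lambda>x. v x $ i)"
    for u v :: "'x \<Rightarrow> real^3" and i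
    using exhaust_3[of i]
    by (elim disjE) (simp_all, (intro real_polynomial_function.intros(3,4) real_polynomial_function_diff that)+)
  have stack: "real_polynomial_function (\<lambda>x. stack (u x) (v x) $ i)"
    if "\<And>i. real_polynomial_function (\<lambda>x. u x $ i)" "\<And>i. real_polynomial_function (\<lambda>x. v x $ i)"
    for u v :: "'x \<Rightarrow> real^3" and i
    using exhaust_6[of i] by (elim disjE) (simp_all add: that)
  have limb: "real_polynomial_function (\<lambda>x. limb_row (A x) (C x) i $ j)" for i j
    unfolding limb_row_def by (intro stack cross A C)
  have dep: "real_polynomial_function (\<lambda>x. dep_row (A x) (C x) i $ j)" for i j
    unfolding dep_row_def vector_minus_component vector_smult_component
    by (intro real_polynomial_function.intros(3,4) real_polynomial_function_diff mixed limb A)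
  have If: "real_polynomial_function (\<lambda>x. if b then f x else g x)"
    if "real_polynomial_function f" "real_polynomial_function g" for b and f g :: "'x \<Rightarrow> real"
    using that by (cases b) simp_all
  have lin: "real_polynomial_function (\<lambda>x. lin_row (A x) (C x) k v $ j)" for k v j
    unfolding lin_row_def if_distrib[of "\<lambda>u. u $ j"] vector_add_component vector_smult_component
    by (intro If real_polynomial_function.intros(2,3,4) mixed limb stack cross A C)
  have minor: "real_polynomial_function (\<lambda>x. minor_vec (A x) (C x) k l m u v w $ j)" for k l m u v w j
    unfolding minor_vec_def wedge5_def vec_lambda_beta det6_def
    by (intro real_polynomial_function_det)
      (simp only: vec_lambda_beta if_distrib[of "\<lambda>u. u $ _"], intro If dep lin real_polynomial_function.intros(2))
  have "real_polynomial_function (\<lambda>x. tensor_row (A x) (C x) j $ t)" for j t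
    by (cases j) (auto simp: tensor_row_def split: prod.splits intro: minor real_polynomial_function.intros(2))
  then show ?thesis
    unfolding tensor_det_def
    by (intro real_polynomial_function.intros(4) real_polynomial_function_det mixed A) auto
qed

section \<open>Specialising the generic rotation to the identity\<close>

definition so3_to_Kbar :: "so3_fun \<Rightarrow> Kbar" where
  "so3_to_Kbar f = to_ac (Fract f 1)"

definition so3_at_id :: "so3_fun \<Rightarrow> real" where
  "so3_at_id f = Rep_so3_fun f (mat 1)"

lemma rotation_matrix_id: "rotation_matrix (mat 1 :: real^3^3)"
  by (simp add: rotation_matrix_def orthogonal_matrix_id)

lemma ring_map_so3_to_Kbar: "ring_map so3_to_Kbar"
  by (simp add: ring_map_def so3_to_Kbar_def One_fract_def[symmetric] flip: to_ac_add to_ac_mult)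

lemma ring_map_so3_at_id: "ring_map so3_at_id"
  by (simp add: ring_map_def so3_at_id_def plus_so3_fun.rep_eq times_so3_fun.rep_eq
      one_so3_fun.rep_eq rotation_matrix_id)

lemma so3_to_Kbar_eq_0: "so3_to_Kbar f = 0 \<longleftrightarrow> f = 0"
  by (simp add: so3_to_Kbar_def Zero_fract_def eq_fract)

text \<open>The data of the platform are polynomial on SO(3). Keeping them in
  \<open>so3_fun\<close>, before fractions are formed, makes both the evaluation at the identity and
  the embedding into the algebraic closure available.\<close>

definition base_so3 :: "real^3^6 \<Rightarrow> so3_fun^3^6" where
  "base_so3 A = (\<chi> i j. so3_const (A$i$j))"

definition limbs_so3 :: "real^3^6 \<Rightarrow> real^3^6 \<Rightarrow> so3_fun^3^6" where
  "limbs_so3 A b = (\<chi> i j. (\<Sum>k\<in>UNIV. so3_entry j k * so3_const (b$i$k)) - so3_const (A$i$j))"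

lemma base_so3_maps:
  "map_vec (map_vec so3_to_Kbar) (base_so3 A) = to_Kbar (base_pts A)"
  "map_vec (map_vec so3_at_id) (base_so3 A) = A"
  by (simp_all add: vec_eq_iff base_so3_def to_Kbar_def base_pts_def so3_to_Kbar_def real_to_K_def
      so3_at_id_def so3_const.rep_eq rotation_matrix_id)

lemma limbs_so3_maps:
  "map_vec (map_vec so3_to_Kbar) (limbs_so3 A b) = to_Kbar (limbs A b)"
  "map_vec (map_vec so3_at_id) (limbs_so3 A b) = b - A"
proof -
  show "map_vec (map_vec so3_to_Kbar) (limbs_so3 A b) = to_Kbar (limbs A b)"
    by (simp add: vec_eq_iff limbs_so3_def ring_map_sum[OF ring_map_so3_to_Kbar]
        ring_mapD[OF ring_map_so3_to_Kbar])
      (simp add: so3_to_Kbar_def to_Kbar_def limbs_def base_pts_def real_to_K_def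
        generic_rotation_def matrix_vector_mult_def to_ac_sum del: mult_fract)
  have "(\<Sum>k\<in>UNIV. (mat 1 :: real^3^3) $ j $ k * b$i$k) = b$i$j" for i j
    using matrix_vector_mul_lid[of "b$i"] by (simp add: vec_eq_iff matrix_vector_mult_def)
  then show "map_vec (map_vec so3_at_id) (limbs_so3 A b) = b - A"
    by (simp add: vec_eq_iff limbs_so3_def ring_map_sum[OF ring_map_so3_at_id]
        ring_mapD[OF ring_map_so3_at_id])
      (simp add: so3_at_id_def so3_const.rep_eq so3_entry.rep_eq rotation_matrix_id)
qed

text \<open>A polynomial on SO(3) that does not vanish at the identity is nonzero in the function field, so
  it is enough to specialise the generic rotation to the identity.\<close>

lemma generic_platform_tensor_det:
  obtains s where
    "zariski_open_architectures {(A, b). (A, b) \<in> architectures \<and> tensor_det s A (b - A) \<noteq> 0}"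
    "{(A, b). (A, b) \<in> architectures \<and> tensor_det s A (b - A) \<noteq> 0} \<noteq> {}"
    "\<And>A b. tensor_det s A (b - A) \<noteq> 0 \<Longrightarrow> tensor_det s (to_Kbar (base_pts A)) (to_Kbar (limbs A b)) \<noteq> 0"
proof -
  obtain s where s: "det (\<chi> t. tensor_row example_base example_limbs (s t)) \<noteq> 0"
    using det_selection[of "tensor_row example_base example_limbs"] example_injective by blast
  let ?U = "{(A, b). (A, b) \<in> architectures \<and> tensor_det s A (b - A) \<noteq> 0}"
  have lin: "real_polynomial_function (\<lambda>x. F x)" if "linear F" for F :: "architecture \<Rightarrow> real"
    using that by (intro real_polynomial_function.intros(1)) (simp add: linear_conv_bounded_linear)
  have "real_polynomial_function (\<lambda>x :: architecture. tensor_det s (fst x) (snd x - fst x))"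
    by (intro real_polynomial_function_tensor_det lin linearI) (simp_all add: algebra_simps)
  then have open_U: "zariski_open_architectures ?U"
    unfolding zariski_open_architectures_def
    by (intro exI[of _ "{\<lambda>x. tensor_det s (fst x) (snd x - fst x)}"]) auto
  have "tensor_det s example_base example_limbs \<noteq> 0"
    using s by (simp add: tensor_det_def example_base_def mixed_3)
  \<comment> \<open>At the identity rotation C = b - A, so the platform points are the base points
    plus the prescribed limbs.\<close>
  then have "(example_base, example_base + example_limbs) \<in> ?U"
    by (simp add: architectures_def example_base_def example_limbs_def)
  then have "?U \<noteq> {}" by blast
  moreover have "tensor_det s (to_Kbar (base_pts A)) (to_Kbar (limbs A b)) \<noteq> 0"
    if "tensor_det s A (b - A) \<noteq> 0" for A b
  proof -
    have "so3_at_id (tensor_det s (base_so3 A) (limbs_so3 A b)) = tensor_det s A (b - A)"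
      by (simp add: ring_map_tensor_det[OF ring_map_so3_at_id] base_so3_maps limbs_so3_maps)
    with that have "tensor_det s (base_so3 A) (limbs_so3 A b) \<noteq> 0"
      using ring_mapD(4)[OF ring_map_so3_at_id] by auto
    then show ?thesis
      using ring_map_tensor_det[OF ring_map_so3_to_Kbar, of s "base_so3 A" "limbs_so3 A b"]
      by (metis base_so3_maps(1) limbs_so3_maps(1) so3_to_Kbar_eq_0)
  qed
  ultimately show thesis using open_U by (intro that)
qed

section \<open>Homogeneous polynomial functions\<close>

text \<open>Closed sets and regular mappings only need some homogeneous polynomial over the ground
  field that represents the function. Working with functions gives closure under products and
  determinants without evaluating products of polynomials.\<close>

definition homogeneous_fun :: "nat \<Rightarrow> ('k::field alg_closure^'n::finite \<Rightarrow> 'k alg_closure) \<Rightarrow> bool" where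
  "homogeneous_fun d f \<longleftrightarrow> (\<exists>p :: ('n, 'k) mpoly. homogeneous d p \<and> (\<forall>v. peval p v = f v))"

lemma peval_superset:
  assumes "finite S" "Poly_Mapping.keys p \<subseteq> S"
  shows "peval p v = (\<Sum>m\<in>S. to_ac (Poly_Mapping.lookup p m) * (\<Prod>i\<in>UNIV. v$i ^ Poly_Mapping.lookup m i))"
  unfolding peval_def
  using assms by (intro sum.mono_neutral_left) (auto simp: in_keys_iff)

lemma peval_add: "peval (p + q) v = peval p v + peval q v"
proof -
  let ?S = "Poly_Mapping.keys p \<union> Poly_Mapping.keys q"
  have "finite ?S" by simp
  then show ?thesis
    using Poly_Mapping.keys_add[of p q]
    by (simp add: peval_superset[of ?S] lookup_add distrib_right sum.distrib)
qed

lemma homogeneous_fun_add: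
  assumes "homogeneous_fun d f" "homogeneous_fun d g"
  shows "homogeneous_fun d (\<lambda>v. f v + g v)"
proof -
  obtain p q where "homogeneous d p" "homogeneous d q" "\<And>v. peval p v = f v" "\<And>v. peval q v = g v"
    using assms unfolding homogeneous_fun_def by blast
  moreover from this have "homogeneous d (p + q)"
    using Poly_Mapping.keys_add[of p q] unfolding homogeneous_def by blast
  ultimately show ?thesis
    unfolding homogeneous_fun_def by (intro exI[of _ "p + q"]) (simp add: peval_add)
qed

lemma homogeneous_fun_monomial:
  assumes "(\<Sum>i\<in>UNIV. Poly_Mapping.lookup m i) = d"
  shows "homogeneous_fun d (\<lambda>v. to_ac c * (\<Prod>i\<in>UNIV. v$i ^ Poly_Mapping.lookup m i))"
  unfolding homogeneous_fun_def
  by (rule exI[of _ "Poly_Mapping.single m c"])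
    (use assms in \<open>auto simp: homogeneous_def peval_def\<close>)

lemma homogeneous_fun_0: "homogeneous_fun d (\<lambda>v. 0)"
  unfolding homogeneous_fun_def by (rule exI[of _ 0]) (simp add: homogeneous_def peval_def)

lemma homogeneous_fun_sum:
  assumes "\<And>i. i \<in> I \<Longrightarrow> homogeneous_fun d (f i)"
  shows "homogeneous_fun d (\<lambda>v. \<Sum>i\<in>I. f i v)"
  using assms
  by (induction I rule: infinite_finite_induct) (simp_all add: homogeneous_fun_0 homogeneous_fun_add)

lemma homogeneous_fun_mult:
  assumes "homogeneous_fun d f" "homogeneous_fun e g"
  shows "homogeneous_fun (d + e) (\<lambda>v. f v * g v)"
proof -
  obtain p q where p: "homogeneous d p" "\<And>v. peval p v = f v" and q: "homogeneous e q" "\<And>v. peval q v = g v"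
    using assms unfolding homogeneous_fun_def by blast
  have "(\<lambda>v. f v * g v) = (\<lambda>v. \<Sum>m\<in>Poly_Mapping.keys p. \<Sum>n\<in>Poly_Mapping.keys q.
      to_ac (Poly_Mapping.lookup p m * Poly_Mapping.lookup q n) * (\<Prod>i\<in>UNIV. v$i ^ Poly_Mapping.lookup (m + n) i))"
    unfolding p(2)[symmetric] q(2)[symmetric] peval_def sum_product
    by (simp add: lookup_add power_add prod.distrib mult_ac)
  moreover have "homogeneous_fun (d + e) \<dots>"
    using p(1) q(1)
    by (intro homogeneous_fun_sum homogeneous_fun_monomial)
      (simp add: lookup_add sum.distrib homogeneous_def)
  ultimately show ?thesis by simp
qed

lemma homogeneous_fun_const: "homogeneous_fun 0 (\<lambda>v. to_ac c)"
  using homogeneous_fun_monomial[of 0 0 c] by simp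

lemma homogeneous_fun_coord:
  fixes i :: "'n::finite"
  shows "homogeneous_fun 1 (\<lambda>v :: 'k::field alg_closure^'n. v$i)"
proof -
  have "(\<Sum>j\<in>UNIV. Poly_Mapping.lookup (Poly_Mapping.single i (1::nat)) j) = 1"
    by (simp add: lookup_single when_def)
  moreover have "(\<Prod>j\<in>UNIV. v$j ^ Poly_Mapping.lookup (Poly_Mapping.single i 1) j) = v$i"
    for v :: "'k alg_closure^'n"
  proof -
    have "(\<Prod>j\<in>UNIV. v$j ^ Poly_Mapping.lookup (Poly_Mapping.single i 1) j) =
        (\<Prod>j\<in>UNIV. if j = i then v$j else 1)"
      by (intro prod.cong) (auto simp: lookup_single when_def)
    then show ?thesis by simp
  qed
  ultimately show ?thesis
    using homogeneous_fun_monomial[of "Poly_Mapping.single i 1" 1 "1 :: 'k"] by simp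
qed

lemma homogeneous_fun_scale: "homogeneous_fun d f \<Longrightarrow> homogeneous_fun d (\<lambda>v. to_ac c * f v)"
  using homogeneous_fun_mult[OF homogeneous_fun_const] by fastforce

lemma homogeneous_fun_scale': "homogeneous_fun d f \<Longrightarrow> homogeneous_fun d (\<lambda>v. f v * to_ac c)"
  using homogeneous_fun_mult[OF _ homogeneous_fun_const] by fastforce

lemma homogeneous_fun_prod:
  assumes "finite I" "\<And>i. i \<in> I \<Longrightarrow> homogeneous_fun (d i) (f i)"
  shows "homogeneous_fun (\<Sum>i\<in>I. d i) (\<lambda>v. \<Prod>i\<in>I. f i v)"
  using assms
proof (induction I rule: finite_induct)
  case empty
  then show ?case using homogeneous_fun_const[of 1] by simp
qed (simp add: homogeneous_fun_mult)

lemma homogeneous_fun_det: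
  fixes M :: "'k::field alg_closure^'m::finite \<Rightarrow> 'k alg_closure^'n::finite^'n"
  assumes "\<And>i j. homogeneous_fun (d i) (\<lambda>v. M v $ i $ j)"
  shows "homogeneous_fun (\<Sum>i\<in>UNIV. d i) (\<lambda>v. det (M v))"
  unfolding det_def
proof (intro homogeneous_fun_sum)
  fix p :: "'n \<Rightarrow> 'n"
  have "homogeneous_fun (\<Sum>i\<in>UNIV. d i) (\<lambda>v. to_ac (of_int (sign p)) * (\<Prod>i\<in>UNIV. M v $ i $ p i))"
    by (intro homogeneous_fun_scale homogeneous_fun_prod assms) simp
  then show "homogeneous_fun (\<Sum>i\<in>UNIV. d i) (\<lambda>v. of_int (sign p) * (\<Prod>i\<in>UNIV. M v $ i $ p i))"
    by simp
qed

lemma homogeneous_fun_det6: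
  fixes r1 r2 r3 r4 r5 r6 :: "'k::field alg_closure^'m::finite \<Rightarrow> 'k alg_closure^6"
  assumes "\<And>j. homogeneous_fun d1 (\<lambda>v. r1 v $ j)" "\<And>j. homogeneous_fun d2 (\<lambda>v. r2 v $ j)"
    "\<And>j. homogeneous_fun d3 (\<lambda>v. r3 v $ j)" "\<And>j. homogeneous_fun d4 (\<lambda>v. r4 v $ j)"
    "\<And>j. homogeneous_fun d5 (\<lambda>v. r5 v $ j)" "\<And>j. homogeneous_fun d6 (\<lambda>v. r6 v $ j)"
  shows "homogeneous_fun (d1 + d2 + d3 + d4 + d5 + d6) (\<lambda>v. det6 (r1 v) (r2 v) (r3 v) (r4 v) (r5 v) (r6 v))"
proof -
  define d :: "6 \<Rightarrow> nat" where "d i = (if i = 1 then d1 else if i = 2 then d2 else if i = 3 then d3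
    else if i = 4 then d4 else if i = 5 then d5 else d6)" for i
  have "(\<Sum>i\<in>UNIV. d i) = d1 + d2 + d3 + d4 + d5 + d6"
    by (simp add: sum_6 d_def)
  moreover have "homogeneous_fun (\<Sum>i\<in>UNIV. d i)
      (\<lambda>v. det6 (r1 v) (r2 v) (r3 v) (r4 v) (r5 v) (r6 v))"
    unfolding det6_def
  proof (rule homogeneous_fun_det)
    fix i j
    show "homogeneous_fun (d i) (\<lambda>v. (\<chi> i. if i = 1 then r1 v else if i = 2 then r2 v else
     if i = 3 then r3 v else if i = 4 then r4 v else if i = 5 then r5 v else r6 v) $ i $ j)"
      using exhaust_6[of i] assms by (elim disjE) (simp_all add: d_def)
  qed
  ultimately show ?thesis by simp
qed

section \<open>Homogeneity of the equations\<close>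

text \<open>Points have coordinates in the algebraic closure, but the forms defining closed sets and
  regular mappings must have coefficients in the ground field.\<close>

definition rational_family :: "'k::field alg_closure^3^6 \<Rightarrow> bool" where
  "rational_family A \<longleftrightarrow> (\<exists>A0. A = map_vec (map_vec to_ac) A0)"

context
  fixes A C :: "'k::field alg_closure^3^6"
  assumes A: "rational_family A" and C: "rational_family C"
begin

lemma homogeneous_fun_dep_row: "homogeneous_fun 0 (\<lambda>v. dep_row A C i $ j)"
proof -
  obtain A0 C0 where A0: "A = map_vec (map_vec to_ac) A0" and C0: "C = map_vec (map_vec to_ac) C0"
    using A C by (auto simp: rational_family_def)
  have h: "ring_map (to_ac :: 'k \<Rightarrow> _)" by (simp add: ring_map_def)
  have "dep_row A C i $ j = to_ac (dep_row A0 C0 i $ j)"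
    using map_vec_dep_row[OF h, of A0 C0 i] unfolding A0 C0 vec_eq_iff by simp
  then show ?thesis by (simp add: homogeneous_fun_const)
qed

lemma homogeneous_fun_lin_row: "homogeneous_fun 1 (\<lambda>v. lin_row A C k v $ j)"
proof -
  obtain A0 C0 where A0: "A = map_vec (map_vec to_ac) A0" and C0: "C = map_vec (map_vec to_ac) C0"
    using A C by (auto simp: rational_family_def)
  have h: "ring_map (to_ac :: 'k \<Rightarrow> _)" by (simp add: ring_map_def)
  have "lin_row A C k (axis a 1) $ j = to_ac (lin_row A0 C0 k (axis a 1) $ j)" for a
    using map_vec_lin_row[OF h, of A0 C0 k "axis a 1"]
    unfolding A0 C0 vec_eq_iff map_vec_simps[OF h] by simp
  then have "(\<lambda>v. lin_row A C k v $ j) = (\<lambda>v. \<Sum>a\<in>UNIV. v$a * to_ac (lin_row A0 C0 k (axis a 1) $ j))"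
    by (subst lin_row_expand) (simp add: fun_eq_iff)
  moreover have "homogeneous_fun 1 \<dots>"
    by (intro homogeneous_fun_sum homogeneous_fun_scale' homogeneous_fun_coord)
  ultimately show ?thesis by simp
qed

lemma homogeneous_fun_minor_vec: "homogeneous_fun 3 (\<lambda>v. minor_vec A C k l m v v v $ c)"
proof -
  have "homogeneous_fun 0 (\<lambda>v :: 'k alg_closure^4. axis c 1 $ j :: 'k alg_closure)" for j
    using homogeneous_fun_const[of 0] homogeneous_fun_const[of 1]
    by (cases "j = c") (simp_all add: axis_def)
  then have "homogeneous_fun (0 + 0 + 0 + 1 + 1 + 1) (\<lambda>v. minor_vec A C k l m v v v $ c)"
    unfolding minor_vec_def wedge5_def vec_lambda_beta
    by (intro homogeneous_fun_det6 homogeneous_fun_dep_row homogeneous_fun_lin_row)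
  then show ?thesis by (simp add: numeral_3_eq_3)
qed

text \<open>These quartic forms carry the existence of a nonzero kernel from the affine surface to
  its Zariski closure.\<close>

lemma homogeneous_fun_maximal_minor:
  "homogeneous_fun 4 (\<lambda>v. det6 (lin_row A C n v) (dep_row A C 5) (dep_row A C 6)
     (lin_row A C k v) (lin_row A C l v) (lin_row A C m v))"
proof -
  have "homogeneous_fun (1 + 0 + 0 + 1 + 1 + 1) (\<lambda>v. det6 (lin_row A C n v) (dep_row A C 5) (dep_row A C 6)
     (lin_row A C k v) (lin_row A C l v) (lin_row A C m v))"
    by (intro homogeneous_fun_det6 homogeneous_fun_dep_row homogeneous_fun_lin_row)
  then show ?thesis by (simp add: numeral_eq_Suc)
qed

end

section \<open>The formulas at infinity\<close>

text \<open>The sums in \<open>V_inf\<close> and \<open>Omega_inf\<close> do not involve the image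
  of 6 under the permutation, hence five arguments.\<close>

definition perm_sum :: "6 set \<Rightarrow> (6 \<Rightarrow> 6 \<Rightarrow> 6 \<Rightarrow> 6 \<Rightarrow> 6 \<Rightarrow> 'a::comm_ring_1) \<Rightarrow> 'a" where
  "perm_sum S g = (\<Sum>p | p permutes S. of_int (sign p) * g (p 1) (p 2) (p 3) (p 4) (p 5))"

lemma perm_sum_insert:
  assumes "k \<notin> S"
  shows "perm_sum (insert k S) g = (\<Sum>b\<in>insert k S. (if b = k then 1 else - 1) *
     perm_sum S (\<lambda>i j l m n. g (Transposition.transpose k b i) (Transposition.transpose k b j)
       (Transposition.transpose k b l) (Transposition.transpose k b m) (Transposition.transpose k b n)))"
proof -
  have fin: "finite S" by simp
  have "perm_sum (insert k S) g = (\<Sum>b\<in>insert k S. \<Sum>q | q permutes S.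
     of_int (sign (Transposition.transpose k b \<circ> q)) * g ((Transposition.transpose k b \<circ> q) 1)
       ((Transposition.transpose k b \<circ> q) 2) ((Transposition.transpose k b \<circ> q) 3)
       ((Transposition.transpose k b \<circ> q) 4) ((Transposition.transpose k b \<circ> q) 5))"
    unfolding perm_sum_def by (rule sum_over_permutations_insert[OF fin assms])
  also have "\<dots> = (\<Sum>b\<in>insert k S. (if b = k then 1 else - 1) *
     perm_sum S (\<lambda>i j l m n. g (Transposition.transpose k b i) (Transposition.transpose k b j)
       (Transposition.transpose k b l) (Transposition.transpose k b m) (Transposition.transpose k b n)))"
    unfolding perm_sum_def sum_distrib_left
  proof (intro sum.cong refl)
    fix b q assume "q \<in> {q. q permutes S}"
    then have "q permutes S" by simp
    then have "sign (Transposition.transpose k b \<circ> q) = sign (Transposition.transpose k b) * sign q"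
      using fin permutation_permutes by (intro sign_compose permutation_swap_id) blast
    then show "of_int (sign (Transposition.transpose k b \<circ> q)) * g ((Transposition.transpose k b \<circ> q) 1)
       ((Transposition.transpose k b \<circ> q) 2) ((Transposition.transpose k b \<circ> q) 3)
       ((Transposition.transpose k b \<circ> q) 4) ((Transposition.transpose k b \<circ> q) 5) =
      (if b = k then 1 else - 1) * (of_int (sign q) *
       g (Transposition.transpose k b (q 1)) (Transposition.transpose k b (q 2))
       (Transposition.transpose k b (q 3)) (Transposition.transpose k b (q 4))
       (Transposition.transpose k b (q 5)))"
      by (auto simp: sign_swap_id)
  qed
  finally show ?thesis .
qed

lemma perm_sum_sing: "perm_sum {k} g = g 1 2 3 4 5"
proof -
  have "{p. p permutes {k}} = {id}" by (auto simp: permutes_sing)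
  then show ?thesis by (simp add: perm_sum_def)
qed

lemma perm_sum_345: "perm_sum {3, 4, 5} g =
  g 1 2 3 4 5 - g 1 2 3 5 4 - g 1 2 4 3 5 + g 1 2 4 5 3 - g 1 2 5 4 3 + g 1 2 5 3 4"
  by (simp add: perm_sum_insert perm_sum_sing Transposition.transpose_def)

text \<open>Since the first limb data vanish, only permutations sending 6 to 1 contribute. Each is a
  permutation of 1 to 5 followed by the exchange of 6 and 1, which gives the minus sign.\<close>

lemma perm_sum_UNIV:
  assumes "\<And>i j l m n. 1 \<in> {i, j, l, m, n} \<Longrightarrow> g i j l m n = 0"
  shows "perm_sum UNIV g = - perm_sum {1, 2, 3, 4, 5} (\<lambda>i j l m n. g (Transposition.transpose 6 1 i)
     (Transposition.transpose 6 1 j) (Transposition.transpose 6 1 l) (Transposition.transpose 6 1 m)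
     (Transposition.transpose 6 1 n))"
proof -
  have U: "(UNIV :: 6 set) = insert 6 {1, 2, 3, 4, 5}" unfolding UNIV_6 by auto
  have z: "perm_sum {1, 2, 3, 4, 5} (\<lambda>i j l m n. g (Transposition.transpose 6 b i)
     (Transposition.transpose 6 b j) (Transposition.transpose 6 b l) (Transposition.transpose 6 b m)
     (Transposition.transpose 6 b n)) = 0" if b: "b \<noteq> 1" for b
    unfolding perm_sum_def
  proof (rule sum.neutral, safe)
    fix p :: "6 \<Rightarrow> 6" assume p: "p permutes {1, 2, 3, 4, 5}"
    have "1 \<in> p ` {1, 2, 3, 4, 5}" using permutes_image[OF p] by simp
    then have "1 \<in> {p 1, p 2, p 3, p 4, p 5}" by auto
    moreover have "Transposition.transpose 6 b 1 = 1" using b by (simp add: Transposition.transpose_def)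
    ultimately have "1 \<in> {Transposition.transpose 6 b (p 1), Transposition.transpose 6 b (p 2),
        Transposition.transpose 6 b (p 3), Transposition.transpose 6 b (p 4), Transposition.transpose 6 b (p 5)}"
      by (metis insert_iff singletonD)
    then show "of_int (sign p) * g (Transposition.transpose 6 b (p 1)) (Transposition.transpose 6 b (p 2))
        (Transposition.transpose 6 b (p 3)) (Transposition.transpose 6 b (p 4)) (Transposition.transpose 6 b (p 5)) = 0"
      using assms by simp
  qed
  show ?thesis
    unfolding U using z[of 6] by (subst perm_sum_insert) (simp_all add: z)
qed

text \<open>Exchanging the two arguments of \<open>a\<close>, or those of \<open>c\<close>, reverses
  both the sign of the permutation and that of the summand. The 120 surviving terms therefore fall
  into groups of 4 equal ones, leaving 30 products; this accounts for the factor 1/4 in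
  \<open>V_inf\<close>.\<close>

lemma perm_sum_quadratic:
  fixes a c :: "6 \<Rightarrow> 6 \<Rightarrow> 'a::comm_ring_1" and f :: "6 \<Rightarrow> 'a"
  assumes a: "\<And>i j. a i j = - a j i" and c: "\<And>i j. c i j = - c j i"
    and zero: "\<And>j. a 1 j = 0" "f 1 = 0" "\<And>j. c 1 j = 0"
  shows "perm_sum UNIV (\<lambda>i j l m n. a i j * f l * c m n) = 4 * (
    - a 2 3 * f 4 * c 5 6 + a 2 3 * f 5 * c 4 6 - a 2 3 * f 6 * c 4 5 + a 2 4 * f 3 * c 5 6
     - a 2 4 * f 5 * c 3 6 + a 2 4 * f 6 * c 3 5 - a 2 5 * f 3 * c 4 6 + a 2 5 * f 4 * c 3 6
     - a 2 5 * f 6 * c 3 4 + a 2 6 * f 3 * c 4 5 - a 2 6 * f 4 * c 3 5 + a 2 6 * f 5 * c 3 4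
     - a 3 4 * f 2 * c 5 6 + a 3 4 * f 5 * c 2 6 - a 3 4 * f 6 * c 2 5 + a 3 5 * f 2 * c 4 6
     - a 3 5 * f 4 * c 2 6 + a 3 5 * f 6 * c 2 4 - a 3 6 * f 2 * c 4 5 + a 3 6 * f 4 * c 2 5
     - a 3 6 * f 5 * c 2 4 - a 4 5 * f 2 * c 3 6 + a 4 5 * f 3 * c 2 6 - a 4 5 * f 6 * c 2 3
     + a 4 6 * f 2 * c 3 5 - a 4 6 * f 3 * c 2 5 + a 4 6 * f 5 * c 2 3 - a 5 6 * f 2 * c 3 4
     + a 5 6 * f 3 * c 2 4 - a 5 6 * f 4 * c 2 3)" (is "_ = ?rhs")
proof -
  define g where "g i j l m n = a i j * f l * c m n" for i j l m n
  have z: "g i j l m n = 0" if "1 \<in> {i, j, l, m, n}" for i j l m n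
    using that zero a[of i 1] c[of m 1] by (auto simp: g_def)
  note as = a[of 3 2] a[of 4 2] a[of 5 2] a[of 6 2] a[of 4 3] a[of 5 3] a[of 6 3] a[of 5 4] a[of 6 4] a[of 6 5]
  note cs = c[of 3 2] c[of 4 2] c[of 5 2] c[of 6 2] c[of 4 3] c[of 5 3] c[of 6 3] c[of 5 4] c[of 6 4] c[of 6 5]
  have "perm_sum UNIV g = ?rhs"
    by (subst perm_sum_UNIV, erule z,
        simp add: perm_sum_insert[of 1 "{2, 3, 4, 5}"] Transposition.transpose_def,
        simp add: perm_sum_insert[of 2 "{3, 4, 5}"] perm_sum_345 Transposition.transpose_def,
        simp add: g_def as cs)
  then show ?thesis unfolding g_def .
qed

text \<open>The groups now have 3! 2! = 12 equal terms, which leaves 10 products and accounts for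
  the factor 1/12 in \<open>Omega_inf\<close>.\<close>

lemma perm_sum_alternating:
  fixes a :: "6 \<Rightarrow> 6 \<Rightarrow> 'a::comm_ring_1" and e :: "6 \<Rightarrow> 6 \<Rightarrow> 6 \<Rightarrow> 'a"
  assumes a: "\<And>i j. a i j = - a j i" and e: "\<And>i j k. e i j k = - e j i k" "\<And>i j k. e i j k = - e i k j"
    and zero: "\<And>j. a 1 j = 0" "\<And>j k. e 1 j k = 0"
  shows "perm_sum UNIV (\<lambda>i j l m n. e i j l * a m n) = 12 * (
    - e 2 3 4 * a 5 6 + e 2 3 5 * a 4 6 - e 2 3 6 * a 4 5 - e 2 4 5 * a 3 6
     + e 2 4 6 * a 3 5 - e 2 5 6 * a 3 4 + e 3 4 5 * a 2 6 - e 3 4 6 * a 2 5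
     + e 3 5 6 * a 2 4 - e 4 5 6 * a 2 3)" (is "_ = ?rhs")
proof -
  define g where "g i j l m n = e i j l * a m n" for i j l m n
  have z: "g i j l m n = 0" if "1 \<in> {i, j, l, m, n}" for i j l m n
    using that zero a[of m 1] e(1)[of i 1 l] e(2)[of i j 1] e(1)[of i 1 j] by (auto simp: g_def)
  note as = a[of 3 2] a[of 4 2] a[of 5 2] a[of 6 2] a[of 4 3] a[of 5 3] a[of 6 3] a[of 5 4] a[of 6 4] a[of 6 5]
  note es = e(1)[of 3 2] e(1)[of 4 2] e(1)[of 5 2] e(1)[of 6 2] e(1)[of 4 3] e(1)[of 5 3] e(1)[of 6 3]
    e(1)[of 5 4] e(1)[of 6 4] e(1)[of 6 5]
    e(2)[of _ 3 2] e(2)[of _ 4 2] e(2)[of _ 5 2] e(2)[of _ 6 2] e(2)[of _ 4 3] e(2)[of _ 5 3] e(2)[of _ 6 3]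
    e(2)[of _ 5 4] e(2)[of _ 6 4] e(2)[of _ 6 5]
  have "perm_sum UNIV g = ?rhs"
    by (subst perm_sum_UNIV, erule z,
        simp add: perm_sum_insert[of 1 "{2, 3, 4, 5}"] Transposition.transpose_def,
        simp add: perm_sum_insert[of 2 "{3, 4, 5}"] perm_sum_345 Transposition.transpose_def,
        simp add: g_def as es)
  then show ?thesis unfolding g_def .
qed

text \<open>In the next two lemmas \<open>aij\<close> stands for $[A_i, A_j, P]$, \<open>fi\<close> for $[A_i, C_i, P]$, \<open>cij\<close> for a
  coordinate of $C_i \times C_j$ and \<open>eijk\<close> for $[C_i, C_j, C_k]$. The assumptions express the
  data of limbs 5 and 6 as combinations of those of limbs 2, 3, 4 plus remainders; only the terms
  that contain a remainder of each of the limbs 5 and 6 survive.\<close>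

lemma quadratic_sum_reduction:
  fixes a23 a24 a34 c23 c24 c34 :: "'a::comm_ring_1"
  assumes a: "a25 = \<alpha>3 * a23 + \<alpha>4 * a24" "a35 = \<alpha>4 * a34 - \<alpha>2 * a23" "a45 = - \<alpha>2 * a24 - \<alpha>3 * a34"
      "a26 = \<beta>3 * a23 + \<beta>4 * a24" "a36 = \<beta>4 * a34 - \<beta>2 * a23" "a46 = - \<beta>2 * a24 - \<beta>3 * a34"
      "a56 = (\<alpha>2 * \<beta>3 - \<alpha>3 * \<beta>2) * a23 + (\<alpha>2 * \<beta>4 - \<alpha>4 * \<beta>2) * a24 + (\<alpha>3 * \<beta>4 - \<alpha>4 * \<beta>3) * a34"
    and c: "c25 = \<alpha>3 * c23 + \<alpha>4 * c24 - d2" "c35 = \<alpha>4 * c34 - \<alpha>2 * c23 - d3" "c45 = - \<alpha>2 * c24 - \<alpha>3 * c34 - d4"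
      "c26 = \<beta>3 * c23 + \<beta>4 * c24 - e2" "c36 = \<beta>4 * c34 - \<beta>2 * c23 - e3" "c46 = - \<beta>2 * c24 - \<beta>3 * c34 - e4"
      "c56 = (\<alpha>2 * \<beta>3 - \<alpha>3 * \<beta>2) * c23 + (\<alpha>2 * \<beta>4 - \<alpha>4 * \<beta>2) * c24 + (\<alpha>3 * \<beta>4 - \<alpha>4 * \<beta>3) * c34
        + \<beta>2 * d2 + \<beta>3 * d3 + \<beta>4 * d4 - \<alpha>2 * e2 - \<alpha>3 * e3 - \<alpha>4 * e4 + h"
    and f: "f5 = g5 + \<alpha>2 * f2 + \<alpha>3 * f3 + \<alpha>4 * f4" "f6 = g6 + \<beta>2 * f2 + \<beta>3 * f3 + \<beta>4 * f4"
  shows "- a23 * f4 * c56 + a23 * f5 * c46 - a23 * f6 * c45 + a24 * f3 * c56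
     - a24 * f5 * c36 + a24 * f6 * c35 - a25 * f3 * c46 + a25 * f4 * c36
     - a25 * f6 * c34 + a26 * f3 * c45 - a26 * f4 * c35 + a26 * f5 * c34
     - a34 * f2 * c56 + a34 * f5 * c26 - a34 * f6 * c25 + a35 * f2 * c46
     - a35 * f4 * c26 + a35 * f6 * c24 - a36 * f2 * c45 + a36 * f4 * c25
     - a36 * f5 * c24 - a45 * f2 * c36 + a45 * f3 * c26 - a45 * f6 * c23
     + a46 * f2 * c35 - a46 * f3 * c25 + a46 * f5 * c23 - a56 * f2 * c34
     + a56 * f3 * c24 - a56 * f4 * c23 =
    - (g5 * (a34 * e2 - a24 * e3 + a23 * e4) - g6 * (a34 * d2 - a24 * d3 + a23 * d4)
      + (a34 * f2 - a24 * f3 + a23 * f4) * h)"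
  unfolding a c f by (simp add: algebra_simps)

lemma alternating_sum_reduction:
  fixes a23 a24 a34 e234 :: "'a::comm_ring_1"
  assumes a: "a25 = \<alpha>3 * a23 + \<alpha>4 * a24" "a35 = \<alpha>4 * a34 - \<alpha>2 * a23" "a45 = - \<alpha>2 * a24 - \<alpha>3 * a34"
      "a26 = \<beta>3 * a23 + \<beta>4 * a24" "a36 = \<beta>4 * a34 - \<beta>2 * a23" "a46 = - \<beta>2 * a24 - \<beta>3 * a34"
      "a56 = (\<alpha>2 * \<beta>3 - \<alpha>3 * \<beta>2) * a23 + (\<alpha>2 * \<beta>4 - \<alpha>4 * \<beta>2) * a24 + (\<alpha>3 * \<beta>4 - \<alpha>4 * \<beta>3) * a34"
    and e: "e235 = p23 + \<alpha>4 * e234" "e245 = p24 - \<alpha>3 * e234" "e345 = p34 + \<alpha>2 * e234"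
      "e236 = q23 + \<beta>4 * e234" "e246 = q24 - \<beta>3 * e234" "e346 = q34 + \<beta>2 * e234"
      "e256 = r2 - \<beta>3 * p23 - \<beta>4 * p24 + \<alpha>3 * q23 + \<alpha>4 * q24 + (\<alpha>3 * \<beta>4 - \<alpha>4 * \<beta>3) * e234"
      "e356 = r3 + \<beta>2 * p23 - \<beta>4 * p34 - \<alpha>2 * q23 + \<alpha>4 * q34 + (\<alpha>4 * \<beta>2 - \<alpha>2 * \<beta>4) * e234"
      "e456 = r4 + \<beta>2 * p24 + \<beta>3 * p34 - \<alpha>2 * q24 - \<alpha>3 * q34 + (\<alpha>2 * \<beta>3 - \<alpha>3 * \<beta>2) * e234"
  shows "- e234 * a56 + e235 * a46 - e236 * a45 - e245 * a36
     + e246 * a35 - e256 * a34 + e345 * a26 - e346 * a25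
     + e356 * a24 - e456 * a23 =
    - (a34 * r2 - a24 * r3 + a23 * r4)"
  unfolding a e by (simp add: algebra_simps)

context
  fixes A C :: "'a::field^3^6" and \<alpha> \<beta> :: "6 \<Rightarrow> 'a" and P :: "'a^3"
    and D5 D6 CP :: "'a^3" and g5 g6 g0 :: 'a
  assumes zero: "A$1 = 0" "C$1 = 0"
    and A5: "A$5 = (\<Sum>i\<in>{2,3,4}. \<alpha> i *s A$i)" and A6: "A$6 = (\<Sum>i\<in>{2,3,4}. \<beta> i *s A$i)"
    and twelve: "(12::'a) \<noteq> 0"
  defines "D5 \<equiv> C$5 - (\<Sum>i\<in>{2,3,4}. \<alpha> i *s C$i)" and "D6 \<equiv> C$6 - (\<Sum>i\<in>{2,3,4}. \<beta> i *s C$i)"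
    and "CP \<equiv> mixed P (A$3) (A$4) *s C$2 + mixed P (A$4) (A$2) *s C$3 + mixed P (A$2) (A$3) *s C$4"
    and "g5 \<equiv> mixed P (A$5) (C$5) - (\<Sum>i\<in>{2,3,4}. \<alpha> i * mixed P (A$i) (C$i))"
    and "g6 \<equiv> mixed P (A$6) (C$6) - (\<Sum>i\<in>{2,3,4}. \<beta> i * mixed P (A$i) (C$i))"
    and "g0 \<equiv> mixed P (A$3) (A$4) * mixed P (A$2) (C$2) + mixed P (A$4) (A$2) * mixed P (A$3) (C$3)
      + mixed P (A$2) (A$3) * mixed P (A$4) (C$4)"
begin

lemma mixed_base_reduction:
  defines "a i j \<equiv> mixed (A$i) (A$j) P"
  shows "a 2 5 = \<alpha> 3 * a 2 3 + \<alpha> 4 * a 2 4" "a 3 5 = \<alpha> 4 * a 3 4 - \<alpha> 2 * a 2 3"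
    "a 4 5 = - \<alpha> 2 * a 2 4 - \<alpha> 3 * a 3 4"
    "a 2 6 = \<beta> 3 * a 2 3 + \<beta> 4 * a 2 4" "a 3 6 = \<beta> 4 * a 3 4 - \<beta> 2 * a 2 3"
    "a 4 6 = - \<beta> 2 * a 2 4 - \<beta> 3 * a 3 4"
    "a 5 6 = (\<alpha> 2 * \<beta> 3 - \<alpha> 3 * \<beta> 2) * a 2 3 + (\<alpha> 2 * \<beta> 4 - \<alpha> 4 * \<beta> 2) * a 2 4
       + (\<alpha> 3 * \<beta> 4 - \<alpha> 4 * \<beta> 3) * a 3 4"
  unfolding a_def A5 A6 by (simp_all add: mixed_3 algebra_simps)

lemma limbs_reduction:
  "C$5 = D5 + \<alpha> 2 *s C$2 + \<alpha> 3 *s C$3 + \<alpha> 4 *s C$4" "C$6 = D6 + \<beta> 2 *s C$2 + \<beta> 3 *s C$3 + \<beta> 4 *s C$4"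
  by (simp_all add: D5_def D6_def)

text \<open>In four-space, the right-hand side is the vector part of the generalised cross product
  of (g5, D5), (g6, D6) and (g0, CP). Its first component is the scalar in front of P in
  \<open>Omega_inf_eq\<close>.\<close>

lemma V_inf_eq: "V_inf A C P = g5 *s cross D6 CP + g6 *s cross CP D5 + g0 *s cross D5 D6"
proof -
  have "(4::'a) \<noteq> 0"
  proof
    assume "(4::'a) = 0"
    then have "(4::'a) * 3 = 0" by (simp only: mult_zero_left)
    then show False using twelve by simp
  qed
  then have four: "(- 1 / 4) * (4 * x) = - x" for x :: 'a by simp
  have "V_inf A C P $ k = g5 * cross D6 CP $ k + g6 * cross CP D5 $ k + g0 * cross D5 D6 $ k" for k
  proof -
    define a where "a i j = mixed (A$i) (A$j) P" for i j
    define f where "f i = mixed (A$i) (C$i) P" for i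
    define c where "c i j = cross (C$i) (C$j) $ k" for i j
    have anti: "a i j = - a j i" for i j unfolding a_def by (simp add: mixed_3 algebra_simps)
    have cross_anti: "cross u v = - cross v u" for u v :: "'a^3"
      by (simp add: vec_eq_iff forall_3)
    then have canti: "c i j = - c j i" for i j unfolding c_def by (metis vector_uminus_component)
    have z: "a 1 j = 0" "f 1 = 0" "c 1 j = 0" for j
      using exhaust_3[of k] by (auto simp: a_def f_def c_def zero mixed_3)
    have cs: "c 2 5 = \<alpha> 3 * c 2 3 + \<alpha> 4 * c 2 4 - cross D5 (C$2) $ k"
      "c 3 5 = \<alpha> 4 * c 3 4 - \<alpha> 2 * c 2 3 - cross D5 (C$3) $ k"
      "c 4 5 = - \<alpha> 2 * c 2 4 - \<alpha> 3 * c 3 4 - cross D5 (C$4) $ k"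
      "c 2 6 = \<beta> 3 * c 2 3 + \<beta> 4 * c 2 4 - cross D6 (C$2) $ k"
      "c 3 6 = \<beta> 4 * c 3 4 - \<beta> 2 * c 2 3 - cross D6 (C$3) $ k"
      "c 4 6 = - \<beta> 2 * c 2 4 - \<beta> 3 * c 3 4 - cross D6 (C$4) $ k"
      "c 5 6 = (\<alpha> 2 * \<beta> 3 - \<alpha> 3 * \<beta> 2) * c 2 3 + (\<alpha> 2 * \<beta> 4 - \<alpha> 4 * \<beta> 2) * c 2 4
         + (\<alpha> 3 * \<beta> 4 - \<alpha> 4 * \<beta> 3) * c 3 4
         + \<beta> 2 * cross D5 (C$2) $ k + \<beta> 3 * cross D5 (C$3) $ k + \<beta> 4 * cross D5 (C$4) $ k
         - \<alpha> 2 * cross D6 (C$2) $ k - \<alpha> 3 * cross D6 (C$3) $ k - \<alpha> 4 * cross D6 (C$4) $ k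
         + cross D5 D6 $ k"
      unfolding c_def limbs_reduction using exhaust_3[of k]
      by (elim disjE; simp add: algebra_simps)+
    have cyc: "mixed P (A$i) (C$i) = f i" "mixed P (A$i) (A$j) = a i j" for i j
      unfolding f_def a_def by (simp_all add: mixed_3 algebra_simps)
    have fs: "f 5 = g5 + \<alpha> 2 * f 2 + \<alpha> 3 * f 3 + \<alpha> 4 * f 4" "f 6 = g6 + \<beta> 2 * f 2 + \<beta> 3 * f 3 + \<beta> 4 * f 4"
      unfolding g5_def g6_def cyc by simp_all
    have "V_inf A C P $ k = (- 1 / 4) * perm_sum UNIV (\<lambda>i j l m n. a i j * f l * c m n)"
      unfolding V_inf_def perm_sum_def a_def f_def c_def
      by (simp add: sum_component mult.assoc)
    also have "\<dots> = g5 * (a 3 4 * cross D6 (C$2) $ k - a 2 4 * cross D6 (C$3) $ k + a 2 3 * cross D6 (C$4) $ k)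
      - g6 * (a 3 4 * cross D5 (C$2) $ k - a 2 4 * cross D5 (C$3) $ k + a 2 3 * cross D5 (C$4) $ k)
      + (a 3 4 * f 2 - a 2 4 * f 3 + a 2 3 * f 4) * cross D5 D6 $ k"
      unfolding perm_sum_quadratic[of a c f, OF anti canti z]
        quadratic_sum_reduction[OF mixed_base_reduction[folded a_def] cs fs]
      unfolding four by simp
    also have "\<dots> = g5 * cross D6 CP $ k + g6 * cross CP D5 $ k + g0 * cross D5 D6 $ k"
      unfolding CP_def g0_def cyc anti[of 4 2] using exhaust_3[of k]
      by (elim disjE) (simp_all add: algebra_simps)
    finally show ?thesis .
  qed
  then show ?thesis by (simp add: vec_eq_iff)
qed

lemma Omega_inf_eq: "Omega_inf A C P = (- mixed D5 D6 CP) *s P"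
proof -
  define a where "a i j = mixed (A$i) (A$j) P" for i j
  define e where "e i j k = mixed (C$i) (C$j) (C$k)" for i j k
  have anti: "a i j = - a j i" for i j unfolding a_def by (simp add: mixed_3 algebra_simps)
  have eanti: "e i j k = - e j i k" "e i j k = - e i k j" for i j k
    unfolding e_def by (simp_all add: mixed_3 algebra_simps)
  have z: "a 1 j = 0" "e 1 j k = 0" for j k
    by (auto simp: a_def e_def zero mixed_3)
  have es: "e 2 3 5 = mixed (C$2) (C$3) D5 + \<alpha> 4 * e 2 3 4" "e 2 4 5 = mixed (C$2) (C$4) D5 - \<alpha> 3 * e 2 3 4"
    "e 3 4 5 = mixed (C$3) (C$4) D5 + \<alpha> 2 * e 2 3 4"
    "e 2 3 6 = mixed (C$2) (C$3) D6 + \<beta> 4 * e 2 3 4" "e 2 4 6 = mixed (C$2) (C$4) D6 - \<beta> 3 * e 2 3 4"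
    "e 3 4 6 = mixed (C$3) (C$4) D6 + \<beta> 2 * e 2 3 4"
    "e 2 5 6 = mixed D5 D6 (C$2) - \<beta> 3 * mixed (C$2) (C$3) D5 - \<beta> 4 * mixed (C$2) (C$4) D5
       + \<alpha> 3 * mixed (C$2) (C$3) D6 + \<alpha> 4 * mixed (C$2) (C$4) D6 + (\<alpha> 3 * \<beta> 4 - \<alpha> 4 * \<beta> 3) * e 2 3 4"
    "e 3 5 6 = mixed D5 D6 (C$3) + \<beta> 2 * mixed (C$2) (C$3) D5 - \<beta> 4 * mixed (C$3) (C$4) D5
       - \<alpha> 2 * mixed (C$2) (C$3) D6 + \<alpha> 4 * mixed (C$3) (C$4) D6 + (\<alpha> 4 * \<beta> 2 - \<alpha> 2 * \<beta> 4) * e 2 3 4"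
    "e 4 5 6 = mixed D5 D6 (C$4) + \<beta> 2 * mixed (C$2) (C$4) D5 + \<beta> 3 * mixed (C$3) (C$4) D5
       - \<alpha> 2 * mixed (C$2) (C$4) D6 - \<alpha> 3 * mixed (C$3) (C$4) D6 + (\<alpha> 2 * \<beta> 3 - \<alpha> 3 * \<beta> 2) * e 2 3 4"
    unfolding e_def limbs_reduction by (simp_all add: mixed_3 algebra_simps)
  have cyc: "mixed P (A$i) (A$j) = a i j" for i j
    unfolding a_def by (simp add: mixed_3 algebra_simps)
  have 12: "(1 / 12) * (12 * x) = x" for x :: 'a using twelve by simp
  have "Omega_inf A C P = ((1 / 12) * perm_sum UNIV (\<lambda>i j l m n. e i j l * a m n)) *s P"
    unfolding Omega_inf_def perm_sum_def a_def e_def by (simp add: mult.assoc)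
  also have "\<dots> = (- (a 3 4 * mixed D5 D6 (C$2) - a 2 4 * mixed D5 D6 (C$3) + a 2 3 * mixed D5 D6 (C$4))) *s P"
    unfolding perm_sum_alternating[of a e, OF anti eanti z]
      alternating_sum_reduction[OF mixed_base_reduction[folded a_def] es] 12 ..
  also have "\<dots> = (- mixed D5 D6 CP) *s P"
    unfolding CP_def cyc anti[of 4 2] by (rule arg_cong[of _ _ "\<lambda>x. x *s P"]) (simp add: mixed_3 algebra_simps)
  finally show ?thesis .
qed

end

section \<open>Reciprocal twists on the projective surface\<close>

definition rec_kernel :: "'a::comm_ring_1^3^6 \<Rightarrow> 'a^3^6 \<Rightarrow> 'a^4 \<Rightarrow> ('a^6) set" where
  "rec_kernel A C v = {T. dotn (dep_row A C 5) T = 0 \<and> dotn (dep_row A C 6) T = 0 \<and>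
     (\<forall>k. dotn (lin_row A C k v) T = 0)}"

lemma dotn_limb_row: "dotn (limb_row A C i) (stack \<Omega> V) = dot (cross (A$i) (C$i)) \<Omega> + dot (C$i) V"
  by (simp add: limb_row_def dotn_stack)

lemma dotn_lin_row:
  "dotn (lin_row A C 1 v) (stack \<Omega> V) = dot (dir v) V"
  "dotn (lin_row A C 2 v) (stack \<Omega> V) =
     v$1 * dotn (limb_row A C 2) (stack \<Omega> V) + dot (cross (A$2) (dir v)) \<Omega>"
  "dotn (lin_row A C 3 v) (stack \<Omega> V) =
     v$1 * dotn (limb_row A C 3) (stack \<Omega> V) + dot (cross (A$3) (dir v)) \<Omega>"
  "dotn (lin_row A C 4 v) (stack \<Omega> V) =
     v$1 * dotn (limb_row A C 4) (stack \<Omega> V) + dot (cross (A$4) (dir v)) \<Omega>"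
  "dotn (lin_row A C 5 v) (stack \<Omega> V) =
     mixed (dir v) (A$3) (A$4) * dotn (limb_row A C 2) (stack \<Omega> V)
     + mixed (dir v) (A$4) (A$2) * dotn (limb_row A C 3) (stack \<Omega> V)
     + mixed (dir v) (A$2) (A$3) * dotn (limb_row A C 4) (stack \<Omega> V)"
  by (simp_all add: lin_row_def dotn_simps dotn_stack dot_3)

lemma cross_zero_imp_parallel:
  fixes u v :: "'a::field^3"
  assumes "cross u v = 0" "u \<noteq> 0"
  obtains t where "v = t *s u"
proof -
  have e: "u$2 * v$3 = u$3 * v$2" "u$3 * v$1 = u$1 * v$3" "u$1 * v$2 = u$2 * v$1"
    using assms(1) by (simp_all add: vec_eq_iff forall_3)
  obtain i where i: "u$i \<noteq> 0" using assms(2) by (auto simp: vec_eq_iff)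
  have "u$i * v$j = v$i * u$j" for j
    using e exhaust_3[of i] exhaust_3[of j] by (auto simp: mult.commute)
  then have "v = (v$i / u$i) *s u"
    using i by (simp add: vec_eq_iff field_simps)
  then show thesis by (rule that)
qed

context
  fixes A C :: "'a::field^3^6" and \<alpha> \<beta> :: "6 \<Rightarrow> 'a"
  assumes zero: "A$1 = 0" "C$1 = 0"
    and A5: "A$5 = (\<Sum>i\<in>{2,3,4}. \<alpha> i *s A$i)" and A6: "A$6 = (\<Sum>i\<in>{2,3,4}. \<beta> i *s A$i)"
    and D: "mixed (A$2) (A$3) (A$4) \<noteq> 0"
begin

text \<open>The brackets in \<open>dep_row\<close> are Cramer's rule for alpha and beta with the
  denominator cleared, which keeps the minors polynomial in the architecture. Up to this nonzero
  factor the two conditions are the linear equations of the quadric.\<close>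

lemma dotn_dep_row:
  "dotn (dep_row A C 5) T = mixed (A$2) (A$3) (A$4) *
     (dotn (limb_row A C 5) T - (\<Sum>i\<in>{2,3,4}. \<alpha> i * dotn (limb_row A C i) T))"
  "dotn (dep_row A C 6) T = mixed (A$2) (A$3) (A$4) *
     (dotn (limb_row A C 6) T - (\<Sum>i\<in>{2,3,4}. \<beta> i * dotn (limb_row A C i) T))"
proof -
  have "mixed (A$5) (A$3) (A$4) = \<alpha> 2 * mixed (A$2) (A$3) (A$4)"
    "mixed (A$2) (A$5) (A$4) = \<alpha> 3 * mixed (A$2) (A$3) (A$4)"
    "mixed (A$2) (A$3) (A$5) = \<alpha> 4 * mixed (A$2) (A$3) (A$4)"
    "mixed (A$6) (A$3) (A$4) = \<beta> 2 * mixed (A$2) (A$3) (A$4)"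
    "mixed (A$2) (A$6) (A$4) = \<beta> 3 * mixed (A$2) (A$3) (A$4)"
    "mixed (A$2) (A$3) (A$6) = \<beta> 4 * mixed (A$2) (A$3) (A$4)"
    unfolding A5 A6 by (simp_all add: mixed_3 algebra_simps)
  then show "dotn (dep_row A C 5) T = mixed (A$2) (A$3) (A$4) *
     (dotn (limb_row A C 5) T - (\<Sum>i\<in>{2,3,4}. \<alpha> i * dotn (limb_row A C i) T))"
    "dotn (dep_row A C 6) T = mixed (A$2) (A$3) (A$4) *
     (dotn (limb_row A C 6) T - (\<Sum>i\<in>{2,3,4}. \<beta> i * dotn (limb_row A C i) T))"
    by (simp_all add: dep_row_def dotn_simps algebra_simps)
qed

text \<open>Cramer's rule expresses [A_2, A_3, A_4] P in terms of A_2, A_3, A_4; taking the cross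
  product with Q and then the dot product with Omega gives the identity.\<close>

lemma cramer_cross:
  "mixed P (A$3) (A$4) * dot (cross (A$2) Q) \<Omega> + mixed P (A$4) (A$2) * dot (cross (A$3) Q) \<Omega>
     + mixed P (A$2) (A$3) * dot (cross (A$4) Q) \<Omega> = mixed (A$2) (A$3) (A$4) * dot (cross P Q) \<Omega>"
  by (simp add: mixed_3 dot_3 algebra_simps)

lemma cross_eq_0I:
  assumes "dot (cross (A$2) P) \<Omega> = 0" "dot (cross (A$3) P) \<Omega> = 0" "dot (cross (A$4) P) \<Omega> = 0"
  shows "cross P \<Omega> = 0"
proof -
  have "mixed (A$2) (A$3) (A$4) * dot (cross Q P) \<Omega> = 0" for Q
    using cramer_cross[of Q P \<Omega>] assms by simp
  then have "dot (cross Q P) \<Omega> = 0" for Q using D by simp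
  from this[of "vector [1,0,0]"] this[of "vector [0,1,0]"] this[of "vector [0,0,1]"]
  show ?thesis by (simp add: vec_eq_iff forall_3 dot_3 algebra_simps)
qed

text \<open>The first limb says that P and V are orthogonal, so the term \<open>dot P V\<close>
  drops out of the other conditions. The remaining terms in P obey the linear relations among the
  base points, which makes limbs 5 and 6 equivalent to the two constant rows. Row 5 follows from
  rows 2 to 4 because P x P = 0.\<close>

lemma rec_kernel_affine: "rec_kernel A C (vector [1, P$1, P$2, P$3]) = Rec A C P"
proof -
  let ?v = "vector [1, P$1, P$2, P$3] :: 'a^4"
  have dirv: "dir ?v = P" by (simp add: vec_eq_iff forall_3)
  have "stack \<Omega> V \<in> rec_kernel A C ?v \<longleftrightarrow> reciprocal A C P \<Omega> V" for \<Omega> V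
  proof -
    let ?L = "\<lambda>i. dotn (limb_row A C i) (stack \<Omega> V)"
    let ?M = "\<lambda>i. dot (cross (A$i) P) \<Omega>"
    have rec: "dot (C$i + P) V + dot (cross (A$i) (C$i + P)) \<Omega> = ?L i + ?M i + dot P V" for i
      by (simp add: dotn_limb_row dot_3 algebra_simps)
    have M: "?M 5 = (\<Sum>i\<in>{2,3,4}. \<alpha> i * ?M i)" "?M 6 = (\<Sum>i\<in>{2,3,4}. \<beta> i * ?M i)"
      unfolding A5 A6 by (simp_all add: dot_3 algebra_simps)
    have one: "?L 1 + ?M 1 = 0" by (simp add: dotn_limb_row zero dot_3)
    have R: "reciprocal A C P \<Omega> V \<longleftrightarrow> dot P V = 0 \<and> (\<forall>i\<in>{2,3,4,5,6}. ?L i + ?M i = 0)"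
      unfolding reciprocal_def rec forall_6 using one by auto
    have K: "stack \<Omega> V \<in> rec_kernel A C ?v \<longleftrightarrow> dot P V = 0 \<and> (\<forall>i\<in>{2,3,4}. ?L i + ?M i = 0) \<and>
       ?L 5 = (\<Sum>i\<in>{2,3,4}. \<alpha> i * ?L i) \<and> ?L 6 = (\<Sum>i\<in>{2,3,4}. \<beta> i * ?L i) \<and>
       mixed P (A$3) (A$4) * ?L 2 + mixed P (A$4) (A$2) * ?L 3 + mixed P (A$2) (A$3) * ?L 4 = 0"
      unfolding rec_kernel_def mem_Collect_eq forall_5 dotn_lin_row dotn_dep_row dirv
      using D by auto
    have cr: "mixed P (A$3) (A$4) * ?M 2 + mixed P (A$4) (A$2) * ?M 3 + mixed P (A$2) (A$3) * ?M 4 = 0"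
      unfolding cramer_cross by (simp add: dot_3)
    show ?thesis
    proof
      assume "stack \<Omega> V \<in> rec_kernel A C ?v"
      then show "reciprocal A C P \<Omega> V"
        unfolding K R using M by (auto simp: add_eq_0_iff2)
    next
      assume r: "reciprocal A C P \<Omega> V"
      then have L: "?L i = - ?M i" if "i \<in> {2,3,4,5,6}" for i
        using that unfolding R by (auto simp: add_eq_0_iff2)
      have "mixed P (A$3) (A$4) * ?L 2 + mixed P (A$4) (A$2) * ?L 3 + mixed P (A$2) (A$3) * ?L 4
         = - (mixed P (A$3) (A$4) * ?M 2 + mixed P (A$4) (A$2) * ?M 3 + mixed P (A$2) (A$3) * ?M 4)"
        by (simp add: L)
      then show "stack \<Omega> V \<in> rec_kernel A C ?v"
        unfolding K cr using r M by (simp add: R L)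
    qed
  qed
  then show ?thesis
    unfolding Rec_def using stack_surj by (auto, metis)
qed

text \<open>Only the quadratic equation needs an argument. If w is nonzero, multiply by w and
  substitute rows 2 to 4: \<open>cramer_cross\<close> turns the sum into a multiple of the product
  of Omega x P with Omega, which is 0. If w = 0, then Omega = t P and the equation is t times row
  5.\<close>

lemma rec_kernel_quadric:
  assumes T: "T \<in> rec_kernel A C v" "T \<noteq> 0" and v: "v \<noteq> 0"
  shows "pt T \<in> quadric A C \<alpha> \<beta>"
proof -
  obtain \<Omega> V where TV: "T = stack \<Omega> V" using stack_surj by blast
  let ?L = "\<lambda>i. dotn (limb_row A C i) (stack \<Omega> V)"
  let ?P = "dir v"
  have Leq: "?L i = dot V (C$i) + mixed \<Omega> (A$i) (C$i)" for i
    by (simp add: dotn_limb_row dot_3 mixed_3 algebra_simps)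
  have K: "v$1 * ?L 2 + dot (cross (A$2) ?P) \<Omega> = 0" "v$1 * ?L 3 + dot (cross (A$3) ?P) \<Omega> = 0"
    "v$1 * ?L 4 + dot (cross (A$4) ?P) \<Omega> = 0"
    "mixed ?P (A$3) (A$4) * ?L 2 + mixed ?P (A$4) (A$2) * ?L 3 + mixed ?P (A$2) (A$3) * ?L 4 = 0"
    and L5: "?L 5 = (\<Sum>i\<in>{2,3,4}. \<alpha> i * ?L i)" and L6: "?L 6 = (\<Sum>i\<in>{2,3,4}. \<beta> i * ?L i)"
    using T(1) D unfolding TV rec_kernel_def mem_Collect_eq forall_5 dotn_lin_row dotn_dep_row by auto
  have q3: "mixed \<Omega> (A$3) (A$4) * ?L 2 + mixed \<Omega> (A$4) (A$2) * ?L 3 + mixed \<Omega> (A$2) (A$3) * ?L 4 = 0"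
    (is "?q = 0")
  proof (cases "v$1 = 0")
    case True
    then have "cross ?P \<Omega> = 0" using K by (intro cross_eq_0I) simp_all
    moreover have "?P \<noteq> 0" using v True by (auto simp: vec_eq_iff forall_3 forall_4)
    ultimately obtain t where t: "\<Omega> = t *s ?P" by (rule cross_zero_imp_parallel)
    have "mixed \<Omega> x y = t * mixed ?P x y" for x y
      unfolding t by (simp add: mixed_3 algebra_simps)
    then have "?q = t * (mixed ?P (A$3) (A$4) * ?L 2 + mixed ?P (A$4) (A$2) * ?L 3 + mixed ?P (A$2) (A$3) * ?L 4)"
      by (simp add: algebra_simps)
    then show ?thesis unfolding K(4) by simp
  next
    case False
    have "v$1 * ?q = mixed \<Omega> (A$3) (A$4) * (v$1 * ?L 2) + mixed \<Omega> (A$4) (A$2) * (v$1 * ?L 3)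
       + mixed \<Omega> (A$2) (A$3) * (v$1 * ?L 4)"
      by (simp add: algebra_simps)
    also have "\<dots> = - (mixed \<Omega> (A$3) (A$4) * dot (cross (A$2) ?P) \<Omega>
       + mixed \<Omega> (A$4) (A$2) * dot (cross (A$3) ?P) \<Omega> + mixed \<Omega> (A$2) (A$3) * dot (cross (A$4) ?P) \<Omega>)"
      using K(1-3) by (simp add: eq_neg_iff_add_eq_0[symmetric] del: minus_add_distrib)
    also have "\<dots> = 0"
      unfolding cramer_cross by (simp add: dot_3 algebra_simps)
    finally show ?thesis using False by simp
  qed
  have q1: "dot V (C$5 - (\<Sum>i\<in>{2,3,4}. \<alpha> i *s C$i)) + mixed \<Omega> (A$5) (C$5)
       - (\<Sum>i\<in>{2,3,4}. \<alpha> i * mixed \<Omega> (A$i) (C$i)) = 0"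
    using L5 unfolding Leq by (simp add: dot_3 algebra_simps)
  have q2: "dot V (C$6 - (\<Sum>i\<in>{2,3,4}. \<beta> i *s C$i)) + mixed \<Omega> (A$6) (C$6)
       - (\<Sum>i\<in>{2,3,4}. \<beta> i * mixed \<Omega> (A$i) (C$i)) = 0"
    using L6 unfolding Leq by (simp add: dot_3 algebra_simps)
  show ?thesis
    unfolding quadric_def mem_Collect_eq TV
    using T(2) q1 q2 q3[unfolded Leq] TV by (intro exI[of _ \<Omega>] exI[of _ V] conjI refl) simp_all
qed

text \<open>Writing Omega = t P, the vector (t, V) is orthogonal to (g5, D5), (g6, D6) and (g0, CP).
  As P is nonzero, \<open>nz\<close> says that these three vectors are independent, so (t, V) lies
  on the line of their generalised cross product.\<close>

lemma rec_kernel_infinite: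
  assumes T: "T \<in> rec_kernel A C (vector [0, P$1, P$2, P$3])" and P: "P \<noteq> 0"
    and twelve: "(12::'a) \<noteq> 0"
    and nz: "stack (Omega_inf A C P) (V_inf A C P) \<noteq> 0"
  shows "T \<in> pt (stack (Omega_inf A C P) (V_inf A C P))"
proof -
  let ?v = "vector [0, P$1, P$2, P$3] :: 'a^4"
  have dirv: "dir ?v = P" by (simp add: vec_eq_iff forall_3)
  obtain \<Omega> V where TV: "T = stack \<Omega> V" using stack_surj by blast
  define D5 where "D5 = C$5 - (\<Sum>i\<in>{2,3,4}. \<alpha> i *s C$i)"
  define D6 where "D6 = C$6 - (\<Sum>i\<in>{2,3,4}. \<beta> i *s C$i)"
  define CP where "CP = mixed P (A$3) (A$4) *s C$2 + mixed P (A$4) (A$2) *s C$3 + mixed P (A$2) (A$3) *s C$4"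
  define g5 where "g5 = mixed P (A$5) (C$5) - (\<Sum>i\<in>{2,3,4}. \<alpha> i * mixed P (A$i) (C$i))"
  define g6 where "g6 = mixed P (A$6) (C$6) - (\<Sum>i\<in>{2,3,4}. \<beta> i * mixed P (A$i) (C$i))"
  define g0 where "g0 = mixed P (A$3) (A$4) * mixed P (A$2) (C$2) + mixed P (A$4) (A$2) * mixed P (A$3) (C$3)
      + mixed P (A$2) (A$3) * mixed P (A$4) (C$4)"
  let ?L = "\<lambda>i. dotn (limb_row A C i) (stack \<Omega> V)"
  have K: "dot (cross (A$2) P) \<Omega> = 0" "dot (cross (A$3) P) \<Omega> = 0" "dot (cross (A$4) P) \<Omega> = 0"
    "mixed P (A$3) (A$4) * ?L 2 + mixed P (A$4) (A$2) * ?L 3 + mixed P (A$2) (A$3) * ?L 4 = 0"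
    and L5: "?L 5 = (\<Sum>i\<in>{2,3,4}. \<alpha> i * ?L i)" and L6: "?L 6 = (\<Sum>i\<in>{2,3,4}. \<beta> i * ?L i)"
    using T D unfolding TV rec_kernel_def mem_Collect_eq forall_5 dotn_lin_row dotn_dep_row dirv by auto
  obtain t where t: "\<Omega> = t *s P"
    using cross_zero_imp_parallel[OF cross_eq_0I[OF K(1-3)] P] by blast
  have Leq: "?L i = dot V (C$i) + t * mixed P (A$i) (C$i)" for i
    unfolding t by (simp add: dotn_limb_row dot_3 mixed_3 algebra_simps)
  have V5: "dot V D5 = - (t * g5)" and V6: "dot V D6 = - (t * g6)"
    using L5 L6 unfolding Leq D5_def D6_def g5_def g6_def
    by (simp_all add: dot_3 algebra_simps eq_neg_iff_add_eq_0)
  have V0: "dot V CP = - (t * g0)"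
    using K(4) unfolding Leq CP_def g0_def by (simp add: dot_3 algebra_simps eq_neg_iff_add_eq_0)
  define N where "N = g5 *s cross D6 CP + g6 *s cross CP D5 + g0 *s cross D5 D6"
  have Vinf: "V_inf A C P = N" and Oinf: "Omega_inf A C P = (- mixed D5 D6 CP) *s P"
    using V_inf_eq[OF zero A5 A6 twelve, of P] Omega_inf_eq[OF zero A5 A6 twelve, of P]
    unfolding N_def D5_def D6_def CP_def g5_def g6_def g0_def by auto
  \<comment> \<open>Cramer's rule recovers V from its products with D5, D6 and CP.\<close>
  have eq1: "mixed D5 D6 CP *s V = (- t) *s N"
  proof -
    have "mixed D5 D6 CP *s V = dot V D5 *s cross D6 CP + dot V D6 *s cross CP D5 + dot V CP *s cross D5 D6"
      by (simp add: vec_eq_iff forall_3 mixed_3 dot_3 algebra_simps)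
    also have "\<dots> = (- t) *s N"
      unfolding V5 V6 V0 N_def by (simp add: vec_eq_iff algebra_simps)
    finally show ?thesis .
  qed
  show ?thesis
  proof (cases "mixed D5 D6 CP = 0")
    case False
    have "T = (- t / mixed D5 D6 CP) *s stack (Omega_inf A C P) (V_inf A C P)"
    proof -
      have "V = (- t / mixed D5 D6 CP) *s N"
        using eq1 False by (simp add: vec_eq_iff field_simps)
      then show ?thesis
        unfolding TV Vinf Oinf t using False by (simp add: vec_eq_iff forall_6)
    qed
    then show ?thesis unfolding pt_def by blast
  next
    \<comment> \<open>The first component of the cross product vanishes, so \<open>N\<close> is
      nonzero and t = 0. Then V is orthogonal to D5, D6 and CP, and the triple product expansion of
      N x V is zero.\<close>
    case True
    then have N: "N \<noteq> 0" using nz unfolding Vinf Oinf by (auto simp: vec_eq_iff forall_6 forall_3)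
    then have t0: "t = 0" using eq1 True by (simp add: vec_eq_iff) auto
    have "cross N V = 0"
    proof -
      have "cross N V = g5 *s (dot V D6 *s CP - dot V CP *s D6) + g6 *s (dot V CP *s D5 - dot V D5 *s CP)
        + g0 *s (dot V D5 *s D6 - dot V D6 *s D5)"
        unfolding N_def by (simp add: vec_eq_iff forall_3 dot_3 algebra_simps)
      then show ?thesis unfolding V5 V6 V0 t0 by simp
    qed
    then obtain r where "V = r *s N" using N by (rule cross_zero_imp_parallel)
    then have "T = r *s stack (Omega_inf A C P) (V_inf A C P)"
      unfolding TV Vinf Oinf t t0 True by (simp add: vec_eq_iff forall_6)
    then show ?thesis unfolding pt_def by blast
  qed
qed

end

section \<open>Homogeneous coordinates and kernels\<close>

lemma pt_self: "v \<in> pt v"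
  unfolding pt_def by (rule image_eqI[of _ _ 1]) simp_all

lemma pt_eqD:
  assumes "pt v = pt v'" "v \<noteq> 0"
  obtains c where "c \<noteq> 0" "v = c *s v'"
proof -
  have "v \<in> pt v'" using pt_self[of v] assms(1) by simp
  then obtain c where "v = c *s v'" by (auto simp: pt_def)
  moreover from this assms(2) have "c \<noteq> 0" by auto
  ultimately show thesis by (intro that)
qed

lemma rec_kernel_scale:
  fixes A C :: "'a::field^3^6"
  assumes "c \<noteq> 0"
  shows "rec_kernel A C (c *s v) = rec_kernel A C v"
  using assms by (simp add: rec_kernel_def lin_row_scale dotn_simps)

lemma rec_kernel_smult: "T \<in> rec_kernel A C v \<Longrightarrow> c *s T \<in> rec_kernel A C v"
  by (simp add: rec_kernel_def dotn_simps)

lemma minor_vec_scale: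
  fixes A C :: "'a::field^3^6"
  shows "minor_vec A C k l m (c *s v) (c *s v) (c *s v) = (c * c * c) *s minor_vec A C k l m v v v"
proof -
  have "minor_vec A C k l m (c *s v) (c *s v) (c *s v) $ i = (c * c * c) * minor_vec A C k l m v v v $ i" for i
    unfolding minor_vec_expand[of A C k l m "c *s v"] minor_vec_expand[of A C k l m v]
    by (simp add: sum_distrib_left mult_ac)
  then show ?thesis by (simp add: vec_eq_iff)
qed

lemma det6_eq_0_kernel:
  fixes T :: "'a::field^6"
  assumes "T \<noteq> 0" "dotn r1 T = 0" "dotn r2 T = 0" "dotn r3 T = 0" "dotn r4 T = 0" "dotn r5 T = 0" "dotn r6 T = 0"
  shows "det6 r1 r2 r3 r4 r5 r6 = 0"
proof (rule ccontr)
  assume "det6 r1 r2 r3 r4 r5 r6 \<noteq> 0"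
  then have "T = 0"
    unfolding det6_def by (rule det_nonzero_kernel) (use assms in simp)
  then show False using assms(1) by simp
qed

text \<open>The kernel lies in the line of the minors by \<open>wedge5_kernel\<close>; being nonzero
  and closed under scaling, it is the whole line.\<close>

lemma rec_kernel_eq_pt:
  fixes A C :: "'a::field^3^6"
  assumes G: "minor_vec A C k l m v v v \<noteq> 0" and T: "T \<in> rec_kernel A C v" "T \<noteq> 0"
  shows "rec_kernel A C v = pt (minor_vec A C k l m v v v)"
proof
  show sub: "rec_kernel A C v \<subseteq> pt (minor_vec A C k l m v v v)"
    using G unfolding minor_vec_def rec_kernel_def by (auto intro: wedge5_kernel)
  obtain r where r: "T = r *s minor_vec A C k l m v v v"
    using sub T(1) by (auto simp: pt_def)
  then have "r \<noteq> 0" using T(2) by auto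
  then have "minor_vec A C k l m v v v = inverse r *s T" by (simp add: r)
  then have "minor_vec A C k l m v v v \<in> rec_kernel A C v" using rec_kernel_smult[OF T(1)] by simp
  then show "pt (minor_vec A C k l m v v v) \<subseteq> rec_kernel A C v"
    using rec_kernel_smult by (auto simp: pt_def)
qed

lemma ring_map_so3_const: "ring_map so3_const"
  by (auto simp: ring_map_def so3_const.rep_eq one_so3_fun.rep_eq plus_so3_fun.rep_eq
      times_so3_fun.rep_eq fun_eq_iff simp flip: Rep_so3_fun_inject)

lemma ring_map_real_to_Kbar: "ring_map (\<lambda>c. to_ac (real_to_K c))"
  using ring_map_so3_const ring_map_so3_to_Kbar
  by (simp add: ring_map_def real_to_K_def so3_to_Kbar_def)

text \<open>The constant 12 in \<open>so3_fun\<close> evaluates at the identity to the real number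
  12, so it is nonzero there, and the embedding into the closure has zero kernel.\<close>

lemma Kbar_12_nonzero: "(12 :: Kbar) \<noteq> 0"
proof -
  have "so3_at_id (of_int 12) = 12" using ring_map_of_int[OF ring_map_so3_at_id, of 12] by simp
  then have "(of_int 12 :: so3_fun) \<noteq> 0" using ring_mapD(4)[OF ring_map_so3_at_id] by force
  then have "so3_to_Kbar (of_int 12) \<noteq> 0" by (simp only: so3_to_Kbar_eq_0 not_False_eq_True)
  then show ?thesis using ring_map_of_int[OF ring_map_so3_to_Kbar, of 12] by simp
qed

section \<open>The extended mapping over the algebraic closure of K\<close>

context
  fixes A C :: "Kbar^3^6" and \<alpha> \<beta> :: "6 \<Rightarrow> Kbar" and s
  assumes rational: "rational_family A" "rational_family C"
    and zero: "A$1 = 0" "C$1 = 0"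
    and A5: "A$5 = (\<Sum>i\<in>{2,3,4}. \<alpha> i *s A$i)" and A6: "A$6 = (\<Sum>i\<in>{2,3,4}. \<beta> i *s A$i)"
    and generic: "tensor_det s A C \<noteq> 0"
begin

lemma base_independent: "mixed (A$2) (A$3) (A$4) \<noteq> 0"
  using generic by (auto simp: tensor_det_def)

text \<open>The quartic minors vanish on the affine surface, hence on its closure. At a point of the
  closure, a nonzero vector of cubic minors is orthogonal to the five rows that define it, and the
  vanishing quartics make it orthogonal to every other row.\<close>

lemma Sigma_proj_kernel:
  assumes "pt v \<in> Sigma_proj A C" "v \<noteq> 0"
  obtains T where "T \<noteq> 0" "T \<in> rec_kernel A C v"
proof -
  let ?minor = "\<lambda>n k l m v. det6 (lin_row A C n v) (dep_row A C 5) (dep_row A C 6)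
     (lin_row A C k v) (lin_row A C l v) (lin_row A C m v)"
  define F :: "(4, so3_field) mpoly set" where
    "F = {p. homogeneous 4 p \<and> (\<exists>n k l m. \<forall>v. peval p v = ?minor n k l m v)}"
  define Z where "Z = {pt v | v. v \<noteq> 0 \<and> (\<forall>p\<in>F. peval p v = 0)}"
  have "zariski_closed Z"
    unfolding zariski_closed_def Z_def by (rule exI[of _ F]) (auto simp: F_def)
  moreover have "affine_pt ` Sigma_aff A C \<subseteq> Z"
  proof
    fix x assume "x \<in> affine_pt ` Sigma_aff A C"
    then obtain P where P: "det (Jac A C P) = 0" and x: "x = affine_pt P"
      by (auto simp: Sigma_aff_def)
    let ?v = "vector [1, P$1, P$2, P$3] :: Kbar^4"
    from P obtain T where T: "T \<noteq> 0" "Jac A C P *v T = 0"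
      by (metis invertible_det_nz invertible_left_inverse matrix_left_invertible_ker)
    \<comment> \<open>The rows of \<open>Jac\<close> list direction before moment, so a kernel
      vector has V before Omega; the twist swaps the halves.\<close>
    obtain \<Omega> V where TV: "T = stack V \<Omega>" using stack_surj by blast
    have "reciprocal A C P \<Omega> V"
      unfolding reciprocal_def
    proof
      fix i
      have "(Jac A C P *v T) $ i = dotn (stack (C$i + P) (cross (A$i) (C$i + P))) T"
        by (simp add: matrix_vector_mult_def Jac_def dotn_def)
      then show "dot (C$i + P) V + dot (cross (A$i) (C$i + P)) \<Omega> = 0"
        unfolding T(2) by (simp add: TV dotn_stack)
    qed
    then have "stack \<Omega> V \<in> rec_kernel A C ?v"
      unfolding rec_kernel_affine[OF zero A5 A6 base_independent] Rec_def by blast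
    moreover have "stack \<Omega> V \<noteq> 0"
      using T(1) unfolding TV by (auto simp: vec_eq_iff forall_6)
    ultimately have "?minor n k l m ?v = 0" for n k l m
      by (intro det6_eq_0_kernel[of "stack \<Omega> V"]) (auto simp: rec_kernel_def)
    moreover have "?v \<noteq> 0"
      by (metis vector_4(1) zero_index zero_neq_one)
    ultimately show "x \<in> Z"
      unfolding x affine_pt_def Z_def by (auto simp: F_def)
  qed
  ultimately have "pt v \<in> Z"
    using assms(1) unfolding Sigma_proj_def zariski_closure_def by blast
  then obtain v' where v': "pt v = pt v'" "v' \<noteq> 0" "\<forall>p\<in>F. peval p v' = 0"
    unfolding Z_def by blast
  have minors: "?minor n k l m v' = 0" for n k l m
  proof -
    obtain p where "homogeneous 4 p" "\<And>v. peval p v = ?minor n k l m v"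
      using homogeneous_fun_maximal_minor[OF rational, of n k l m] unfolding homogeneous_fun_def by blast
    then have "p \<in> F" unfolding F_def by blast
    then show ?thesis using v'(3) \<open>\<And>v. peval p v = ?minor n k l m v\<close> by metis
  qed
  obtain k l m where G: "minor_vec A C k l m v' v' v' \<noteq> 0"
    using minor_vec_nonzero[OF generic v'(2)] by blast
  have "minor_vec A C k l m v' v' v' \<in> rec_kernel A C v'"
    by (simp add: rec_kernel_def minor_vec_def dotn_wedge5 det6_eq_0 minors)
  moreover obtain c where "c \<noteq> 0" "v = c *s v'" using pt_eqD[OF v'(1) assms(2)] .
  ultimately have "minor_vec A C k l m v' v' v' \<in> rec_kernel A C v" by (simp add: rec_kernel_scale)
  with G show thesis by (rule that)
qed

text \<open>Intersecting over the whole line avoids a choice of coordinates: nonzero multiples have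
  the same kernel, and the zero vector imposes only the two constant rows.\<close>

definition rec_proj :: "(Kbar^4) set \<Rightarrow> (Kbar^6) set" where
  "rec_proj x = (\<Inter>v\<in>x. rec_kernel A C v)"

lemma rec_proj_pt: "rec_proj (pt v) = rec_kernel A C v"
proof
  show "rec_proj (pt v) \<subseteq> rec_kernel A C v"
    unfolding rec_proj_def using pt_self by blast
  have "rec_kernel A C v \<subseteq> rec_kernel A C (c *s v)" for c
    by (auto simp: rec_kernel_def lin_row_scale dotn_simps)
  then show "rec_kernel A C v \<subseteq> rec_proj (pt v)"
    unfolding rec_proj_def pt_def by blast
qed

lemma Sigma_proj_cases:
  assumes "x \<in> Sigma_proj A C"
  obtains v where "v \<noteq> 0" "x = pt v"
proof -
  \<comment> \<open>With no equations, this is the whole projective space, a closed set without the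
    degenerate line spanned by 0.\<close>
  define Z :: "(Kbar^4) set set" where "Z = {pt v | v. v \<noteq> 0 \<and> (\<forall>p\<in>{} :: (4, so3_field) mpoly set. peval p v = 0)}"
  have "zariski_closed Z" unfolding zariski_closed_def Z_def by blast
  moreover have "affine_pt ` Sigma_aff A C \<subseteq> Z"
  proof
    fix x assume "x \<in> affine_pt ` Sigma_aff A C"
    then obtain P :: "Kbar^3" where "x = pt (vector [1, P$1, P$2, P$3])" by (auto simp: affine_pt_def)
    moreover have "(vector [1, P$1, P$2, P$3] :: Kbar^4) \<noteq> 0"
      by (metis vector_4(1) zero_index zero_neq_one)
    ultimately show "x \<in> Z" unfolding Z_def by blast
  qed
  ultimately have "x \<in> Z" using assms unfolding Sigma_proj_def zariski_closure_def by blast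
  then show thesis using that unfolding Z_def by blast
qed

lemma regular_mapping_rec_proj: "regular_mapping (Sigma_proj A C) (quadric A C \<alpha> \<beta>) rec_proj"
  unfolding regular_mapping_def
proof (intro conjI ballI)
  show "rec_proj ` Sigma_proj A C \<subseteq> quadric A C \<alpha> \<beta>"
  proof
    fix y assume "y \<in> rec_proj ` Sigma_proj A C"
    then obtain x where x: "x \<in> Sigma_proj A C" "y = rec_proj x" by blast
    obtain v where v: "v \<noteq> 0" "x = pt v" using Sigma_proj_cases[OF x(1)] .
    obtain T where T: "T \<noteq> 0" "T \<in> rec_kernel A C v" using Sigma_proj_kernel x(1) v by blast
    obtain k l m where G: "minor_vec A C k l m v v v \<noteq> 0" using minor_vec_nonzero[OF generic v(1)] by blast
    have y: "y = pt (minor_vec A C k l m v v v)"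
      unfolding x(2) v(2) rec_proj_pt by (rule rec_kernel_eq_pt[OF G T(2,1)])
    then have "minor_vec A C k l m v v v \<in> rec_kernel A C v"
      using pt_self rec_kernel_eq_pt[OF G T(2,1)] by blast
    then show "y \<in> quadric A C \<alpha> \<beta>"
      unfolding y using rec_kernel_quadric[OF zero A5 A6 base_independent] G v(1) by blast
  qed
next
  fix x assume x: "x \<in> Sigma_proj A C"
  obtain v0 where v0: "v0 \<noteq> 0" "x = pt v0" using Sigma_proj_cases[OF x] .
  obtain k l m where G0: "minor_vec A C k l m v0 v0 v0 \<noteq> 0" using minor_vec_nonzero[OF generic v0(1)] by blast
  obtain F :: "6 \<Rightarrow> (4, so3_field) mpoly" where
    F: "\<And>j. homogeneous 3 (F j)" "\<And>j v. peval (F j) v = minor_vec A C k l m v v v $ j"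
    using homogeneous_fun_minor_vec[OF rational, of k l m] unfolding homogeneous_fun_def by metis
  have Fv: "(\<chi> j. peval (F j) v) = minor_vec A C k l m v v v" for v by (simp add: F(2))
  define Z where "Z = {pt v | v. v \<noteq> 0 \<and> (\<forall>p\<in>range F. peval p v = 0)}"
  \<comment> \<open>Membership in \<open>Z\<close> can be tested on any coordinates, since the
    minors scale by a cube.\<close>
  have Z: "pt v \<notin> Z \<longleftrightarrow> minor_vec A C k l m v v v \<noteq> 0" if "v \<noteq> 0" for v
  proof -
    have "minor_vec A C k l m v v v = 0" if eq: "pt v = pt v'" and v': "\<forall>p\<in>range F. peval p v' = 0" for v'
    proof -
      have "minor_vec A C k l m v' v' v' = 0" using v' by (simp add: F(2) vec_eq_iff)
      moreover obtain c where "v = c *s v'" using pt_eqD[OF eq \<open>v \<noteq> 0\<close>] .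
      ultimately show ?thesis by (simp add: minor_vec_scale)
    qed
    moreover have "pt v \<in> Z" if "minor_vec A C k l m v v v = 0"
      using that \<open>v \<noteq> 0\<close> unfolding Z_def mem_Collect_eq by (intro exI[of _ v]) (simp add: F(2))
    ultimately show ?thesis unfolding Z_def by blast
  qed
  show "\<exists>Z d. \<exists>F :: 6 \<Rightarrow> (4, so3_field) mpoly.
      zariski_closed Z \<and> x \<notin> Z \<and> (\<forall>j. homogeneous d (F j)) \<and>
      (\<forall>v. v \<noteq> 0 \<and> pt v \<in> Sigma_proj A C - Z \<longrightarrow>
         (\<chi> j. peval (F j) v) \<noteq> 0 \<and> rec_proj (pt v) = pt (\<chi> j. peval (F j) v))"
  proof (intro exI conjI allI impI)
    show "zariski_closed Z"
      unfolding zariski_closed_def Z_def by (rule exI[of _ "range F"]) (use F(1) in auto)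
    show "x \<notin> Z" using Z[OF v0(1)] G0 v0(2) by simp
    show "homogeneous 3 (F j)" for j by (rule F(1))
    fix v assume v: "v \<noteq> 0 \<and> pt v \<in> Sigma_proj A C - Z"
    then have G: "minor_vec A C k l m v v v \<noteq> 0" using Z by blast
    then show "(\<chi> j. peval (F j) v) \<noteq> 0" unfolding Fv .
    obtain T where T: "T \<noteq> 0" "T \<in> rec_kernel A C v" using Sigma_proj_kernel v by blast
    show "rec_proj (pt v) = pt (\<chi> j. peval (F j) v)"
      unfolding Fv rec_proj_pt by (rule rec_kernel_eq_pt[OF G T(2,1)])
  qed
qed

lemma rec_proj_affine: "rec_proj (affine_pt P) = Rec A C P"
  unfolding affine_pt_def rec_proj_pt by (rule rec_kernel_affine[OF zero A5 A6 base_independent])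

lemma rec_proj_infinite:
  assumes P: "P \<noteq> 0" "infinite_pt P \<in> Sigma_proj A C"
    and nz: "stack (Omega_inf A C P) (V_inf A C P) \<noteq> 0"
  shows "rec_proj (infinite_pt P) = pt (stack (Omega_inf A C P) (V_inf A C P))"
proof -
  let ?v = "vector [0, P$1, P$2, P$3] :: Kbar^4"
  let ?T = "stack (Omega_inf A C P) (V_inf A C P)"
  have v: "?v \<noteq> 0" using P(1) by (auto simp: vec_eq_iff forall_3 forall_4)
  obtain T where T: "T \<noteq> 0" "T \<in> rec_kernel A C ?v"
    using Sigma_proj_kernel[OF _ v] P(2) unfolding infinite_pt_def by blast
  have sub: "rec_kernel A C ?v \<subseteq> pt ?T"
    using rec_kernel_infinite[OF zero A5 A6 base_independent _ P(1) Kbar_12_nonzero nz] by blast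
  then obtain r where r: "T = r *s ?T" using T(2) by (auto simp: pt_def)
  then have "r \<noteq> 0" using T(1) by auto
  then have "?T = inverse r *s T" by (simp add: r)
  then have "?T \<in> rec_kernel A C ?v" using rec_kernel_smult[OF T(2)] by simp
  then have "pt ?T \<subseteq> rec_kernel A C ?v" using rec_kernel_smult by (auto simp: pt_def)
  then show ?thesis unfolding infinite_pt_def rec_proj_pt using sub by blast
qed

end

lemma to_Kbar_base_lincomb:
  assumes "A$j = (\<Sum>i\<in>S. \<gamma> i *\<^sub>R A$i)"
  shows "to_Kbar (base_pts A) $ j = (\<Sum>i\<in>S. to_ac (real_to_K (\<gamma> i)) *s to_Kbar (base_pts A) $ i)"
  unfolding vec_eq_iff to_Kbar_def base_pts_def
  by (simp add: assms sum_component ring_map_sum[OF ring_map_real_to_Kbar]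
      ring_mapD[OF ring_map_real_to_Kbar])

lemma to_Kbar_first_limb:
  assumes "A$1 = 0" "b$1 = 0"
  shows "to_Kbar (base_pts A) $ 1 = 0" "to_Kbar (limbs A b) $ 1 = 0"
proof -
  have "real_to_K 0 = 0"
    using ring_mapD(4)[OF ring_map_so3_const] by (simp add: real_to_K_def Zero_fract_def)
  then show "to_Kbar (base_pts A) $ 1 = 0" "to_Kbar (limbs A b) $ 1 = 0"
    using assms by (simp_all add: vec_eq_iff to_Kbar_def base_pts_def limbs_def matrix_vector_mult_def)
qed

lemma rational_family_to_Kbar: "rational_family (to_Kbar U)"
  unfolding rational_family_def by (rule exI[of _ U]) (simp add: vec_eq_iff to_Kbar_def)

text \<open>Points of the quadric are lines spanned by nonzero vectors. So the agreement with
  \<open>Rec\<close> on the affine surface also contains the fact that reciprocal twists there form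
  a space of dimension 1.\<close>

theorem proposition12:
  "generic_platform (\<lambda>A b. \<forall>\<alpha> \<beta> :: 6 \<Rightarrow> real.
     A$5 = (\<Sum>i\<in>{2,3,4}. \<alpha> i *\<^sub>R A$i) \<longrightarrow> A$6 = (\<Sum>i\<in>{2,3,4}. \<beta> i *\<^sub>R A$i) \<longrightarrow>
     (let A' = to_Kbar (base_pts A);
          C' = to_Kbar (limbs A b);
          Q = quadric A' C' (\<lambda>i. to_ac (real_to_K (\<alpha> i))) (\<lambda>i. to_ac (real_to_K (\<beta> i)))
      in \<exists>Rech :: (Kbar^4) set \<Rightarrow> (Kbar^6) set.
           regular_mapping (Sigma_proj A' C') Q Rech \<and>
           (\<forall>P\<in>Sigma_aff A' C'. Rech (affine_pt P) = Rec A' C' P) \<and>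
           (\<forall>P. P \<noteq> 0 \<and> infinite_pt P \<in> Sigma_proj A' C' \<and>
                stack (Omega_inf A' C' P) (V_inf A' C' P) \<noteq> 0 \<longrightarrow>
                Rech (infinite_pt P) = pt (stack (Omega_inf A' C' P) (V_inf A' C' P)))))"
proof (rule generic_platform_tensor_det)
  fix s
  assume s: "zariski_open_architectures {(A, b). (A, b) \<in> architectures \<and> tensor_det s A (b - A) \<noteq> 0}"
    "{(A, b). (A, b) \<in> architectures \<and> tensor_det s A (b - A) \<noteq> 0} \<noteq> {}"
    "\<And>A b. tensor_det s A (b - A) \<noteq> 0 \<Longrightarrow> tensor_det s (to_Kbar (base_pts A)) (to_Kbar (limbs A b)) \<noteq> 0"
  show ?thesis
    unfolding generic_platform_def
  proof (rule exI, intro conjI, rule s(1), rule s(2), safe, unfold Let_def)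
    fix A b :: "real^3^6" and \<alpha> \<beta> :: "6 \<Rightarrow> real"
    assume arch: "(A, b) \<in> architectures" and gen: "tensor_det s A (b - A) \<noteq> 0"
      and A5: "A$5 = (\<Sum>i\<in>{2,3,4}. \<alpha> i *\<^sub>R A$i)" and A6: "A$6 = (\<Sum>i\<in>{2,3,4}. \<beta> i *\<^sub>R A$i)"
    have zero: "A$1 = 0" "b$1 = 0" using arch by (auto simp: architectures_def)
    note ctxt = rational_family_to_Kbar rational_family_to_Kbar to_Kbar_first_limb[OF zero]
      to_Kbar_base_lincomb[OF A5] to_Kbar_base_lincomb[OF A6] s(3)[OF gen]
    let ?A = "to_Kbar (base_pts A)" and ?C = "to_Kbar (limbs A b)"
    show "\<exists>Rech. regular_mapping (Sigma_proj ?A ?C)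
          (quadric ?A ?C (\<lambda>i. to_ac (real_to_K (\<alpha> i))) (\<lambda>i. to_ac (real_to_K (\<beta> i)))) Rech \<and>
        (\<forall>P\<in>Sigma_aff ?A ?C. Rech (affine_pt P) = Rec ?A ?C P) \<and>
        (\<forall>P. P \<noteq> 0 \<and> infinite_pt P \<in> Sigma_proj ?A ?C \<and> stack (Omega_inf ?A ?C P) (V_inf ?A ?C P) \<noteq> 0 \<longrightarrow>
          Rech (infinite_pt P) = pt (stack (Omega_inf ?A ?C P) (V_inf ?A ?C P)))"
      using regular_mapping_rec_proj[OF ctxt] rec_proj_affine[OF ctxt] rec_proj_infinite[OF ctxt]
      by blast
  qed
qed

end
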